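(* Let $d\ge1$, let $L_1,\dots,L_m,H\in M_d(\mathbb{C})$ with $H$ self-adjoint, and put $G=-\frac12\sum_{\ell=1}^m L_\ell^*L_\ell-\mathrm{i}H$. For $\xi\in\mathbb{C}^d\setminus\{0\}$ let $(X_t(\xi))_{t\ge0}$ be the unique solution of the linear stochastic Schr\"odinger equation (It\^o sense) $$dX_t(\xi)=GX_t(\xi)\,dt+\sum_{\ell=1}^m L_\ell X_t(\xi)\,dW^\ell_t,\qquad X_0(\xi)=\xi,$$ where $W^1,\dots,W^m$ are independent real-valued Wiener processes on a filtered complete probability space $(\Omega,\mathfrak{F},(\mathfrak{F}_t)_{t\ge0},\mathbb{P})$. The following are equivalent: (1) $\mathcal{S}(\psi)=\mathbb{C}^d$ for all $\psi\in\mathbb{C}^d\setminus\{0\}$; (2) for all $t>0$ and all $\xi\in\mathbb{C}^d\setminus\{0\}$ the essential range of $X_t(\xi)$ is total in $\mathbb{C}^d$.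
   Context: The space $\mathcal{S}(\psi)$: for $A\in M_d(\mathbb{C})$ define recursively $\delta_G^0(A)=A$, $\delta_G^{n+1}(A)=[G,\delta_G^n(A)]$, where $[A,B]=AB-BA$. For non-zero $\psi\in\mathbb{C}^d$, $\mathcal{S}(\psi)$ is the (complex) linear span of $\psi$ and all the vectors $$\delta_G^{n_1}(L_{\ell_1})\delta_G^{n_2}(L_{\ell_2})\cdots\delta_G^{n_k}(L_{\ell_k})\psi,\qquad k\ge1,\ n_1,\dots,n_k\ge0,\ 1\le\ell_1,\dots,\ell_k\le m.$$ The essential range of a $\mathbb{C}^d$-valued random variable $Y$ is the set of all $u\in\mathbb{C}^d$ such that $\mathbb{P}\{Y\in\mathcal{U}\}>0$ for each neighbourhood $\mathcal{U}$ of $u$. A subset of $\mathbb{C}^d$ is total if its complex linear span is $\mathbb{C}^d$. *)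

theory Defs
  imports "HOL-Probability.Probability"
begin

section \<open>Matrices and the space \<open>\<S>(\<psi>)\<close>\<close>

definition adj :: "complex^'d^'d \<Rightarrow> complex^'d^'d" where
  "adj A = map_matrix cnj (transpose A)"

definition commutator :: "complex^'d^'d \<Rightarrow> complex^'d^'d \<Rightarrow> complex^'d^'d" where
  "commutator A B = A ** B - B ** A"

primrec delta :: "complex^'d^'d \<Rightarrow> nat \<Rightarrow> complex^'d^'d \<Rightarrow> complex^'d^'d" where
  "delta G 0 A = A"
| "delta G (Suc n) A = commutator G (delta G n A)"

text \<open>A word \<open>[(n\<^sub>1, l\<^sub>1), \<dots>, (n\<^sub>k, l\<^sub>k)]\<close> encodes the product
  \<open>\<delta>\<^bsup>n\<^sub>1\<^esup>(L l\<^sub>1) \<cdots> \<delta>\<^bsup>n\<^sub>k\<^esup>(L l\<^sub>k) \<psi>\<close>. Note that \<open>vec.span\<close> is the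
  complex linear span, whereas the plain \<open>span\<close> on this type is the real one.\<close>

definition S_space ::
    "nat \<Rightarrow> complex^'d^'d \<Rightarrow> (nat \<Rightarrow> complex^'d^'d) \<Rightarrow> complex^'d \<Rightarrow> (complex^'d) set" where
  "S_space m G L \<psi> = vec.span (insert \<psi>
     {foldr (\<lambda>(n, l) v. delta G n (L l) *v v) w \<psi> | w. w \<noteq> [] \<and> set w \<subseteq> UNIV \<times> {1..m}})"

definition G_op :: "nat \<Rightarrow> (nat \<Rightarrow> complex^'d^'d) \<Rightarrow> complex^'d^'d \<Rightarrow> complex^'d^'d" where
  "G_op m L H = - ((1/2) *\<^sub>R (\<Sum>l=1..m. adj (L l) ** L l)) - map_matrix (\<lambda>z. \<i> * z) H"


section \<open>Filtered probability spaces and Wiener processes\<close>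

text \<open>Time is \<open>[0, \<infinity>)\<close>; processes and filtrations are indexed by \<open>real\<close>,
  and their values at negative times are never used.\<close>

definition filtered_complete_prob_space :: "'w measure \<Rightarrow> (real \<Rightarrow> 'w measure) \<Rightarrow> bool" where
  "filtered_complete_prob_space M F \<longleftrightarrow>
     prob_space M \<and> complete_measure M \<and>
     (\<forall>t\<ge>0. subalgebra M (F t)) \<and> (\<forall>s\<ge>0. \<forall>t\<ge>s. subalgebra (F t) (F s))"

definition increment_sets ::
    "'w measure \<Rightarrow> (real \<Rightarrow> 'w \<Rightarrow> real) \<Rightarrow> real \<Rightarrow> real \<Rightarrow> 'w set set" where
  "increment_sets M w s t = sets (vimage_algebra (space M) (\<lambda>\<omega>. w t \<omega> - w s \<omega>) borel)"

definition wiener_process ::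
    "'w measure \<Rightarrow> (real \<Rightarrow> 'w measure) \<Rightarrow> (real \<Rightarrow> 'w \<Rightarrow> real) \<Rightarrow> bool" where
  "wiener_process M F w \<longleftrightarrow>
     (\<forall>t\<ge>0. w t \<in> borel_measurable (F t)) \<and>
     (AE \<omega> in M. w 0 \<omega> = 0) \<and>
     (AE \<omega> in M. continuous_on {0..} (\<lambda>t. w t \<omega>)) \<and>
     (\<forall>s\<ge>0. \<forall>t>s.
        distributed M lborel (\<lambda>\<omega>. w t \<omega> - w s \<omega>) (normal_density 0 (sqrt (t - s))) \<and>
        prob_space.indep_set M (sets (F s)) (increment_sets M w s t))"

text \<open>Independent Wiener processes relative to a common filtration, i.e. an \<open>m\<close>-dimensional
  Wiener process: over every interval \<open>(s, t]\<close> the past \<open>F s\<close> (index \<open>None\<close>) and the \<open>m\<close>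
  increments (indices \<open>Some l\<close>) are mutually independent. Iterating over successive intervals,
  this includes the independence of the \<open>m\<close> processes.\<close>

definition independent_wiener_processes ::
    "'w measure \<Rightarrow> (real \<Rightarrow> 'w measure) \<Rightarrow> nat \<Rightarrow> (nat \<Rightarrow> real \<Rightarrow> 'w \<Rightarrow> real) \<Rightarrow> bool" where
  "independent_wiener_processes M F m W \<longleftrightarrow>
     (\<forall>l\<in>{1..m}. wiener_process M F (W l)) \<and>
     (\<forall>s\<ge>0. \<forall>t>s. prob_space.indep_sets M
        (\<lambda>i. case i of None \<Rightarrow> sets (F s) | Some l \<Rightarrow> increment_sets M (W l) s t)
        (insert None (Some ` {1..m})))"


section \<open>The Ito integral\<close>

definition conv_in_prob ::
    "'w measure \<Rightarrow> (nat \<Rightarrow> 'w \<Rightarrow> 'b::euclidean_space) \<Rightarrow> ('w \<Rightarrow> 'b) \<Rightarrow> bool" where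
  "conv_in_prob M Z Z' \<longleftrightarrow>
     (\<forall>\<epsilon>>0. (\<lambda>k. measure M {\<omega> \<in> space M. norm (Z k \<omega> - Z' \<omega>) > \<epsilon>}) \<longlonglongrightarrow> 0)"

definition progressively_measurable ::
    "(real \<Rightarrow> 'w measure) \<Rightarrow> (real \<Rightarrow> 'w \<Rightarrow> 'b::euclidean_space) \<Rightarrow> bool" where
  "progressively_measurable F Y \<longleftrightarrow>
     (\<forall>t\<ge>0. (\<lambda>(s, \<omega>). Y s \<omega>) \<in> borel_measurable (restrict_space borel {0..t} \<Otimes>\<^sub>M F t))"

text \<open>The data \<open>n\<close>, \<open>\<tau>\<close>, \<open>\<eta>\<close> stand for the simple process equal to \<open>\<eta> i\<close> on
  \<open>(\<tau> i, \<tau> (i + 1)]\<close> for \<open>i < n\<close> and to \<open>0\<close> elsewhere.\<close>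

definition simple_data ::
    "'w measure \<Rightarrow> (real \<Rightarrow> 'w measure) \<Rightarrow> nat \<Rightarrow> (nat \<Rightarrow> real) \<Rightarrow> (nat \<Rightarrow> 'w \<Rightarrow> 'b::euclidean_space) \<Rightarrow> bool"
  where
  "simple_data M F n \<tau> \<eta> \<longleftrightarrow> 0 \<le> \<tau> 0 \<and>
     (\<forall>i<n. \<tau> i \<le> \<tau> (Suc i) \<and> \<eta> i \<in> borel_measurable (F (\<tau> i)) \<and> bounded (\<eta> i ` space M))"

definition simple_process ::
    "nat \<Rightarrow> (nat \<Rightarrow> real) \<Rightarrow> (nat \<Rightarrow> 'w \<Rightarrow> 'b::euclidean_space) \<Rightarrow> real \<Rightarrow> 'w \<Rightarrow> 'b" where
  "simple_process n \<tau> \<eta> s \<omega> = (\<Sum>i<n. indicat_real {\<tau> i<..\<tau> (Suc i)} s *\<^sub>R \<eta> i \<omega>)"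

definition simple_integral ::
    "(real \<Rightarrow> 'w \<Rightarrow> real) \<Rightarrow> nat \<Rightarrow> (nat \<Rightarrow> real) \<Rightarrow> (nat \<Rightarrow> 'w \<Rightarrow> 'b::euclidean_space) \<Rightarrow> real \<Rightarrow> 'w \<Rightarrow> 'b"
  where
  "simple_integral w n \<tau> \<eta> t \<omega> =
     (\<Sum>i<n. (w (min t (\<tau> (Suc i))) \<omega> - w (min t (\<tau> i)) \<omega>) *\<^sub>R \<eta> i \<omega>)"

text \<open>\<open>has_ito_integral M F w Y t Z\<close> says that \<open>Z\<close> is (a version of) the Ito integral of \<open>Y\<close>
  against \<open>w\<close> over \<open>[0, t]\<close>, for progressively measurable \<open>Y\<close> with almost surely
  square-integrable paths.\<close>

definition has_ito_integral ::
    "'w measure \<Rightarrow> (real \<Rightarrow> 'w measure) \<Rightarrow> (real \<Rightarrow> 'w \<Rightarrow> real) \<Rightarrow>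
     (real \<Rightarrow> 'w \<Rightarrow> 'b::euclidean_space) \<Rightarrow> real \<Rightarrow> ('w \<Rightarrow> 'b) \<Rightarrow> bool" where
  "has_ito_integral M F w Y t Z \<longleftrightarrow>
     progressively_measurable F Y \<and>
     (AE \<omega> in M. set_integrable lborel {0..t} (\<lambda>s. (norm (Y s \<omega>))\<^sup>2)) \<and>
     Z \<in> borel_measurable M \<and>
     (\<exists>n \<tau> \<eta>. (\<forall>k. simple_data M F (n k) (\<tau> k) (\<eta> k)) \<and>
        conv_in_prob M
          (\<lambda>k \<omega>. LBINT s:{0..t}. (norm (simple_process (n k) (\<tau> k) (\<eta> k) s \<omega> - Y s \<omega>))\<^sup>2)
          (\<lambda>\<omega>. 0) \<and>
        conv_in_prob M (\<lambda>k. simple_integral w (n k) (\<tau> k) (\<eta> k) t) Z)"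


section \<open>The linear stochastic Schroedinger equation\<close>

definition lsse_solution ::
    "'w measure \<Rightarrow> (real \<Rightarrow> 'w measure) \<Rightarrow> nat \<Rightarrow> (nat \<Rightarrow> real \<Rightarrow> 'w \<Rightarrow> real) \<Rightarrow>
     complex^'d^'d \<Rightarrow> (nat \<Rightarrow> complex^'d^'d) \<Rightarrow> complex^'d \<Rightarrow>
     (real \<Rightarrow> 'w \<Rightarrow> complex^'d) \<Rightarrow> bool" where
  "lsse_solution M F m W G L \<xi> X \<longleftrightarrow>
     progressively_measurable F X \<and>
     (AE \<omega> in M. continuous_on {0..} (\<lambda>t. X t \<omega>)) \<and>
     (AE \<omega> in M. X 0 \<omega> = \<xi>) \<and>
     (\<forall>t\<ge>0. \<exists>I.
        (\<forall>l\<in>{1..m}. has_ito_integral M F (W l) (\<lambda>s \<omega>. L l *v X s \<omega>) t (I l)) \<and>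
        (AE \<omega> in M. X t \<omega> = \<xi> + (LBINT s:{0..t}. G *v X s \<omega>) + (\<Sum>l=1..m. I l \<omega>)))"


section \<open>Essential range and total sets\<close>

definition essential_range :: "'w measure \<Rightarrow> ('w \<Rightarrow> complex^'d) \<Rightarrow> (complex^'d) set" where
  "essential_range M Y =
     {u. \<forall>U. open U \<and> u \<in> U \<longrightarrow> measure M {\<omega> \<in> space M. Y \<omega> \<in> U} > 0}"

definition total_set :: "(complex^'d) set \<Rightarrow> bool" where
  "total_set A \<longleftrightarrow> vec.span A = UNIV"

end

theory Submission
  imports Defs
begin

text \<open>Put \<open>E(t) = exp(tG)\<close>. The pulled back solution \<open>Y(t) = E(-t) X(t)\<close> solves the driftless equation
  \<open>dY = \<Sum>\<^sub>l B\<^sub>l(t) Y dW\<^sup>l\<close> with \<open>B\<^sub>l(t) = E(-t) L\<^sub>l E(t) = \<Sum>\<^sub>n (-t)\<^sup>n/n! \<delta>\<^sup>n(L\<^sub>l)\<close>, and for each fixed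
  \<open>\<xi>\<close> and \<open>t > 0\<close> the essential range of \<open>X(t)\<close> spans exactly \<open>E(t) S(\<xi>)\<close>.

  The products \<open>\<Prod>\<^sub>j (1 + \<Sum>\<^sub>l B\<^sub>l(t\<^sub>j) \<Delta>W\<^sup>l\<^sub>j) \<xi>\<close> of the Euler scheme converge to \<open>Y(t)\<close> in probability and
  stay in \<open>S(\<xi>)\<close>, because \<open>S(\<xi>)\<close> is invariant under every \<open>B\<^sub>l(q)\<close>; hence so does \<open>Y(t)\<close>.
  Conversely let \<open>u Y(t) = 0\<close> almost surely. The Euler scheme has bounded second moments, so
  testing it with \<open>1\<close> and with the increment \<open>W\<^sup>l(t) - W\<^sup>l(s)\<close> given the past of \<open>s\<close> yields
  \<open>u Y(s) = 0\<close> and \<open>u B\<^sub>l(s) Y(s) = 0\<close> for all \<open>s < t\<close>. Iterating down to time \<open>0\<close>,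
  \<open>u B(r\<^sub>k) \<cdots> B(r\<^sub>1) \<xi> = 0\<close> whenever \<open>0 < r\<^sub>1 < \<dots> < r\<^sub>k < t\<close>, and differentiating at \<open>r\<^sub>1 = 0\<close>, then at
  \<open>r\<^sub>2 = 0\<close>, and so on, \<open>u\<close> annihilates \<open>S(\<xi>)\<close>.

  No moment bound on \<open>X\<close> is assumed: the convergence of the Euler scheme started at time \<open>s\<close> is
  only claimed after multiplication by a bounded \<open>F(s)\<close>-measurable weight \<open>\<theta>\<close> that makes \<open>\<theta> X(s)\<close>
  bounded, and all localisation happens in discrete time.\<close>

section \<open>The Banach algebra of bounded operators\<close>

text \<open>\<open>has_ito_integral\<close> yields, for one process and one end time, only that some
  simple integrals converge in probability. The proof therefore works on finite grids, where
  independence of the increments from the past is all that is used, and returns to continuous time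
  by limits in probability. Two obstacles shape this passage. Closeness is wanted at all grid points
  at once, whence a maximal inequality for step processes with unbounded coefficients. And testing
  against an increment needs square integrability, which the solution may lack: the test is applied
  to the Euler scheme, and the solution enters only as its limit. With the drift removed, both tests
  become exact identities: the scheme is a martingale, and its covariation with \<open>W l\<close>
  is a Riemann sum of the coefficients. The annihilator \<open>u\<close> is an operator and not a
  functional, so that a coefficient can be absorbed into \<open>u\<close> and the argument repeated.
  The analysis is done over real Euclidean spaces; complex linearity returns at the end, because
  \<open>u\<close> is built from complex matrices.\<close>

typedef (overloaded) ('a::real_normed_vector) endo = "UNIV :: ('a \<Rightarrow>\<^sub>L 'a) set"
  morphisms blinfun_of_endo Endo ..

setup_lifting type_definition_endo

instantiation endo :: (real_normed_vector) real_normed_vector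
begin
lift_definition zero_endo :: "'a endo" is 0 .
lift_definition plus_endo :: "'a endo \<Rightarrow> 'a endo \<Rightarrow> 'a endo" is "(+)" .
lift_definition minus_endo :: "'a endo \<Rightarrow> 'a endo \<Rightarrow> 'a endo" is "(-)" .
lift_definition uminus_endo :: "'a endo \<Rightarrow> 'a endo" is "uminus" .
lift_definition scaleR_endo :: "real \<Rightarrow> 'a endo \<Rightarrow> 'a endo" is "(*\<^sub>R)" .
lift_definition norm_endo :: "'a endo \<Rightarrow> real" is norm .
definition dist_endo :: "'a endo \<Rightarrow> 'a endo \<Rightarrow> real" where "dist_endo a b = norm (a - b)"
definition sgn_endo :: "'a endo \<Rightarrow> 'a endo" where "sgn_endo a = inverse (norm a) *\<^sub>R a"
definition uniformity_endo :: "('a endo \<times> 'a endo) filter" where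
  "uniformity_endo = (INF e\<in>{0 <..}. principal {(x, y). dist x y < e})"
definition open_endo :: "'a endo set \<Rightarrow> bool" where
  "open_endo U = (\<forall>x\<in>U. eventually (\<lambda>(x', y). x' = x \<longrightarrow> y \<in> U) uniformity)"
instance
proof
  fix a b c :: "'a endo" and r s :: real
  show "a + b + c = a + (b + c)" "a + b = b + a" "0 + a = a" "- a + a = 0" "a - b = a + - b"
    "r *\<^sub>R (a + b) = r *\<^sub>R a + r *\<^sub>R b" "(r + s) *\<^sub>R a = r *\<^sub>R a + s *\<^sub>R a"
    "r *\<^sub>R s *\<^sub>R a = (r * s) *\<^sub>R a" "1 *\<^sub>R a = a"
    "norm a = 0 \<longleftrightarrow> a = 0" "norm (a + b) \<le> norm a + norm b" "norm (r *\<^sub>R a) = \<bar>r\<bar> * norm a"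
    by (transfer; simp add: scaleR_add_left scaleR_add_right add.assoc add.commute norm_triangle_ineq; fail)+
qed (simp_all only: dist_endo_def sgn_endo_def uniformity_endo_def open_endo_def)
end

text \<open>A type constructor with a single parameter lets composition be the multiplication of a
  \<open>real_normed_algebra_1\<close>, so that \<open>exp\<close> applies to operators.
  \<open>perfect_space\<close> excludes the zero space, in which \<open>0 = 1\<close>.\<close>

instantiation endo :: ("{real_normed_vector, perfect_space}") real_normed_algebra_1
begin
lift_definition one_endo :: "'a endo" is id_blinfun .
lift_definition times_endo :: "'a endo \<Rightarrow> 'a endo \<Rightarrow> 'a endo" is "(o\<^sub>L)" .
instance
proof
  show "(0 :: 'a endo) \<noteq> 1"
    by transfer (metis norm_blinfun_id norm_zero zero_neq_one)
  fix a b c :: "'a endo" and r :: real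
  show "norm (1 :: 'a endo) = 1" by transfer simp
  show "norm (a * b) \<le> norm a * norm b" by transfer (rule norm_blinfun_compose)
  show "a * b * c = a * (b * c)" by (transfer; rule blinfun_eqI; simp)
  show "1 * a = a" "a * 1 = a" by (transfer; rule blinfun_eqI; simp)+
  show "(a + b) * c = a * c + b * c" "a * (b + c) = a * b + a * c"
    "(r *\<^sub>R a) * b = r *\<^sub>R (a * b)" "a * (r *\<^sub>R b) = r *\<^sub>R (a * b)"
    by (transfer; rule blinfun_eqI; simp add: blinfun.bilinear_simps)+
qed
end

instance endo :: (banach) banach
proof
  fix X :: "nat \<Rightarrow> 'a endo" assume "Cauchy X"
  then have "Cauchy (\<lambda>n. blinfun_of_endo (X n))"
    unfolding Cauchy_def dist_norm by transfer
  then obtain l where "(\<lambda>n. blinfun_of_endo (X n)) \<longlonglongrightarrow> l"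
    using convergent_eq_Cauchy by blast
  then have "X \<longlonglongrightarrow> Endo l"
    unfolding tendsto_iff dist_norm
    by (simp add: norm_endo.rep_eq minus_endo.rep_eq Endo_inverse)
  then show "convergent X" by (auto simp: convergent_def)
qed

lift_definition app :: "'a::real_normed_vector endo \<Rightarrow> 'a \<Rightarrow> 'a" is blinfun_apply .

lemma norm_app: "norm (app T x) \<le> norm T * norm x"
  by transfer (rule norm_blinfun)

lemma bounded_bilinear_app: "bounded_bilinear app"
proof
  fix S T :: "'a endo" and x y :: 'a and r :: real
  show "app (S + T) x = app S x + app T x" "app (r *\<^sub>R S) x = r *\<^sub>R app S x"
    by (transfer, rule plus_blinfun.rep_eq[THEN fun_cong], transfer, rule scaleR_blinfun.rep_eq[THEN fun_cong])
  show "app S (x + y) = app S x + app S y" "app S (r *\<^sub>R x) = r *\<^sub>R app S x"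
    by (transfer, rule blinfun.add_right, transfer, rule blinfun.scaleR_right)
  show "\<exists>K. \<forall>(S::'a endo) x. norm (app S x) \<le> norm S * norm x * K"
    by (rule exI[of _ 1]) (simp add: norm_app)
qed

interpretation app: bounded_bilinear app
  by (rule bounded_bilinear_app)

lemma app_times [simp]: "app (S * T) x = app S (app T x)"
  by transfer simp

lemma app_one [simp]: "app 1 x = x"
  by transfer simp

lemma endo_eqI: "(\<And>x. app S x = app T x) \<Longrightarrow> S = T"
  by transfer (rule blinfun_eqI)

definition endo_of :: "('a::euclidean_space \<Rightarrow> 'a) \<Rightarrow> 'a endo" where
  "endo_of f = Endo (Blinfun f)"

lemma app_endo_of: "linear f \<Longrightarrow> app (endo_of f) = f"
  by (simp add: endo_of_def app.rep_eq Endo_inverse bounded_linear_Blinfun_apply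
      linear_conv_bounded_linear)

lemma measurable_app [measurable (raw)]:
  fixes f :: "'b \<Rightarrow> 'a::euclidean_space"
  assumes [measurable]: "f \<in> borel_measurable N"
  shows "(\<lambda>x. app T (f x)) \<in> borel_measurable N"
proof -
  have "continuous_on UNIV (app T)"
    by (simp add: app.bounded_linear_right linear_continuous_on)
  from borel_measurable_continuous_onI[OF this] show ?thesis by simp
qed


section \<open>Conjugation by exponentials\<close>

text \<open>The operator counterpart of \<open>delta\<close>; \<open>matrix_endo_delta\<close>
  identifies the two.\<close>

primrec ad :: "'a::ring \<Rightarrow> nat \<Rightarrow> 'a \<Rightarrow> 'a" where
  "ad G 0 A = A"
| "ad G (Suc n) A = G * ad G n A - ad G n A * G"

text \<open>Applied with \<open>y\<close> a complex scalar viewed as a real operator, this says that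
  exponentials of complex matrices are complex linear.\<close>

lemma exp_commute_left:
  fixes x y :: "'a::{real_normed_algebra_1,banach}"
  assumes "x * y = y * x"
  shows "exp x * y = y * exp x"
  unfolding exp_def
  by (simp add: suminf_mult[symmetric] suminf_mult2 summable_exp_generic
      power_commuting_commutes assms)

lemma ad_bound:
  fixes G A :: "'a::real_normed_algebra"
  shows "norm (ad G n A) \<le> (2 * norm G) ^ n * norm A"
proof (induction n)
  case (Suc n)
  have "norm (ad G (Suc n) A) \<le> norm (G * ad G n A) + norm (ad G n A * G)"
    by (simp add: norm_triangle_ineq4)
  also have "\<dots> \<le> 2 * norm G * norm (ad G n A)"
    using norm_mult_ineq[of G "ad G n A"] norm_mult_ineq[of "ad G n A" G]
    by (simp add: algebra_simps)
  also have "\<dots> \<le> 2 * norm G * ((2 * norm G) ^ n * norm A)"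
    by (intro mult_left_mono Suc.IH) auto
  finally show ?case by (simp add: algebra_simps)
qed simp

lemma ad_scaleR:
  fixes G A :: "'a::real_algebra"
  shows "ad (c *\<^sub>R G) n A = c ^ n *\<^sub>R ad G n A"
  by (induction n) (auto simp: algebra_simps)

lemma summable_norm_ad:
  fixes G A :: "'a::{real_normed_algebra_1,banach}"
  shows "summable (\<lambda>n. norm ((- 1) ^ n *\<^sub>R (inverse (fact n) *\<^sub>R ad G n A)))"
proof (rule summable_comparison_test)
  show "\<exists>N. \<forall>n\<ge>N. norm (norm ((- 1) ^ n *\<^sub>R (inverse (fact n) *\<^sub>R ad G n A)))
      \<le> norm A * (inverse (fact n) * (2 * norm G) ^ n)"
    using ad_bound[of G _ A] by (auto simp: field_simps power_abs)
  show "summable (\<lambda>n. norm A * (inverse (fact n) * (2 * norm G) ^ n))"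
    by (intro summable_mult summable_exp)
qed

text \<open>The right side is a Cauchy product. Its terms \<open>c n\<close> satisfy
  \<open>(n + 1) c (n + 1) = c n * G\<close>, which is also the recursion of
  \<open>A * G^n / n!\<close>, so the two series agree term by term.\<close>

lemma ad_series_commute:
  fixes G A :: "'a::{real_normed_algebra_1,banach}"
  shows "A * exp G = exp G * (\<Sum>n. (- 1) ^ n *\<^sub>R (inverse (fact n) *\<^sub>R ad G n A))"
proof -
  define a where "a n = G ^ n /\<^sub>R fact n" for n
  define b where "b n = (- 1) ^ n *\<^sub>R (inverse (fact n) *\<^sub>R ad G n A)" for n
  define c where "c n = (\<Sum>i\<le>n. a i * b (n - i))" for n
  have a_Suc: "a n * G = real (Suc n) *\<^sub>R a (Suc n)" for n
  proof -
    have "real (Suc n) * inverse (fact (Suc n)) = inverse (fact n)"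
      by (simp only: fact_Suc inverse_mult_distrib of_nat_mult of_nat_fact) simp
    then show ?thesis
      by (simp add: a_def power_Suc2 scaleR_scaleR del: power_Suc fact_Suc of_nat_Suc)
  qed
  have b_Suc: "b n * G = G * b n + real (Suc n) *\<^sub>R b (Suc n)" for n
  proof -
    have "real (Suc n) * ((- 1) ^ Suc n * inverse (fact (Suc n))) = - ((-1) ^ n * inverse (fact n))"
      by (simp only: fact_Suc inverse_mult_distrib of_nat_mult of_nat_fact) simp
    then have "real (Suc n) *\<^sub>R b (Suc n) = - ((-1) ^ n * inverse (fact n)) *\<^sub>R ad G (Suc n) A"
      by (simp only: b_def scaleR_scaleR mult.assoc)
    then show ?thesis
      by (simp add: b_def scaleR_diff_right)
  qed
  have c_eq: "c n = A * a n" for n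
  proof (induction n)
    case 0
    show ?case by (simp add: c_def a_def b_def)
  next
    case (Suc n)
    have "real (Suc n) *\<^sub>R c (Suc n) = (\<Sum>i\<le>Suc n. real (Suc n) *\<^sub>R (a i * b (Suc n - i)))"
      by (simp only: c_def scaleR_sum_right)
    \<comment> \<open>The weight \<open>Suc n\<close> is split as \<open>i + (Suc n - i)\<close>:
      the first part is absorbed by \<open>a_Suc\<close> in the left factor, the second by
      \<open>b_Suc\<close> in the right factor.\<close>
    also have "\<dots> = (\<Sum>i\<le>Suc n. real i *\<^sub>R (a i * b (Suc n - i)) +
        real (Suc n - i) *\<^sub>R (a i * b (Suc n - i)))"
      by (intro sum.cong) (auto simp: scaleR_add_left[symmetric] of_nat_diff)
    also have "\<dots> = (\<Sum>i\<le>Suc n. real i *\<^sub>R (a i * b (Suc n - i))) +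
        (\<Sum>i\<le>Suc n. real (Suc n - i) *\<^sub>R (a i * b (Suc n - i)))"
      by (rule sum.distrib)
    also have "(\<Sum>i\<le>Suc n. real i *\<^sub>R (a i * b (Suc n - i))) =
        (\<Sum>i\<le>n. real (Suc i) *\<^sub>R (a (Suc i) * b (n - i)))"
      by (subst sum.atMost_Suc_shift) simp
    also have "\<dots> = (\<Sum>i\<le>n. a i * (G * b (n - i)))"
      by (simp only: mult.assoc[symmetric] a_Suc mult_scaleR_left)
    also have "(\<Sum>i\<le>Suc n. real (Suc n - i) *\<^sub>R (a i * b (Suc n - i))) =
        (\<Sum>i\<le>n. a i * (real (Suc (n - i)) *\<^sub>R b (Suc (n - i))))"
      by (simp add: Suc_diff_le[symmetric] del: of_nat_Suc)
    also have "(\<Sum>i\<le>n. a i * (G * b (n - i))) + \<dots> = c n * G"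
      by (simp only: c_def sum_distrib_right mult.assoc b_Suc distrib_left sum.distrib)
    also have "\<dots> = real (Suc n) *\<^sub>R (A * a (Suc n))"
      by (simp only: Suc.IH mult.assoc a_Suc mult_scaleR_right)
    finally show ?case by (simp del: of_nat_Suc)
  qed
  have "(\<lambda>n. c n) sums (suminf a * suminf b)"
    unfolding c_def
    by (rule Cauchy_product_sums) (simp_all only: a_def b_def summable_norm_ad summable_norm_exp)
  moreover have "(\<lambda>n. c n) sums (A * suminf a)"
    unfolding c_eq a_def by (intro sums_mult summable_sums summable_exp_generic)
  ultimately show ?thesis
    unfolding exp_def a_def[symmetric] b_def[symmetric] by (simp add: sums_unique2)
qed

definition conj_exp :: "'a::{real_normed_algebra_1,banach} \<Rightarrow> 'a \<Rightarrow> real \<Rightarrow> 'a" where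
  "conj_exp G A s = exp (- s *\<^sub>R G) * A * exp (s *\<^sub>R G)"

lemma conj_exp_series:
  "conj_exp G A s = (\<Sum>n. ((- s) ^ n * inverse (fact n)) *\<^sub>R ad G n A)"
proof -
  have "conj_exp G A s = (exp (- (s *\<^sub>R G)) * exp (s *\<^sub>R G)) *
      (\<Sum>n. (- 1) ^ n *\<^sub>R (inverse (fact n) *\<^sub>R ad (s *\<^sub>R G) n A))"
    by (simp add: conj_exp_def mult.assoc ad_series_commute[of A "s *\<^sub>R G"])
  also have "exp (- (s *\<^sub>R G)) * exp (s *\<^sub>R G) = 1"
    using exp_minus_inverse[of "- (s *\<^sub>R G)"] by simp
  finally show ?thesis
    by (simp add: ad_scaleR power_mult_distrib[of "-1" s, simplified] mult_ac)
qed

lemma summable_conj_exp_series: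
  fixes G A :: "'a::{real_normed_algebra_1,banach}"
  shows "summable (\<lambda>n. ((- s) ^ n * inverse (fact n)) *\<^sub>R ad G n A)"
  using summable_norm_cancel[OF summable_norm_ad[of "s *\<^sub>R G" A]]
  by (simp add: ad_scaleR power_mult_distrib[of "-1" s, simplified] mult_ac)

text \<open>Differentiation stays within the family: it replaces \<open>A\<close> by its commutator
  with \<open>G\<close>, up to sign. This is what lets higher derivatives be taken by
  induction.\<close>

lemma conj_exp_has_vector_derivative:
  fixes G A :: "'a::{real_normed_algebra_1,banach}"
  shows "(conj_exp G A has_vector_derivative - conj_exp G (ad G 1 A) s) (at s within S)"
proof -
  have 1: "((\<lambda>s. exp (s *\<^sub>R G)) has_vector_derivative G * exp (s *\<^sub>R G)) (at s within S)"
    by (rule has_vector_derivative_at_within[OF exp_scaleR_has_vector_derivative_left])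
  have 2: "((\<lambda>s. exp (s *\<^sub>R - G)) has_vector_derivative exp (s *\<^sub>R - G) * - G) (at s within S)"
    by (rule exp_scaleR_has_vector_derivative_right)
  have "((\<lambda>s. (exp (s *\<^sub>R - G) * A) * exp (s *\<^sub>R G)) has_vector_derivative
      (exp (s *\<^sub>R - G) * A) * (G * exp (s *\<^sub>R G)) + (exp (s *\<^sub>R - G) * - G * A) * exp (s *\<^sub>R G))
      (at s within S)"
    by (intro has_vector_derivative_mult 1 has_vector_derivative_mult_left[OF 2])
  then show ?thesis
    by (simp add: conj_exp_def[abs_def] algebra_simps)
qed

lemma continuous_on_conj_exp: "continuous_on S (conj_exp G A)"
  using conj_exp_has_vector_derivative has_vector_derivative_continuous
  by (metis continuous_on_eq_continuous_within)

lemma conj_exp_zero [simp]: "conj_exp G A 0 = A"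
  by (simp add: conj_exp_def)

text \<open>The function of \<open>s\<close> vanishes on an open interval, hence so do all its
  derivatives there, and these are \<open>conj_exp G (ad G n A) s\<close> under \<phi> up to sign.
  Only then does \<open>s\<close> tend to 0 from the right; nothing is differentiated at the end
  point itself.\<close>

lemma ad_vanishes_of_conj_exp:
  fixes \<phi> :: "'a::{real_normed_algebra_1,banach} \<Rightarrow> 'b::real_normed_vector"
  assumes \<phi>: "bounded_linear \<phi>" and "T > 0" and "\<And>s. 0 < s \<Longrightarrow> s < T \<Longrightarrow> \<phi> (conj_exp G A s) = 0"
  shows "\<phi> (ad G n A) = 0"
proof -
  interpret bounded_linear \<phi> by (rule \<phi>)
  have *: "\<phi> (conj_exp G (ad G n A) s) = 0" if "0 < s" "s < T" for s
    using that
  proof (induction n arbitrary: s)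
    case 0
    then show ?case using assms(3) by simp
  next
    case (Suc n)
    have "((\<lambda>s. \<phi> (conj_exp G (ad G n A) s)) has_vector_derivative
        \<phi> (- conj_exp G (ad G 1 (ad G n A)) s)) (at s within {0<..<T})"
      by (intro has_vector_derivative conj_exp_has_vector_derivative)
    moreover have "((\<lambda>s. \<phi> (conj_exp G (ad G n A) s)) has_vector_derivative 0) (at s within {0<..<T})"
      by (rule has_vector_derivative_transform[OF _ _ has_vector_derivative_const[of 0]])
        (use Suc in auto)
    ultimately have "\<phi> (- conj_exp G (ad G 1 (ad G n A)) s) = 0"
      using vector_derivative_unique_within[of s "{0<..<T}"] Suc.prems
      by (simp add: at_within_open[of s "{0<..<T}"] vector_derivative_unique_at)
    then show ?case using linear_neg[OF linear_axioms] by simp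
  qed
  have "((\<lambda>s. \<phi> (conj_exp G (ad G n A) s)) \<longlongrightarrow> \<phi> (conj_exp G (ad G n A) 0)) (at_right 0)"
    using continuous_on_conj_exp[of UNIV G "ad G n A"]
    by (intro tendsto)
      (simp add: continuous_on_eq_continuous_at isCont_def filterlim_at_split del: conj_exp_zero)
  moreover have "((\<lambda>s. \<phi> (conj_exp G (ad G n A) s)) \<longlongrightarrow> 0) (at_right 0)"
    by (rule tendsto_eventually) (use * \<open>T > 0\<close> in \<open>auto simp: eventually_at_right\<close>)
  ultimately show ?thesis
    using tendsto_unique by (force simp: trivial_limit_at_right_real)
qed

text \<open>The error of one drift step is \<open>o(h)\<close>, so the errors of all cells of a grid
  with mesh \<open>h\<close> add up to something small.\<close>

lemma exp_remainder_little_o: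
  fixes G :: "'a::{real_normed_algebra_1,banach}"
  assumes "e > 0"
  shows "\<exists>d>0. \<forall>h. 0 < h \<and> h < d \<longrightarrow> norm (1 + h *\<^sub>R G - exp (h *\<^sub>R G)) \<le> e * h"
proof -
  have "((\<lambda>h. exp (h *\<^sub>R G)) has_vector_derivative G) (at 0)"
    using exp_scaleR_has_vector_derivative_left[of G 0] by simp
  then have "((\<lambda>h. exp (h *\<^sub>R G)) has_derivative (\<lambda>h. h *\<^sub>R G)) (at 0)"
    by (simp add: has_vector_derivative_def)
  then obtain d where "d > 0" and d: "\<And>h. norm (h - 0) < d \<Longrightarrow>
      norm (exp (h *\<^sub>R G) - exp (0 *\<^sub>R G) - (h - 0) *\<^sub>R G) \<le> e * norm (h - 0)"
    using \<open>e > 0\<close> unfolding has_derivative_at_alt by blast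
  then show ?thesis
  proof (intro exI[of _ d] conjI allI impI)
    fix h assume "0 < h \<and> h < d"
    then show "norm (1 + h *\<^sub>R G - exp (h *\<^sub>R G)) \<le> e * h"
      using d[of h] by (simp add: norm_minus_commute[of _ "exp _"] diff_diff_eq)
  qed
qed

text \<open>Bounds the total variation of the propagator along a grid independently of the number of
  cells, which is what summation by parts consumes.\<close>

lemma exp_Lipschitz_on:
  fixes G :: "'a::{real_normed_algebra_1,banach}"
  shows "\<exists>C. \<forall>a\<in>{0..T}. \<forall>b\<in>{0..T}. norm (exp (- a *\<^sub>R G) - exp (- b *\<^sub>R G)) \<le> C * \<bar>a - b\<bar>"
proof -
  have "norm (exp (- a *\<^sub>R G) - exp (- b *\<^sub>R G)) \<le> exp (T * norm G) * norm G * norm (a - b)"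
    if "a \<in> {0..T}" "b \<in> {0..T}" for a b
  proof (rule differentiable_bound[of "{0..T}" "\<lambda>a. exp (- a *\<^sub>R G)" "\<lambda>a h. h *\<^sub>R (exp (- a *\<^sub>R G) * - G)"])
    show "((\<lambda>a. exp (- a *\<^sub>R G)) has_derivative (\<lambda>h. h *\<^sub>R (exp (- a *\<^sub>R G) * - G))) (at a within {0..T})" for a
      using exp_scaleR_has_vector_derivative_right[of "- G" a "{0..T}"]
      by (simp add: has_vector_derivative_def)
    show "onorm (\<lambda>h. h *\<^sub>R (exp (- a *\<^sub>R G) * - G)) \<le> exp (T * norm G) * norm G" if "a \<in> {0..T}" for a
    proof (rule onorm_bound)
      have "norm (exp (- a *\<^sub>R G) * - G) \<le> norm (exp (- a *\<^sub>R G)) * norm G"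
        using norm_mult_ineq[of "exp (- a *\<^sub>R G)" "- G"] by simp
      also have "norm (exp (- a *\<^sub>R G)) \<le> exp (norm (- a *\<^sub>R G))"
        by (rule norm_exp)
      also have "\<dots> \<le> exp (T * norm G)"
        using that by (auto intro!: mult_right_mono)
      finally have *: "norm (exp (- a *\<^sub>R G) * - G) \<le> exp (T * norm G) * norm G"
        by (simp add: mult_right_mono)
      show "norm (h *\<^sub>R (exp (- a *\<^sub>R G) * - G)) \<le> exp (T * norm G) * norm G * norm h" for h
        using mult_right_mono[OF *, of "norm h"] by (simp only: norm_scaleR mult_ac real_norm_def)
    qed auto
  qed (use that in auto)
  then show ?thesis by (intro exI[of _ "exp (T * norm G) * norm G"]) auto
qed

lemma norm_diff_square_le:
  fixes x y :: "'a::real_normed_vector"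
  shows "(norm (x - y))\<^sup>2 \<le> 2 * (norm x)\<^sup>2 + 2 * (norm y)\<^sup>2"
proof -
  have "(norm (x - y))\<^sup>2 \<le> (norm x + norm y)\<^sup>2"
    by (intro power_mono norm_triangle_ineq4) simp
  also have "\<dots> \<le> 2 * (norm x)\<^sup>2 + 2 * (norm y)\<^sup>2"
    using sum_squares_bound[of "norm x" "norm y"] by (simp add: power2_sum)
  finally show ?thesis .
qed

section \<open>Convergence in probability\<close>

text \<open>The form of most limit proofs below: \<open>e\<close> collects what a choice of
  truncation makes small for all \<open>n\<close> at once, and \<open>q\<close>, which may depend on
  \<open>e\<close>, collects what vanishes after that choice.\<close>

lemma vanishing_by_bound:
  fixes p :: "nat \<Rightarrow> real"
  assumes nonneg: "\<And>n. 0 \<le> p n"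
    and bound: "\<And>e. e > 0 \<Longrightarrow> \<exists>q. q \<longlonglongrightarrow> 0 \<and> (\<forall>n. p n \<le> e + q n)"
  shows "p \<longlonglongrightarrow> 0"
proof (rule order_tendstoI)
  fix a :: real
  show "\<forall>\<^sub>F n in sequentially. a < p n" if "a < 0"
    using that nonneg by (intro always_eventually allI) (rule less_le_trans)
  assume "0 < a"
  then obtain q where q: "q \<longlonglongrightarrow> 0" "\<And>n. p n \<le> a / 2 + q n"
    using bound[of "a / 2"] by auto
  have "\<forall>\<^sub>F n in sequentially. q n < a / 2"
    using q(1) \<open>0 < a\<close> by (intro order_tendstoD(2)) auto
  then show "\<forall>\<^sub>F n in sequentially. p n < a"
  proof eventually_elim
    case (elim n)
    with q(2)[of n] show ?case by linarith
  qed
qed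

context prob_space
begin

text \<open>Dominated convergence for indicators. The index from which \<omega> avoids
  \<open>E n\<close> may depend on \<omega>; in this way uniform continuity of single paths becomes
  convergence in probability.\<close>

lemma AE_imp_prob_tendsto_0:
  assumes [measurable]: "\<And>n. E n \<in> events"
    and "AE \<omega> in M. \<forall>\<^sub>F n in sequentially. \<omega> \<notin> E n"
  shows "(\<lambda>n. prob (E n)) \<longlonglongrightarrow> 0"
proof -
  have "(\<lambda>n. \<integral>\<omega>. indicat_real (E n) \<omega> \<partial>M) \<longlonglongrightarrow> (\<integral>\<omega>. 0 \<partial>M)"
  proof (rule integral_dominated_convergence[where w = "\<lambda>_. 1"])
    show "AE \<omega> in M. (\<lambda>n. indicat_real (E n) \<omega>) \<longlonglongrightarrow> 0"
      using assms(2)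
    proof eventually_elim
      case (elim \<omega>)
      then show ?case
        by (intro tendsto_eventually) (auto elim: eventually_mono)
    qed
  qed (auto simp: indicator_def)
  then show ?thesis by simp
qed



lemma prob_subset_Un3:
  assumes "A \<subseteq> B \<union> C \<union> D" "B \<in> events" "C \<in> events" "D \<in> events"
  shows "prob A \<le> prob B + prob C + prob D"
proof -
  have "prob A \<le> prob (B \<union> C \<union> D)"
    using assms by (intro finite_measure_mono) auto
  also have "\<dots> \<le> prob (B \<union> C) + prob D"
    using assms by (intro measure_subadditive) auto
  also have "prob (B \<union> C) \<le> prob B + prob C"
    using assms by (intro measure_subadditive) auto
  finally show ?thesis by simp
qed

lemma events_finite_ex:
  fixes f :: "'k \<Rightarrow> 'a \<Rightarrow> 'b::euclidean_space"
  assumes "finite R" "\<And>r. r \<in> R \<Longrightarrow> f r \<in> borel_measurable M"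
  shows "{\<omega> \<in> space M. \<exists>r\<in>R. norm (f r \<omega>) > \<epsilon>} \<in> events"
proof -
  have "{\<omega> \<in> space M. norm (f r \<omega>) > \<epsilon>} \<in> events" if "r \<in> R" for r
    using assms(2)[OF that] by measurable
  moreover have "{\<omega> \<in> space M. \<exists>r\<in>R. norm (f r \<omega>) > \<epsilon>} = (\<Union>r\<in>R. {\<omega> \<in> space M. norm (f r \<omega>) > \<epsilon>})"
    by auto
  ultimately show ?thesis using \<open>finite R\<close> by auto
qed

text \<open>\<open>measure\<close> is 0 outside \<open>events\<close>, which settles the case of a
  non-measurable \<open>A\<close>. Sets described by pathwise integrals can so be bounded through
  measurable ones.\<close>

lemma AE_subset_prob_le:
  assumes "AE \<omega> in M. \<omega> \<in> A \<longrightarrow> \<omega> \<in> B" "B \<in> events"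
  shows "prob A \<le> prob B"
proof (cases "A \<in> events")
  case True
  with assms show ?thesis by (intro finite_measure_mono_AE)
qed (simp add: measure_notin_sets)

lemma tails_vanish_by_domination:
  fixes Z :: "nat \<Rightarrow> 'a \<Rightarrow> 'b::euclidean_space" and D :: "nat \<Rightarrow> 'a \<Rightarrow> 'c::euclidean_space"
  assumes [measurable]: "\<And>n. D n \<in> borel_measurable M"
    and dom: "\<And>n. AE \<omega> in M. norm (Z n \<omega>) \<le> c * norm (D n \<omega>)"
    and tails: "\<And>\<epsilon>. \<epsilon> > 0 \<Longrightarrow> (\<lambda>n. prob {\<omega> \<in> space M. norm (D n \<omega>) > \<epsilon>}) \<longlonglongrightarrow> 0" and "\<epsilon> > 0"
  shows "(\<lambda>n. prob {\<omega> \<in> space M. norm (Z n \<omega>) > \<epsilon>}) \<longlonglongrightarrow> 0"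
proof -
  \<comment> \<open>In the applications \<open>c\<close> is the norm of an operator and may be 0;
    the maximum makes the division below legitimate.\<close>
  define c' where "c' = max c 1"
  have c': "c' > 0" "c \<le> c'" by (auto simp: c'_def)
  have lim: "(\<lambda>n. prob {\<omega> \<in> space M. norm (D n \<omega>) > \<epsilon> / c'}) \<longlonglongrightarrow> 0"
    using c' \<open>\<epsilon> > 0\<close> by (intro tails) simp
  have "prob {\<omega> \<in> space M. norm (Z n \<omega>) > \<epsilon>} \<le> prob {\<omega> \<in> space M. norm (D n \<omega>) > \<epsilon> / c'}" for n
  proof (rule AE_subset_prob_le)
    show "AE \<omega> in M. \<omega> \<in> {\<omega> \<in> space M. norm (Z n \<omega>) > \<epsilon>} \<longrightarrow> \<omega> \<in> {\<omega> \<in> space M. norm (D n \<omega>) > \<epsilon> / c'}"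
      using dom[of n]
    proof eventually_elim
      case (elim \<omega>)
      then have "norm (Z n \<omega>) \<le> c' * norm (D n \<omega>)"
        using mult_right_mono[OF c'(2) norm_ge_zero, of "D n \<omega>"] by linarith
      then show ?case using c'(1) by (auto simp: pos_divide_less_eq mult.commute)
    qed
  qed measurable
  then show ?thesis
    by (intro tendsto_sandwich[OF _ _ tendsto_const lim] always_eventually allI) auto
qed

lemma chebyshev:
  fixes Z :: "'a \<Rightarrow> 'b::euclidean_space"
  assumes [measurable]: "Z \<in> borel_measurable M"
    and int: "integrable M (\<lambda>\<omega>. (norm (Z \<omega>))\<^sup>2)" and "\<epsilon> > 0"
  shows "prob {\<omega> \<in> space M. \<epsilon> < norm (Z \<omega>)} \<le> expectation (\<lambda>\<omega>. (norm (Z \<omega>))\<^sup>2) / \<epsilon>\<^sup>2"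
proof -
  have "prob {\<omega> \<in> space M. \<epsilon> < norm (Z \<omega>)} \<le> prob {\<omega> \<in> space M. (norm (Z \<omega>))\<^sup>2 \<ge> \<epsilon>\<^sup>2}"
    using \<open>\<epsilon> > 0\<close> by (intro finite_measure_mono) auto
  also have "\<dots> \<le> expectation (\<lambda>\<omega>. (norm (Z \<omega>))\<^sup>2) / \<epsilon>\<^sup>2"
    using int \<open>\<epsilon> > 0\<close> by (intro integral_Markov_inequality_measure[where A = "space M"]) auto
  finally show ?thesis .
qed

lemma integrable_inner_of_squares:
  fixes f g :: "'a \<Rightarrow> 'b::euclidean_space"
  assumes [measurable]: "f \<in> borel_measurable M" "g \<in> borel_measurable M"
    and "integrable M (\<lambda>\<omega>. (norm (f \<omega>))\<^sup>2)" "integrable M (\<lambda>\<omega>. (norm (g \<omega>))\<^sup>2)"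
  shows "integrable M (\<lambda>\<omega>. f \<omega> \<bullet> g \<omega>)"
proof (rule Bochner_Integration.integrable_bound)
  show "integrable M (\<lambda>\<omega>. (norm (f \<omega>))\<^sup>2 + (norm (g \<omega>))\<^sup>2)"
    using assms by simp
  have "\<bar>x \<bullet> y\<bar> \<le> (norm x)\<^sup>2 + (norm y)\<^sup>2" for x y :: 'b
  proof -
    have "0 \<le> (norm x - norm y)\<^sup>2" by simp
    then have "2 * (norm x * norm y) \<le> (norm x)\<^sup>2 + (norm y)\<^sup>2"
      by (simp add: power2_diff)
    with Cauchy_Schwarz_ineq2[of x y] zero_le_mult_iff[of "norm x" "norm y"] show ?thesis
      by auto
  qed
  then show "AE \<omega> in M. norm (f \<omega> \<bullet> g \<omega>) \<le> norm ((norm (f \<omega>))\<^sup>2 + (norm (g \<omega>))\<^sup>2)"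
    by (auto intro!: AE_I2)
qed simp

lemma integrable_of_square:
  fixes f :: "'a \<Rightarrow> 'b::euclidean_space"
  assumes [measurable]: "f \<in> borel_measurable M"
    and "integrable M (\<lambda>\<omega>. (norm (f \<omega>))\<^sup>2)"
  shows "integrable M f"
proof (rule Bochner_Integration.integrable_bound)
  show "integrable M (\<lambda>\<omega>. 1 + (norm (f \<omega>))\<^sup>2)"
    using assms by simp
  have "x \<le> 1 + x\<^sup>2" for x :: real
    by (cases "x \<le> 1") (auto simp: power2_eq_square intro: order_trans[of _ 1] add_increasing2 add_increasing mult_le_cancel_right1)
  then show "AE \<omega> in M. norm (f \<omega>) \<le> norm (1 + (norm (f \<omega>))\<^sup>2)"
    by (auto intro!: AE_I2)
qed simp

end

section \<open>Increments of Wiener processes\<close>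

locale wiener_system =
  fixes M :: "'w measure" and F :: "real \<Rightarrow> 'w measure" and m :: nat
    and W :: "nat \<Rightarrow> real \<Rightarrow> 'w \<Rightarrow> real"
  assumes filtered: "filtered_complete_prob_space M F"
    and wiener: "independent_wiener_processes M F m W"

sublocale wiener_system \<subseteq> prob_space M
  using filtered by (simp add: filtered_complete_prob_space_def)

context wiener_system
begin

lemma subalgebra_F: "0 \<le> t \<Longrightarrow> subalgebra M (F t)"
  using filtered by (simp add: filtered_complete_prob_space_def)

lemma measurable_F_M: "f \<in> measurable (F t) N \<Longrightarrow> 0 \<le> t \<Longrightarrow> f \<in> measurable M N"
  using measurable_from_subalg[OF subalgebra_F] by blast

lemma measurable_F_mono: "f \<in> measurable (F s) N \<Longrightarrow> 0 \<le> s \<Longrightarrow> s \<le> t \<Longrightarrow> f \<in> measurable (F t) N"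
  using filtered measurable_from_subalg by (simp add: filtered_complete_prob_space_def) blast

lemma W_adapted:
  assumes "l \<in> {1..m}" "0 \<le> s" "s \<le> t"
  shows "W l s \<in> borel_measurable (F t)"
proof -
  have "W l s \<in> borel_measurable (F s)"
    using wiener assms unfolding independent_wiener_processes_def wiener_process_def by blast
  then show ?thesis using assms(2,3) by (rule measurable_F_mono)
qed

lemma W_measurable: "l \<in> {1..m} \<Longrightarrow> 0 \<le> s \<Longrightarrow> W l s \<in> borel_measurable M"
  using W_adapted measurable_F_M by blast

lemma increment_distributed:
  "l \<in> {1..m} \<Longrightarrow> 0 \<le> s \<Longrightarrow> s < t \<Longrightarrow>
    distributed M lborel (\<lambda>\<omega>. W l t \<omega> - W l s \<omega>) (normal_density 0 (sqrt (t - s)))"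
  using wiener by (auto simp: independent_wiener_processes_def wiener_process_def)

lemma increment_moments:
  assumes "l \<in> {1..m}" "0 \<le> s" "s < t"
  shows "integrable M (\<lambda>\<omega>. W l t \<omega> - W l s \<omega>)" "expectation (\<lambda>\<omega>. W l t \<omega> - W l s \<omega>) = 0"
    "integrable M (\<lambda>\<omega>. (W l t \<omega> - W l s \<omega>)\<^sup>2)" "expectation (\<lambda>\<omega>. (W l t \<omega> - W l s \<omega>)\<^sup>2) = t - s"
proof -
  note D = increment_distributed[OF assms]
  have pos: "0 < sqrt (t - s)" using assms by simp
  show 1: "expectation (\<lambda>\<omega>. W l t \<omega> - W l s \<omega>) = 0"
    using normal_distributed_expectation[OF pos D] .
  show "expectation (\<lambda>\<omega>. (W l t \<omega> - W l s \<omega>)\<^sup>2) = t - s"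
    using normal_distributed_variance[OF pos D] assms by (simp add: 1)
  show "integrable M (\<lambda>\<omega>. W l t \<omega> - W l s \<omega>)"
    using distributed_integrable[OF D, of "\<lambda>x. x"] integrable_normal_moment[OF pos, of 0 1] by simp
  show "integrable M (\<lambda>\<omega>. (W l t \<omega> - W l s \<omega>)\<^sup>2)"
    using distributed_integrable[OF D, of "\<lambda>x. x\<^sup>2"] integrable_normal_moment[OF pos, of 0 2] by simp
qed

text \<open>The past and the increments over \<open>(s, t]\<close> are mutually independent, so the
  expectation factors. It is applied with \<open>J\<close> a singleton, for means and variances, and
  with \<open>J\<close> a pair, for covariances.\<close>

lemma expectation_increment_prod:
  fixes \<phi> :: "'w \<Rightarrow> real"
  assumes J: "J \<subseteq> {1..m}" and st: "0 \<le> s" "s < t"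
    and \<phi>: "\<phi> \<in> borel_measurable (F s)" "integrable M \<phi>"
    and g [measurable]: "\<And>l. l \<in> J \<Longrightarrow> g l \<in> borel_measurable borel"
    and int: "\<And>l. l \<in> J \<Longrightarrow> integrable M (\<lambda>\<omega>. g l (W l t \<omega> - W l s \<omega>))"
  shows "integrable M (\<lambda>\<omega>. \<phi> \<omega> * (\<Prod>l\<in>J. g l (W l t \<omega> - W l s \<omega>)))"
    "expectation (\<lambda>\<omega>. \<phi> \<omega> * (\<Prod>l\<in>J. g l (W l t \<omega> - W l s \<omega>))) =
      expectation \<phi> * (\<Prod>l\<in>J. expectation (\<lambda>\<omega>. g l (W l t \<omega> - W l s \<omega>)))"
proof -
  define X where "X i = (case i of None \<Rightarrow> \<phi> | Some l \<Rightarrow> (\<lambda>\<omega>. g l (W l t \<omega> - W l s \<omega>)))" for i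
  let ?I = "insert None (Some ` J)"
  have fin: "finite J" using J finite_subset by blast
  have meas: "random_variable borel (X i)" if "i \<in> ?I" for i
    using that \<phi>(2) J int st by (auto simp: X_def)
  have "indep_sets (\<lambda>i. case i of None \<Rightarrow> sets (F s) | Some l \<Rightarrow> increment_sets M (W l) s t)
      (insert None (Some ` {1..m}))"
    using wiener st by (auto simp: independent_wiener_processes_def)
  then have "indep_sets (\<lambda>i. {X i -` A \<inter> space M | A. A \<in> sets borel}) ?I"
  proof (rule indep_sets_mono)
    show "?I \<subseteq> insert None (Some ` {1..m})" using J by auto
    fix i assume "i \<in> ?I"
    then consider "i = None" | l where "i = Some l" "l \<in> J" by auto
    then show "{X i -` A \<inter> space M | A. A \<in> sets borel} \<subseteq>
        (case i of None \<Rightarrow> sets (F s) | Some l \<Rightarrow> increment_sets M (W l) s t)"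
    proof cases
      case 1
      have "space (F s) = space M" using subalgebra_F[OF st(1)] by (simp add: subalgebra_def)
      then show ?thesis using 1 measurable_sets[OF \<phi>(1)] by (auto simp: X_def)
    next
      case 2
      have "(\<lambda>\<omega>. W l t \<omega> - W l s \<omega>) \<in> borel_measurable (vimage_algebra (space M) (\<lambda>\<omega>. W l t \<omega> - W l s \<omega>) borel)"
        by (rule measurable_vimage_algebra1) auto
      then have "(\<lambda>\<omega>. g l (W l t \<omega> - W l s \<omega>)) \<in>
          borel_measurable (vimage_algebra (space M) (\<lambda>\<omega>. W l t \<omega> - W l s \<omega>) borel)"
        using g[OF \<open>l \<in> J\<close>] by (rule measurable_compose)
      from measurable_sets[OF this] show ?thesis
        using 2 by (auto simp: X_def increment_sets_def)
    qed
  qed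
  then have "indep_vars (\<lambda>_. borel) X ?I"
    using meas by (simp add: indep_vars_def2)
  moreover have "integrable M (X i)" if "i \<in> ?I" for i
    using that \<phi>(2) int by (auto simp: X_def)
  moreover have "(\<lambda>\<omega>. \<Prod>i\<in>?I. X i \<omega>) = (\<lambda>\<omega>. \<phi> \<omega> * (\<Prod>l\<in>J. g l (W l t \<omega> - W l s \<omega>)))"
    "(\<Prod>i\<in>?I. expectation (X i)) =
      expectation \<phi> * (\<Prod>l\<in>J. expectation (\<lambda>\<omega>. g l (W l t \<omega> - W l s \<omega>)))"
    using fin by (auto simp: X_def prod.insert prod.reindex)
  ultimately show "integrable M (\<lambda>\<omega>. \<phi> \<omega> * (\<Prod>l\<in>J. g l (W l t \<omega> - W l s \<omega>)))"
    "expectation (\<lambda>\<omega>. \<phi> \<omega> * (\<Prod>l\<in>J. g l (W l t \<omega> - W l s \<omega>))) =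
      expectation \<phi> * (\<Prod>l\<in>J. expectation (\<lambda>\<omega>. g l (W l t \<omega> - W l s \<omega>)))"
    using indep_vars_integrable[of ?I X] indep_vars_lebesgue_integral[of ?I X] fin
    by auto
qed

lemma increment_mean:
  fixes \<phi> :: "'w \<Rightarrow> real"
  assumes "l \<in> {1..m}" "0 \<le> s" "s < t" "\<phi> \<in> borel_measurable (F s)" "integrable M \<phi>"
  shows "integrable M (\<lambda>\<omega>. \<phi> \<omega> * (W l t \<omega> - W l s \<omega>))"
    "expectation (\<lambda>\<omega>. \<phi> \<omega> * (W l t \<omega> - W l s \<omega>)) = 0"
  using expectation_increment_prod[of "{l}" s t \<phi> "\<lambda>_ x. x"] increment_moments[of l s t] assms
  by auto

text \<open>For \<open>k = l\<close> the square of the increment is one function of one independent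
  variable; for distinct indices the two increments are separate factors of mean zero.\<close>

lemma increment_covariance:
  fixes \<phi> :: "'w \<Rightarrow> real"
  assumes "k \<in> {1..m}" "l \<in> {1..m}" "0 \<le> s" "s < t" "\<phi> \<in> borel_measurable (F s)" "integrable M \<phi>"
  shows "integrable M (\<lambda>\<omega>. \<phi> \<omega> * ((W k t \<omega> - W k s \<omega>) * (W l t \<omega> - W l s \<omega>)))" (is ?A)
    "expectation (\<lambda>\<omega>. \<phi> \<omega> * ((W k t \<omega> - W k s \<omega>) * (W l t \<omega> - W l s \<omega>))) =
      (if k = l then (t - s) * expectation \<phi> else 0)" (is ?B)
proof -
  have "?A \<and> ?B"
  proof (cases "k = l")
    case True
    then show ?thesis
      using expectation_increment_prod[of "{l}" s t \<phi> "\<lambda>_ x. x\<^sup>2"] increment_moments[of l s t] assms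
      by (auto simp: power2_eq_square)
  next
    case False
    then show ?thesis
      using expectation_increment_prod[of "{k, l}" s t \<phi> "\<lambda>_ x. x"] increment_moments[of l s t]
        increment_moments[of k s t] assms
      by auto
  qed
  then show ?A ?B by auto
qed

text \<open>One step of the Ito isometry. In the expanded square the terms linear in an increment
  have mean zero, and a product of two increments contributes \<open>t - s\<close> on the diagonal
  and nothing elsewhere. Both the maximal inequality and the moment bound of the Euler scheme
  iterate it.\<close>

lemma square_increment_step:
  fixes f :: "'w \<Rightarrow> 'b::euclidean_space" and b :: "nat \<Rightarrow> 'w \<Rightarrow> 'b"
  assumes J: "J \<subseteq> {1..m}" and st: "0 \<le> s" "s < t"
    and f: "f \<in> borel_measurable (F s)" "integrable M (\<lambda>\<omega>. (norm (f \<omega>))\<^sup>2)"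
    and b: "\<And>l. l \<in> J \<Longrightarrow> b l \<in> borel_measurable (F s)"
      "\<And>l. l \<in> J \<Longrightarrow> integrable M (\<lambda>\<omega>. (norm (b l \<omega>))\<^sup>2)"
  defines "f' \<equiv> \<lambda>\<omega>. f \<omega> + (\<Sum>l\<in>J. (W l t \<omega> - W l s \<omega>) *\<^sub>R b l \<omega>)"
  shows "f' \<in> borel_measurable (F t)" "integrable M (\<lambda>\<omega>. (norm (f' \<omega>))\<^sup>2)"
    "expectation (\<lambda>\<omega>. (norm (f' \<omega>))\<^sup>2) =
      expectation (\<lambda>\<omega>. (norm (f \<omega>))\<^sup>2) + (t - s) * (\<Sum>l\<in>J. expectation (\<lambda>\<omega>. (norm (b l \<omega>))\<^sup>2))"
proof -
  have fin: "finite J" using J finite_subset by blast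
  have [measurable]: "f \<in> borel_measurable (F t)" "f \<in> borel_measurable M"
    using f(1) st by (auto intro: measurable_F_mono measurable_F_M)
  have [measurable]: "b l \<in> borel_measurable (F t)" "b l \<in> borel_measurable M" if "l \<in> J" for l
    using b(1)[OF that] st by (auto intro: measurable_F_mono measurable_F_M)
  have [measurable]: "W l t \<in> borel_measurable (F t)" "W l s \<in> borel_measurable (F t)" if "l \<in> J" for l
    using W_adapted subsetD[OF J that] st by auto
  show "f' \<in> borel_measurable (F t)"
    unfolding f'_def by measurable
  note f_s [measurable] = f(1) and b_s [measurable] = b(1)
  have fb: "integrable M (\<lambda>\<omega>. f \<omega> \<bullet> b l \<omega>)" "(\<lambda>\<omega>. f \<omega> \<bullet> b l \<omega>) \<in> borel_measurable (F s)"
    if "l \<in> J" for l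
    using that f b by (auto intro!: integrable_inner_of_squares)
  have bb: "integrable M (\<lambda>\<omega>. b k \<omega> \<bullet> b l \<omega>)" "(\<lambda>\<omega>. b k \<omega> \<bullet> b l \<omega>) \<in> borel_measurable (F s)"
    if "k \<in> J" "l \<in> J" for k l
    using that f b by (auto intro!: integrable_inner_of_squares)
  let ?d = "\<lambda>l \<omega>. W l t \<omega> - W l s \<omega>"
  have eq: "(norm (f' \<omega>))\<^sup>2 = (norm (f \<omega>))\<^sup>2 + (\<Sum>l\<in>J. 2 * ((f \<omega> \<bullet> b l \<omega>) * ?d l \<omega>)) +
      (\<Sum>k\<in>J. \<Sum>l\<in>J. (b k \<omega> \<bullet> b l \<omega>) * (?d k \<omega> * ?d l \<omega>))" for \<omega>
  proof -
    define S where "S = (\<Sum>l\<in>J. ?d l \<omega> *\<^sub>R b l \<omega>)"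
    have "(norm (f' \<omega>))\<^sup>2 = (norm (f \<omega>))\<^sup>2 + 2 * (f \<omega> \<bullet> S) + S \<bullet> S"
      unfolding f'_def S_def[symmetric]
      by (simp add: power2_norm_eq_inner inner_add_left inner_add_right inner_commute)
    also have "2 * (f \<omega> \<bullet> S) = (\<Sum>l\<in>J. 2 * ((f \<omega> \<bullet> b l \<omega>) * ?d l \<omega>))"
      by (simp add: S_def inner_sum_right sum_distrib_left mult_ac)
    also have "S \<bullet> S = (\<Sum>k\<in>J. \<Sum>l\<in>J. (b k \<omega> \<bullet> b l \<omega>) * (?d k \<omega> * ?d l \<omega>))"
      unfolding S_def by (subst sum.swap)
        (simp add: inner_sum_left inner_sum_right sum_distrib_left mult_ac)
    finally show ?thesis .
  qed
  note m1 = increment_mean[OF _ st fb(2) fb(1)] and m2 = increment_covariance[OF _ _ st bb(2) bb(1)]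
  have i1: "integrable M (\<lambda>\<omega>. 2 * ((f \<omega> \<bullet> b l \<omega>) * ?d l \<omega>))" if "l \<in> J" for l
    using m1(1)[of l] that J by auto
  have i2: "integrable M (\<lambda>\<omega>. (b k \<omega> \<bullet> b l \<omega>) * (?d k \<omega> * ?d l \<omega>))" if "k \<in> J" "l \<in> J" for k l
    using m2(1)[of k l k l] that J by blast
  show "integrable M (\<lambda>\<omega>. (norm (f' \<omega>))\<^sup>2)"
    unfolding eq using f(2) i1 i2 by (intro Bochner_Integration.integrable_add Bochner_Integration.integrable_sum)
  have "expectation (\<lambda>\<omega>. (norm (f' \<omega>))\<^sup>2) = expectation (\<lambda>\<omega>. (norm (f \<omega>))\<^sup>2) +
      (\<Sum>l\<in>J. expectation (\<lambda>\<omega>. 2 * ((f \<omega> \<bullet> b l \<omega>) * ?d l \<omega>))) +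
      (\<Sum>k\<in>J. \<Sum>l\<in>J. expectation (\<lambda>\<omega>. (b k \<omega> \<bullet> b l \<omega>) * (?d k \<omega> * ?d l \<omega>)))"
    unfolding eq using f(2) i1 i2
    by (simp add: Bochner_Integration.integral_add Bochner_Integration.integral_sum del: Bochner_Integration.integral_mult_right_zero)
  also have "(\<Sum>l\<in>J. expectation (\<lambda>\<omega>. 2 * ((f \<omega> \<bullet> b l \<omega>) * ?d l \<omega>))) = 0"
    using m1(2) J by (intro sum.neutral) auto
  also have "(\<Sum>k\<in>J. \<Sum>l\<in>J. expectation (\<lambda>\<omega>. (b k \<omega> \<bullet> b l \<omega>) * (?d k \<omega> * ?d l \<omega>))) =
      (\<Sum>k\<in>J. \<Sum>l\<in>J. if k = l then (t - s) * expectation (\<lambda>\<omega>. b k \<omega> \<bullet> b l \<omega>) else 0)"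
    using J by (intro sum.cong refl m2(2)) auto
  also have "\<dots> = (t - s) * (\<Sum>l\<in>J. expectation (\<lambda>\<omega>. (norm (b l \<omega>))\<^sup>2))"
    using fin by (simp add: power2_norm_eq_inner sum_distrib_left)
  finally show "expectation (\<lambda>\<omega>. (norm (f' \<omega>))\<^sup>2) =
      expectation (\<lambda>\<omega>. (norm (f \<omega>))\<^sup>2) + (t - s) * (\<Sum>l\<in>J. expectation (\<lambda>\<omega>. (norm (b l \<omega>))\<^sup>2))"
    by simp
qed


section \<open>A maximal inequality for step processes\<close>

text \<open>A Lenglart type bound for coefficients without moments. The sum is stopped when its norm
  has exceeded \<epsilon> or its bracket is about to exceed \<delta>. The stopped sum has second
  moment at most \<delta>, and Chebyshev's inequality at the last index suffices, because a value
  above \<epsilon> is kept once reached.\<close>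

lemma discrete_maximal_inequality:
  fixes \<zeta> :: "nat \<Rightarrow> 'w \<Rightarrow> 'b::euclidean_space"
  assumes l: "l \<in> {1..m}" and p0: "0 \<le> p 0" and p: "\<And>i. i < N \<Longrightarrow> p i < p (Suc i)"
    and \<zeta>: "\<And>i. i < N \<Longrightarrow> \<zeta> i \<in> borel_measurable (F (p i))"
    and pos: "\<epsilon> > 0" "\<delta> \<ge> 0"
  defines "I \<equiv> \<lambda>k \<omega>. \<Sum>i<k. (W l (p (Suc i)) \<omega> - W l (p i) \<omega>) *\<^sub>R \<zeta> i \<omega>"
  defines "Q \<equiv> \<lambda>k \<omega>. \<Sum>i<k. (p (Suc i) - p i) * (norm (\<zeta> i \<omega>))\<^sup>2"
  shows "prob {\<omega> \<in> space M. \<exists>k\<le>N. norm (I k \<omega>) > \<epsilon>} \<le> \<delta> / \<epsilon>\<^sup>2 + prob {\<omega> \<in> space M. Q N \<omega> > \<delta>}"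
proof -
  have p_mono: "p i \<le> p j" if "i \<le> j" "j \<le> N" for i j
    using that
  proof (induction j)
    case (Suc j)
    then show ?case using p[of j] by (cases "i = Suc j") auto
  qed simp
  have p_nonneg: "0 \<le> p i" if "i \<le> N" for i
    using p_mono[of 0 i] that p0 by simp
  have \<zeta>_meas: "\<zeta> i \<in> borel_measurable (F (p j))" if "i \<le> j" "i < N" "j \<le> N" for i j
    using measurable_F_mono[OF \<zeta>[of i] p_nonneg p_mono] that by auto
  have W_meas: "W l (p i) \<in> borel_measurable (F (p j))" if "i \<le> j" "j \<le> N" for i j
    using W_adapted[OF l p_nonneg p_mono] that by auto
  have I_meas: "I k \<in> borel_measurable (F (p j))" if "k \<le> j" "j \<le> N" for k j
    unfolding I_def using that
    by (intro borel_measurable_sum borel_measurable_scaleR borel_measurable_diff W_meas \<zeta>_meas) auto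
  have Q_meas: "Q (Suc k) \<in> borel_measurable (F (p j))" if "k \<le> j" "k < N" "j \<le> N" for k j
    unfolding Q_def using that
    by (intro borel_measurable_sum borel_measurable_times borel_measurable_const
        borel_measurable_power measurable_compose[OF _ borel_measurable_norm] \<zeta>_meas) auto
  \<comment> \<open>The bracket is inspected one index ahead: \<open>Q (Suc j)\<close> is already
    determined by the past of \<open>p j\<close>, and so the stopped bracket never exceeds
    \<delta>.\<close>
  define D where "D k \<omega> \<longleftrightarrow> (\<forall>j\<le>k. norm (I j \<omega>) \<le> \<epsilon> \<and> Q (Suc j) \<omega> \<le> \<delta>)" for k \<omega>
  define \<zeta>' where "\<zeta>' i \<omega> = (if D i \<omega> then \<zeta> i \<omega> else 0)" for i \<omega>
  define I' where "I' k \<omega> = (\<Sum>i<k. (W l (p (Suc i)) \<omega> - W l (p i) \<omega>) *\<^sub>R \<zeta>' i \<omega>)" for k \<omega>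
  define Q' where "Q' k \<omega> = (\<Sum>i<k. (p (Suc i) - p i) * (norm (\<zeta>' i \<omega>))\<^sup>2)" for k \<omega>
  have D_meas: "Measurable.pred (F (p k)) (D k)" if "k < N" for k
  proof -
    have [measurable]: "I j \<in> borel_measurable (F (p k))" "Q (Suc j) \<in> borel_measurable (F (p k))"
      if "j \<in> {..k}" for j
      using I_meas[of j k] Q_meas[of j k] that \<open>k < N\<close> by auto
    have "Measurable.pred (F (p k)) (\<lambda>\<omega>. \<forall>j\<in>{..k}. norm (I j \<omega>) \<le> \<epsilon> \<and> Q (Suc j) \<omega> \<le> \<delta>)"
      by measurable
    then show ?thesis by (simp add: D_def[abs_def] Ball_def)
  qed
  have Q'_le_Q: "Q' k \<omega> \<le> Q k \<omega>" if "k \<le> N" for k \<omega>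
    unfolding Q'_def Q_def using that p
    by (intro sum_mono mult_left_mono) (auto simp: \<zeta>'_def less_imp_le)
  have Q'_le: "Q' k \<omega> \<le> \<delta>" if "k \<le> N" for k \<omega>
    using that
  proof (induction k)
    case 0
    then show ?case using pos by (simp add: Q'_def)
  next
    case (Suc k)
    show ?case
    proof (cases "D k \<omega>")
      case True
      then show ?thesis using Q'_le_Q[OF Suc.prems, of \<omega>] by (force simp: D_def)
    next
      case False
      then show ?thesis using Suc by (simp add: Q'_def \<zeta>'_def)
    qed
  qed
  have \<zeta>'_meas: "\<zeta>' k \<in> borel_measurable (F (p k))" if "k < N" for k
    unfolding \<zeta>'_def[abs_def] using D_meas[OF that] \<zeta>[OF that] by measurable
  \<comment> \<open>A stopped coefficient is bounded: its own term of \<open>Q'\<close> is at most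
    \<delta>, and its interval has positive length.\<close>
  have \<zeta>'_sq: "integrable M (\<lambda>\<omega>. (norm (\<zeta>' k \<omega>))\<^sup>2)" if "k < N" for k
  proof (rule integrable_const_bound)
    have [measurable]: "\<zeta>' k \<in> borel_measurable M"
      using measurable_F_M[OF \<zeta>'_meas p_nonneg] that by auto
    show "(\<lambda>\<omega>. (norm (\<zeta>' k \<omega>))\<^sup>2) \<in> borel_measurable M" by measurable
    have "(p (Suc k) - p k) * (norm (\<zeta>' k \<omega>))\<^sup>2 \<le> Q' (Suc k) \<omega>" for \<omega>
      using p that unfolding Q'_def
      by (intro member_le_sum[where f = "\<lambda>i. (p (Suc i) - p i) * (norm (\<zeta>' i \<omega>))\<^sup>2"]) (auto simp: less_imp_le)
    then have "(norm (\<zeta>' k \<omega>))\<^sup>2 \<le> \<delta> / (p (Suc k) - p k)" for \<omega>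
      using order_trans[OF _ Q'_le[of "Suc k" \<omega>]] p[OF that] that
      by (simp add: pos_le_divide_eq mult.commute Suc_le_eq)
    then show "AE \<omega> in M. norm ((norm (\<zeta>' k \<omega>))\<^sup>2) \<le> \<delta> / (p (Suc k) - p k)"
      by (intro AE_I2) simp
  qed
  have main: "I' k \<in> borel_measurable (F (p k)) \<and> integrable M (\<lambda>\<omega>. (norm (I' k \<omega>))\<^sup>2) \<and>
      expectation (\<lambda>\<omega>. (norm (I' k \<omega>))\<^sup>2) = expectation (Q' k)" if "k \<le> N" for k
    using that
  proof (induction k)
    case 0
    then show ?case by (simp add: I'_def Q'_def)
  next
    case (Suc k)
    then have "k < N" by simp
    have I'_Suc: "I' (Suc k) = (\<lambda>\<omega>. I' k \<omega> + (\<Sum>i\<in>{l}. (W i (p (Suc k)) \<omega> - W i (p k) \<omega>) *\<^sub>R \<zeta>' k \<omega>))"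
      by (auto simp: I'_def fun_eq_iff)
    have "integrable M (Q' k)"
      unfolding Q'_def using \<zeta>'_sq Suc by (intro Bochner_Integration.integrable_sum integrable_mult_right) auto
    then have "expectation (Q' (Suc k)) = expectation (Q' k) +
        (p (Suc k) - p k) * expectation (\<lambda>\<omega>. (norm (\<zeta>' k \<omega>))\<^sup>2)"
      using \<zeta>'_sq[OF \<open>k < N\<close>] by (simp add: Q'_def[of "Suc k", abs_def] Q'_def[abs_def])
    with square_increment_step[of "{l}" "p k" "p (Suc k)" "I' k" "\<lambda>_. \<zeta>' k"]
    show ?case
      using Suc l p[OF \<open>k < N\<close>] p_nonneg[of k] \<zeta>'_meas[OF \<open>k < N\<close>] \<zeta>'_sq[OF \<open>k < N\<close>]
      unfolding I'_Suc by simp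
  qed
  have I'_N: "I' N \<in> borel_measurable M" "integrable M (\<lambda>\<omega>. (norm (I' N \<omega>))\<^sup>2)"
  proof -
    have *: "I' N \<in> borel_measurable (F (p N)) \<and> integrable M (\<lambda>\<omega>. (norm (I' N \<omega>))\<^sup>2)"
      using main[OF order_refl] by blast
    show "I' N \<in> borel_measurable M"
      by (rule measurable_F_M[OF conjunct1[OF *] p_nonneg[OF order_refl]])
    show "integrable M (\<lambda>\<omega>. (norm (I' N \<omega>))\<^sup>2)"
      by (rule conjunct2[OF *])
  qed
  have "expectation (Q' N) \<le> \<delta>"
  proof -
    have "expectation (Q' N) \<le> expectation (\<lambda>_. \<delta>)"
      using Q'_le[of N] pos by (intro integral_mono') auto
    then show ?thesis by (simp add: prob_space)
  qed
  then have cheb: "prob {\<omega> \<in> space M. \<epsilon> < norm (I' N \<omega>)} \<le> \<delta> / \<epsilon>\<^sup>2"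
    using order_trans[OF chebyshev[OF I'_N pos(1)], of "\<delta> / \<epsilon>\<^sup>2"] main[of N]
    by (simp add: divide_right_mono)
  \<comment> \<open>Where the bracket stays within \<delta>, only the norm can stop the sum, so the
    final value \<open>I' N\<close> equals \<open>I k\<close> for the first \<open>k\<close> with
    norm above \<epsilon>.\<close>
  have stop: "\<epsilon> < norm (I' N \<omega>)" if "Q N \<omega> \<le> \<delta>" "j \<le> N" "norm (I j \<omega>) > \<epsilon>" for j \<omega>
  proof -
    define k where "k = (LEAST j. norm (I j \<omega>) > \<epsilon>)"
    have k: "norm (I k \<omega>) > \<epsilon>" "k \<le> j" and lt: "\<And>i. i < k \<Longrightarrow> norm (I i \<omega>) \<le> \<epsilon>"
      using that(3) unfolding k_def by (auto intro: LeastI Least_le dest: not_less_Least)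
    have Q_le: "Q (Suc i) \<omega> \<le> \<delta>" if "i < N" for i
    proof -
      have "Q (Suc i) \<omega> \<le> Q N \<omega>"
        unfolding Q_def using that p by (intro sum_mono2) (auto simp: less_imp_le)
      with \<open>Q N \<omega> \<le> \<delta>\<close> show ?thesis by simp
    qed
    have D: "D i \<omega> \<longleftrightarrow> i < k" if "i < N" for i
    proof
      show "D i \<omega> \<Longrightarrow> i < k" using k(1) unfolding D_def by (meson leI not_less)
      show "i < k \<Longrightarrow> D i \<omega>" unfolding D_def
        using lt Q_le that by auto
    qed
    have "I' N \<omega> = (\<Sum>i<N. if i \<in> {..<k} then (W l (p (Suc i)) \<omega> - W l (p i) \<omega>) *\<^sub>R \<zeta> i \<omega> else 0)"
      unfolding I'_def \<zeta>'_def using D by (intro sum.cong) auto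
    also have "\<dots> = (\<Sum>i\<in>{..<N} \<inter> {..<k}. (W l (p (Suc i)) \<omega> - W l (p i) \<omega>) *\<^sub>R \<zeta> i \<omega>)"
      by (rule sum.inter_restrict[symmetric]) simp
    also have "{..<N} \<inter> {..<k} = {..<k}"
      using k(2) \<open>j \<le> N\<close> by auto
    finally show ?thesis using k(1) by (simp add: I_def)
  qed
  have Q_N: "Q N \<in> borel_measurable M"
  proof (cases N)
    case 0
    then show ?thesis by (simp add: Q_def)
  next
    case (Suc n)
    then show ?thesis using measurable_F_M[OF Q_meas[of n N] p_nonneg[of N]] by simp
  qed
  have "prob {\<omega> \<in> space M. \<exists>k\<le>N. norm (I k \<omega>) > \<epsilon>} \<le>
      prob ({\<omega> \<in> space M. \<epsilon> < norm (I' N \<omega>)} \<union> {\<omega> \<in> space M. Q N \<omega> > \<delta>})"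
    using stop I'_N(1) Q_N by (intro finite_measure_mono) (auto simp: not_less[symmetric])
  also have "\<dots> \<le> prob {\<omega> \<in> space M. \<epsilon> < norm (I' N \<omega>)} + prob {\<omega> \<in> space M. Q N \<omega> > \<delta>}"
    using I'_N(1) Q_N by (intro measure_subadditive) auto
  finally show ?thesis using cheb by linarith
qed

section \<open>Step processes over arbitrary finite families of intervals\<close>

lemma set_lebesgue_integral_step:
  fixes g :: "real \<Rightarrow> real"
  assumes p: "\<And>i. i < N \<Longrightarrow> p i < p (Suc i)"
    and g: "\<And>i s. i < N \<Longrightarrow> p i < s \<Longrightarrow> s \<le> p (Suc i) \<Longrightarrow> g s = c i"
  shows "set_integrable lborel {p 0<..p N} g \<and>
    (LBINT s:{p 0<..p N}. g s) = (\<Sum>i<N. (p (Suc i) - p i) * c i)"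
  using assms
proof (induction N)
  case 0
  then show ?case by (simp add: set_integrable_def set_lebesgue_integral_def)
next
  case (Suc N)
  note mono = Suc.prems(1)
  have le: "p 0 \<le> p N"
  proof -
    have "p 0 \<le> p i" if "i \<le> N" for i
      using that
    proof (induction i)
      case (Suc i)
      then show ?case using mono[of i] by simp
    qed simp
    then show ?thesis by simp
  qed
  have un: "{p 0<..p (Suc N)} = {p 0<..p N} \<union> {p N<..p (Suc N)}"
    using le Suc.prems(1)[of N] by auto
  have step: "set_integrable lborel {p N<..p (Suc N)} g"
    "(LBINT s:{p N<..p (Suc N)}. g s) = (p (Suc N) - p N) * c N"
  proof -
    have "set_integrable lborel {p N<..p (Suc N)} (\<lambda>_. c N)"
      unfolding set_integrable_def
      using Suc.prems(1)[of N] by (intro integrable_scaleR_left integrable_real_indicator) auto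
    then show "set_integrable lborel {p N<..p (Suc N)} g"
      using Suc.prems(2)[of N] by (subst set_integrable_cong[OF refl refl, of _ _ "\<lambda>_. c N"]) auto
    have "(LBINT s:{p N<..p (Suc N)}. g s) = (LBINT s:{p N<..p (Suc N)}. c N)"
      using Suc.prems(2)[of N] by (intro set_lebesgue_integral_cong) auto
    then show "(LBINT s:{p N<..p (Suc N)}. g s) = (p (Suc N) - p N) * c N"
      using Suc.prems(1)[of N] by (simp add: set_lebesgue_integral_def)
  qed
  have IH: "set_integrable lborel {p 0<..p N} g"
    "(LBINT s:{p 0<..p N}. g s) = (\<Sum>i<N. (p (Suc i) - p i) * c i)"
    using Suc by auto
  show ?case
    unfolding un using IH step by (simp add: set_integral_Un set_integrable_Un)
qed

text \<open>The index set is arbitrary and the intervals may overlap. Thus the difference of two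
  step integrals over unrelated partitions is again a step integral, with the disjoint sum as index
  set.\<close>

definition step_integral ::
    "nat \<Rightarrow> 'k set \<Rightarrow> ('k \<Rightarrow> real) \<Rightarrow> ('k \<Rightarrow> real) \<Rightarrow> ('k \<Rightarrow> 'w \<Rightarrow> 'b::euclidean_space) \<Rightarrow> real \<Rightarrow> 'w \<Rightarrow> 'b" where
  "step_integral l K a b \<zeta> r \<omega> = (\<Sum>k\<in>K. (W l (min r (b k)) \<omega> - W l (min r (a k)) \<omega>) *\<^sub>R \<zeta> k \<omega>)"

definition step_process ::
    "'k set \<Rightarrow> ('k \<Rightarrow> real) \<Rightarrow> ('k \<Rightarrow> real) \<Rightarrow> ('k \<Rightarrow> 'w \<Rightarrow> 'b::euclidean_space) \<Rightarrow> real \<Rightarrow> 'w \<Rightarrow> 'b" where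
  "step_process K a b \<zeta> s \<omega> = (\<Sum>k\<in>K. indicat_real {a k<..b k} s *\<^sub>R \<zeta> k \<omega>)"

lemma step_integral_measurable:
  fixes \<zeta> :: "'k \<Rightarrow> 'w \<Rightarrow> 'b::euclidean_space"
  assumes "l \<in> {1..m}" "\<And>k. k \<in> K \<Longrightarrow> \<zeta> k \<in> borel_measurable (F (a k))"
    "\<And>k. k \<in> K \<Longrightarrow> 0 \<le> a k \<and> a k \<le> b k" "0 \<le> r"
  shows "step_integral l K a b \<zeta> r \<in> borel_measurable M"
  unfolding step_integral_def
proof (rule borel_measurable_sum)
  fix k assume k: "k \<in> K"
  have [measurable]: "\<zeta> k \<in> borel_measurable M" "W l (min r (b k)) \<in> borel_measurable M"
    "W l (min r (a k)) \<in> borel_measurable M"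
    using measurable_F_M[OF assms(2)[OF k]] assms(3)[OF k] \<open>0 \<le> r\<close> W_measurable[OF assms(1)]
    by auto
  show "(\<lambda>\<omega>. (W l (min r (b k)) \<omega> - W l (min r (a k)) \<omega>) *\<^sub>R \<zeta> k \<omega>) \<in> borel_measurable M"
    by measurable
qed

text \<open>All interval end points in \<open>[0, T]\<close> and all observation times are merged
  into one partition. On each of its cells the step process is constant, which reduces the claim to
  \<open>discrete_maximal_inequality\<close>.\<close>

lemma step_maximal_inequality:
  fixes \<zeta> :: "'k \<Rightarrow> 'w \<Rightarrow> 'b::euclidean_space"
  assumes l: "l \<in> {1..m}" and K: "finite K" and R: "finite R" "R \<subseteq> {0..T}"
    and ab: "\<And>k. k \<in> K \<Longrightarrow> 0 \<le> a k \<and> a k \<le> b k"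
    and \<zeta>: "\<And>k. k \<in> K \<Longrightarrow> \<zeta> k \<in> borel_measurable (F (a k))"
    and pos: "\<epsilon> > 0" "\<delta> \<ge> 0" and T: "0 \<le> T"
  shows "prob {\<omega> \<in> space M. \<exists>r\<in>R. norm (step_integral l K a b \<zeta> r \<omega>) > \<epsilon>} \<le>
    \<delta> / \<epsilon>\<^sup>2 + prob {\<omega> \<in> space M. (LBINT s:{0..T}. (norm (step_process K a b \<zeta> s \<omega>))\<^sup>2) > \<delta>}"
proof -
  define P where "P = {0, T} \<union> R \<union> ((a ` K \<union> b ` K) \<inter> {0..T})"
  define xs where "xs = sorted_list_of_set P"
  define N where "N = length xs - 1"
  define p where "p i = xs ! i" for i
  have P: "finite P" "P \<subseteq> {0..T}" "0 \<in> P" "T \<in> P" "R \<subseteq> P"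
    using K R T by (auto simp: P_def)
  have xs: "set xs = P" "sorted_wrt (<) xs"
    using P(1) by (auto simp: xs_def)
  have len: "length xs = Suc N"
    using xs(1) P(3) by (cases xs) (auto simp: N_def)
  have p_less: "p i < p j" if "i < j" "j \<le> N" for i j
    using sorted_wrt_nth_less[OF xs(2), of i j] that len by (simp add: p_def)
  have p_le: "p i \<le> p j" if "i \<le> j" "j \<le> N" for i j
    using p_less[of i j] that by (cases "i = j") auto
  have p_P: "p i \<in> P" if "i \<le> N" for i
    using that len xs(1) nth_mem[of i xs] by (simp add: p_def)
  have P_p: "\<exists>i\<le>N. p i = x" if "x \<in> P" for x
    using that xs(1) len by (auto simp: in_set_conv_nth p_def less_Suc_eq_le)
  have p_0: "p 0 = 0"
    using P_p[OF P(3)] p_P[of 0] P(2) p_le[of 0] by (metis atLeastAtMost_iff le0 order_antisym subsetD)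
  have p_N: "p N = T"
    using P_p[OF P(4)] p_P[of N] P(2) p_le[of _ N] by (metis atLeastAtMost_iff order_refl order_antisym subsetD)
  \<comment> \<open>No end point lies strictly inside a cell: those in \<open>[0, T]\<close> belong
    to \<open>P\<close>, the remaining ones lie beyond \<open>T\<close>.\<close>
  have gap: "x \<le> p i \<or> p (Suc i) \<le> x" if "i < N" "x \<in> a ` K \<union> b ` K" for i x
  proof (cases "x \<in> {0..T}")
    case True
    then have "x \<in> P" using that by (auto simp: P_def)
    then obtain j where "j \<le> N" "p j = x" using P_p by blast
    with that(1) show ?thesis
      using p_le[of j i] p_le[of "Suc i" j] by (cases "j \<le> i") auto
  next
    case False
    moreover have "0 \<le> x" using that ab by force
    ultimately have "T < x" by auto
    with p_le[of "Suc i" N] that p_N show ?thesis by auto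
  qed
  \<comment> \<open>Intervals are open on the left and closed on the right, so the value on a cell
    is the one at its right end. It is nevertheless known at the left end, because an interval that
    covers the cell starts there or earlier.\<close>
  define \<xi> where "\<xi> i = step_process K a b \<zeta> (p (Suc i))" for i
  have ind: "indicat_real {a k<..b k} s = indicat_real {a k<..b k} (p (Suc i))"
    if "k \<in> K" "i < N" "p i < s" "s \<le> p (Suc i)" for k i s
    using gap[OF that(2), of "a k"] gap[OF that(2), of "b k"] that by (auto simp: indicator_def)
  have const: "step_process K a b \<zeta> s \<omega> = \<xi> i \<omega>" if "i < N" "p i < s" "s \<le> p (Suc i)" for i s \<omega>
    unfolding \<xi>_def step_process_def
    by (intro sum.cong refl arg_cong2[where f = "(*\<^sub>R)"] ind that)
  have \<xi>_meas: "\<xi> i \<in> borel_measurable (F (p i))" if "i < N" for i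
    unfolding \<xi>_def step_process_def
  proof (rule borel_measurable_sum)
    fix k assume k: "k \<in> K"
    show "(\<lambda>\<omega>. indicat_real {a k<..b k} (p (Suc i)) *\<^sub>R \<zeta> k \<omega>) \<in> borel_measurable (F (p i))"
    proof (cases "a k \<le> p i")
      case True
      then have "\<zeta> k \<in> borel_measurable (F (p i))"
        using measurable_F_mono \<zeta>[OF k] ab[OF k] by blast
      then show ?thesis by measurable
    next
      case False
      then have "indicat_real {a k<..b k} (p (Suc i)) = 0"
        using gap[OF that, of "a k"] k by (auto simp: indicator_def)
      then show ?thesis by simp
    qed
  qed
  have incr: "step_integral l K a b \<zeta> (p (Suc i)) \<omega> - step_integral l K a b \<zeta> (p i) \<omega> =
      (W l (p (Suc i)) \<omega> - W l (p i) \<omega>) *\<^sub>R \<xi> i \<omega>" if "i < N" for i \<omega>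
  proof -
    have min_diff: "W l (min (p (Suc i)) x) \<omega> - W l (min (p i) x) \<omega> =
        (if p (Suc i) \<le> x then W l (p (Suc i)) \<omega> - W l (p i) \<omega> else 0)" if "x \<in> a ` K \<union> b ` K" for x
      using gap[OF \<open>i < N\<close> that] p_less[of i "Suc i"] \<open>i < N\<close> by (auto simp: min_def)
    have "(W l (min (p (Suc i)) (b k)) \<omega> - W l (min (p (Suc i)) (a k)) \<omega>) *\<^sub>R \<zeta> k \<omega> -
        (W l (min (p i) (b k)) \<omega> - W l (min (p i) (a k)) \<omega>) *\<^sub>R \<zeta> k \<omega> =
        (W l (p (Suc i)) \<omega> - W l (p i) \<omega>) *\<^sub>R indicat_real {a k<..b k} (p (Suc i)) *\<^sub>R \<zeta> k \<omega>"
      if "k \<in> K" for k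
    proof -
      have "(W l (min (p (Suc i)) (b k)) \<omega> - W l (min (p (Suc i)) (a k)) \<omega>) *\<^sub>R \<zeta> k \<omega> -
        (W l (min (p i) (b k)) \<omega> - W l (min (p i) (a k)) \<omega>) *\<^sub>R \<zeta> k \<omega> =
        ((W l (min (p (Suc i)) (b k)) \<omega> - W l (min (p i) (b k)) \<omega>) -
         (W l (min (p (Suc i)) (a k)) \<omega> - W l (min (p i) (a k)) \<omega>)) *\<^sub>R \<zeta> k \<omega>"
        by (simp add: algebra_simps)
      also have "\<dots> = (W l (p (Suc i)) \<omega> - W l (p i) \<omega>) *\<^sub>R indicat_real {a k<..b k} (p (Suc i)) *\<^sub>R \<zeta> k \<omega>"
        using min_diff[of "a k"] min_diff[of "b k"] gap[OF \<open>i < N\<close>, of "a k"] that ab[OF that]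
          p_less[of i "Suc i"] \<open>i < N\<close>
        by (auto simp: indicator_def)
      finally show ?thesis .
    qed
    then show ?thesis
      unfolding step_integral_def \<xi>_def step_process_def
      by (simp add: sum_subtractf[symmetric] scaleR_sum_right)
  qed
  have sum: "step_integral l K a b \<zeta> (p k) \<omega> = (\<Sum>i<k. (W l (p (Suc i)) \<omega> - W l (p i) \<omega>) *\<^sub>R \<xi> i \<omega>)"
    if "k \<le> N" for k \<omega>
    using that
  proof (induction k)
    case 0
    have "step_integral l K a b \<zeta> 0 \<omega> = 0"
      unfolding step_integral_def
    proof (rule sum.neutral, rule ballI)
      fix k assume "k \<in> K"
      then have "min 0 (b k) = 0" "min 0 (a k) = 0" using ab[of k] by auto
      then show "(W l (min 0 (b k)) \<omega> - W l (min 0 (a k)) \<omega>) *\<^sub>R \<zeta> k \<omega> = 0" by simp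
    qed
    then show ?case by (simp add: p_0)
  next
    case (Suc k)
    then show ?case using incr[of k \<omega>] by (simp add: algebra_simps)
  qed
  have int: "(LBINT s:{0..T}. (norm (step_process K a b \<zeta> s \<omega>))\<^sup>2) =
      (\<Sum>i<N. (p (Suc i) - p i) * (norm (\<xi> i \<omega>))\<^sup>2)" for \<omega>
  proof -
    have "(LBINT s:{0..T}. (norm (step_process K a b \<zeta> s \<omega>))\<^sup>2) =
        (LBINT s:{p 0<..p N}. (norm (step_process K a b \<zeta> s \<omega>))\<^sup>2)"
      unfolding set_lebesgue_integral_def
    proof (rule integral_cong_AE)
      have [measurable]: "(\<lambda>s. step_process K a b \<zeta> s \<omega>) \<in> borel_measurable borel"
        unfolding step_process_def by measurable
      show "(\<lambda>s. indicat_real {0..T} s *\<^sub>R (norm (step_process K a b \<zeta> s \<omega>))\<^sup>2) \<in> borel_measurable lborel"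
        "(\<lambda>s. indicat_real {p 0<..p N} s *\<^sub>R (norm (step_process K a b \<zeta> s \<omega>))\<^sup>2) \<in> borel_measurable lborel"
        by measurable
      show "AE s in lborel. indicat_real {0..T} s *\<^sub>R (norm (step_process K a b \<zeta> s \<omega>))\<^sup>2 =
          indicat_real {p 0<..p N} s *\<^sub>R (norm (step_process K a b \<zeta> s \<omega>))\<^sup>2"
        using AE_lborel_singleton[of 0]
        by eventually_elim (auto simp: indicator_def p_0 p_N)
    qed
    also have "\<dots> = (\<Sum>i<N. (p (Suc i) - p i) * (norm (\<xi> i \<omega>))\<^sup>2)"
      using const p_less by (intro conjunct2[OF set_lebesgue_integral_step]) auto
    finally show ?thesis .
  qed
  have "prob {\<omega> \<in> space M. \<exists>k\<le>N. norm (step_integral l K a b \<zeta> (p k) \<omega>) > \<epsilon>} \<le>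
    \<delta> / \<epsilon>\<^sup>2 + prob {\<omega> \<in> space M. (LBINT s:{0..T}. (norm (step_process K a b \<zeta> s \<omega>))\<^sup>2) > \<delta>}"
    using discrete_maximal_inequality[where p = p and N = N and \<zeta> = \<xi> and l = l, OF l _ _ \<xi>_meas pos] p_0 p_less
    by (simp add: sum int cong: conj_cong)
  moreover have "{\<omega> \<in> space M. \<exists>k\<in>{..N}. norm (step_integral l K a b \<zeta> (p k) \<omega>) > \<epsilon>} \<in> events"
    using p_le[of 0] p_0 by (intro events_finite_ex step_integral_measurable l \<zeta> ab) auto
  then have "prob {\<omega> \<in> space M. \<exists>r\<in>R. norm (step_integral l K a b \<zeta> r \<omega>) > \<epsilon>} \<le>
      prob {\<omega> \<in> space M. \<exists>k\<in>{..N}. norm (step_integral l K a b \<zeta> (p k) \<omega>) > \<epsilon>}"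
  proof (rule finite_measure_mono[rotated], intro subsetI CollectI conjI)
    fix \<omega> assume "\<omega> \<in> {\<omega> \<in> space M. \<exists>r\<in>R. norm (step_integral l K a b \<zeta> r \<omega>) > \<epsilon>}"
    then obtain r where "\<omega> \<in> space M" "r \<in> R" and r: "norm (step_integral l K a b \<zeta> r \<omega>) > \<epsilon>"
      by blast
    then show "\<omega> \<in> space M" by simp
    obtain k where "k \<le> N" "p k = r"
      using P_p[OF subsetD[OF P(5) \<open>r \<in> R\<close>]] by blast
    with r show "\<exists>k\<in>{..N}. norm (step_integral l K a b \<zeta> (p k) \<omega>) > \<epsilon>"
      by (intro bexI[of _ k]) auto
  qed
  ultimately show ?thesis by (simp add: Bex_def)
qed

end

section \<open>Approximation of Ito integrals\<close>

lemma integrable_indicator_Icc: "integrable lborel (indicat_real {a..b::real})"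
  by (intro integrable_real_indicator) (auto simp: emeasure_lborel_Icc_eq)

lemma conv_in_probD:
  "conv_in_prob M Z Z' \<Longrightarrow> \<epsilon> > 0 \<Longrightarrow> (\<lambda>k. measure M {\<omega> \<in> space M. norm (Z k \<omega> - Z' \<omega>) > \<epsilon>}) \<longlonglongrightarrow> 0"
  by (simp add: conv_in_prob_def)

lemma set_lebesgue_integral_le_const:
  fixes g :: "real \<Rightarrow> real"
  assumes "\<And>q. q \<in> {0..T} \<Longrightarrow> g q \<le> c" "0 \<le> c" "0 \<le> T"
  shows "(LBINT q:{0..T}. g q) \<le> c * T"
proof -
  have "(LBINT q:{0..T}. g q) \<le> (\<integral>q. indicat_real {0..T} q * c \<partial>lborel)"
    unfolding set_lebesgue_integral_def
    using assms
    by (intro integral_mono' integrable_mult_left integrable_indicator_Icc) (auto simp: indicator_def)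
  also have "\<dots> = c * T"
    using assms by simp
  finally show ?thesis .
qed

text \<open>Time is clamped to \<open>[0, T]\<close>, the range about which progressive
  measurability informs. The outcome comes first in the pair, as suits integrating out time.\<close>

definition jointly_measurable :: "'w measure \<Rightarrow> real \<Rightarrow> (real \<Rightarrow> 'w \<Rightarrow> 'b::euclidean_space) \<Rightarrow> bool" where
  "jointly_measurable M T Z \<longleftrightarrow> (\<lambda>(\<omega>, s). Z (max 0 (min s T)) \<omega>) \<in> borel_measurable (M \<Otimes>\<^sub>M lborel)"

lemma jointly_measurable_diff:
  "jointly_measurable M T Z \<Longrightarrow> jointly_measurable M T Z' \<Longrightarrow> jointly_measurable M T (\<lambda>s \<omega>. Z s \<omega> - Z' s \<omega>)"
  unfolding jointly_measurable_def split_beta' by (rule borel_measurable_diff)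

lemma jointly_measurable_cut:
  assumes "jointly_measurable M T Z"
  shows "jointly_measurable M T (\<lambda>q \<omega>. indicat_real {s<..} q *\<^sub>R Z q \<omega>)"
proof -
  have [measurable]: "(\<lambda>x. Z (max 0 (min (snd x) T)) (fst x)) \<in> borel_measurable (M \<Otimes>\<^sub>M lborel)"
    using assms by (simp add: jointly_measurable_def split_beta')
  show ?thesis
    unfolding jointly_measurable_def split_beta' by measurable
qed

lemma square_integral_measurable:
  assumes "jointly_measurable M T Z"
  shows "(\<lambda>\<omega>. LBINT s:{0..T}. (norm (Z s \<omega>))\<^sup>2) \<in> borel_measurable M"
proof -
  have [measurable]: "(\<lambda>x. Z (max 0 (min (snd x) T)) (fst x)) \<in> borel_measurable (M \<Otimes>\<^sub>M lborel)"
    using assms by (simp add: jointly_measurable_def split_beta')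
  have "(\<lambda>\<omega>. \<integral>s. indicat_real {0..T} s *\<^sub>R (norm (Z (max 0 (min s T)) \<omega>))\<^sup>2 \<partial>lborel) \<in> borel_measurable M"
    by (rule lborel.borel_measurable_lebesgue_integral) measurable
  also have "(\<lambda>\<omega>. \<integral>s. indicat_real {0..T} s *\<^sub>R (norm (Z (max 0 (min s T)) \<omega>))\<^sup>2 \<partial>lborel) =
      (\<lambda>\<omega>. LBINT s:{0..T}. (norm (Z s \<omega>))\<^sup>2)"
    unfolding set_lebesgue_integral_def
    by (intro ext Bochner_Integration.integral_cong) (auto simp: indicator_def)
  finally show ?thesis .
qed

lemma jointly_measurable_measurable:
  assumes "jointly_measurable M T Z" "\<omega> \<in> space M"
  shows "(\<lambda>s. indicat_real {0..T} s *\<^sub>R Z s \<omega>) \<in> borel_measurable lborel"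
proof -
  have *: "(\<lambda>x. Z (max 0 (min (snd x) T)) (fst x)) \<in> borel_measurable (M \<Otimes>\<^sub>M lborel)"
    using assms(1) by (simp add: jointly_measurable_def split_beta')
  have [measurable]: "(\<lambda>s. Z (max 0 (min s T)) \<omega>) \<in> borel_measurable lborel"
    using measurable_compose[OF measurable_Pair1'[OF assms(2)] *] by simp
  have "(\<lambda>s. indicat_real {0..T} s *\<^sub>R Z (max 0 (min s T)) \<omega>) \<in> borel_measurable lborel"
    by measurable
  also have "(\<lambda>s. indicat_real {0..T} s *\<^sub>R Z (max 0 (min s T)) \<omega>) = (\<lambda>s. indicat_real {0..T} s *\<^sub>R Z s \<omega>)"
  proof
    show "indicat_real {0..T} s *\<^sub>R Z (max 0 (min s T)) \<omega> = indicat_real {0..T} s *\<^sub>R Z s \<omega>" for s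
      by (cases "s \<in> {0..T}") auto
  qed
  finally show ?thesis .
qed

context wiener_system
begin

lemma progressively_jointly_measurable:
  assumes "progressively_measurable F Y" "0 \<le> T"
  shows "jointly_measurable M T Y"
proof -
  have Y: "(\<lambda>(s, \<omega>). Y s \<omega>) \<in> borel_measurable (restrict_space borel {0..T} \<Otimes>\<^sub>M F T)"
    using assms by (auto simp: progressively_measurable_def)
  have id: "(\<lambda>x. x) \<in> measurable M (F T)"
    using measurable_from_subalg[OF subalgebra_F[OF assms(2)] measurable_ident] by (simp only: id_def)
  have "(\<lambda>x. (max 0 (min (snd x) T), fst x)) \<in> measurable (M \<Otimes>\<^sub>M lborel) (restrict_space borel {0..T} \<Otimes>\<^sub>M F T)"
  proof (rule measurable_Pair)
    show "(\<lambda>x. max 0 (min (snd x) T)) \<in> M \<Otimes>\<^sub>M lborel \<rightarrow>\<^sub>M restrict_space borel {0..T}"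
      using assms(2) by (intro measurable_restrict_space2) auto
    show "fst \<in> M \<Otimes>\<^sub>M lborel \<rightarrow>\<^sub>M F T"
      by (rule measurable_compose[OF measurable_fst id])
  qed
  from measurable_compose[OF this Y] show ?thesis
    by (simp add: jointly_measurable_def split_beta')
qed

lemma progressively_adapted:
  assumes "progressively_measurable F Y" "0 \<le> t"
  shows "Y t \<in> borel_measurable (F t)"
proof -
  have Y: "(\<lambda>(s, \<omega>). Y s \<omega>) \<in> borel_measurable (restrict_space borel {0..t} \<Otimes>\<^sub>M F t)"
    using assms by (auto simp: progressively_measurable_def)
  have "(\<lambda>\<omega>. (t, \<omega>)) \<in> measurable (F t) (restrict_space borel {0..t} \<Otimes>\<^sub>M F t)"
    using assms(2) by (intro measurable_Pair1') (auto simp: space_restrict_space)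
  from measurable_compose[OF this Y] show ?thesis by simp
qed

lemma step_process_jointly_measurable:
  assumes "\<And>k. k \<in> K \<Longrightarrow> \<zeta> k \<in> borel_measurable (F (a k))" "\<And>k. k \<in> K \<Longrightarrow> 0 \<le> a k"
  shows "jointly_measurable M T (step_process K a b \<zeta>)"
  unfolding jointly_measurable_def step_process_def split_beta'
proof (rule borel_measurable_sum)
  fix k assume "k \<in> K"
  then have [measurable]: "\<zeta> k \<in> borel_measurable M"
    using assms measurable_F_M by blast
  show "(\<lambda>x. indicat_real {a k<..b k} (max 0 (min (snd x) T)) *\<^sub>R \<zeta> k (fst x)) \<in> borel_measurable (M \<Otimes>\<^sub>M lborel)"
    by measurable
qed

lemma step_process_square_integrable:
  assumes Y: "jointly_measurable M T Y" and \<omega>: "\<omega> \<in> space M"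
    and K: "finite K"
    and int: "set_integrable lborel {0..T} (\<lambda>s. (norm (Y s \<omega>))\<^sup>2)"
  shows "set_integrable lborel {0..T} (\<lambda>s. (norm (step_process K a b \<zeta> s \<omega> - Y s \<omega>))\<^sup>2)"
proof -
  define B where "B = (\<Sum>k\<in>K. norm (\<zeta> k \<omega>))"
  have bound: "norm (step_process K a b \<zeta> s \<omega>) \<le> B" for s
    unfolding step_process_def B_def
    by (rule sum_norm_le) (auto simp: indicator_def)
  have [measurable]: "(\<lambda>s. indicat_real {0..T} s *\<^sub>R Y s \<omega>) \<in> borel_measurable lborel"
    by (rule jointly_measurable_measurable[OF Y \<omega>])
  have [measurable]: "(\<lambda>s. step_process K a b \<zeta> s \<omega>) \<in> borel_measurable borel"
    unfolding step_process_def by measurable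
  have "set_integrable lborel {0..T} (\<lambda>s. 2 * B\<^sup>2 + 2 * (norm (Y s \<omega>))\<^sup>2)"
    using int integrable_indicator_Icc[of 0 T]
    by (intro set_integral_add set_integrable_mult_right) (auto simp: set_integrable_def)
  then show ?thesis
    unfolding set_integrable_def
  proof (rule Bochner_Integration.integrable_bound)
    have "(\<lambda>s. indicat_real {0..T} s *\<^sub>R (norm (indicat_real {0..T} s *\<^sub>R step_process K a b \<zeta> s \<omega> - indicat_real {0..T} s *\<^sub>R Y s \<omega>))\<^sup>2)
        \<in> borel_measurable lborel" by measurable
    also have "(\<lambda>s. indicat_real {0..T} s *\<^sub>R (norm (indicat_real {0..T} s *\<^sub>R step_process K a b \<zeta> s \<omega> - indicat_real {0..T} s *\<^sub>R Y s \<omega>))\<^sup>2) =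
      (\<lambda>s. indicat_real {0..T} s *\<^sub>R (norm (step_process K a b \<zeta> s \<omega> - Y s \<omega>))\<^sup>2)"
      by (auto simp: indicator_def)
    finally show "(\<lambda>s. indicat_real {0..T} s *\<^sub>R (norm (step_process K a b \<zeta> s \<omega> - Y s \<omega>))\<^sup>2) \<in> borel_measurable lborel" .
    have "(norm (step_process K a b \<zeta> s \<omega> - Y s \<omega>))\<^sup>2 \<le> 2 * B\<^sup>2 + 2 * (norm (Y s \<omega>))\<^sup>2" for s
      using norm_diff_square_le[of "step_process K a b \<zeta> s \<omega>" "Y s \<omega>"]
        power_mono[OF bound[of s] norm_ge_zero, of 2] by linarith
    then show "AE s in lborel. norm (indicat_real {0..T} s *\<^sub>R (norm (step_process K a b \<zeta> s \<omega> - Y s \<omega>))\<^sup>2)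
        \<le> norm (indicat_real {0..T} s *\<^sub>R (2 * B\<^sup>2 + 2 * (norm (Y s \<omega>))\<^sup>2))"
      by (intro AE_I2) (auto simp: indicator_def)
  qed
qed

lemma step_comparison:
  fixes Y :: "real \<Rightarrow> 'w \<Rightarrow> 'b::euclidean_space"
    and \<zeta> :: "'k \<Rightarrow> 'w \<Rightarrow> 'b" and \<zeta>' :: "'j \<Rightarrow> 'w \<Rightarrow> 'b"
  assumes l: "l \<in> {1..m}" and K: "finite K" "finite K'" and R: "finite R" "R \<subseteq> {0..T}"
    and ab: "\<And>k. k \<in> K \<Longrightarrow> 0 \<le> a k \<and> a k \<le> b k" "\<And>k. k \<in> K' \<Longrightarrow> 0 \<le> a' k \<and> a' k \<le> b' k"
    and \<zeta>: "\<And>k. k \<in> K \<Longrightarrow> \<zeta> k \<in> borel_measurable (F (a k))"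
      "\<And>k. k \<in> K' \<Longrightarrow> \<zeta>' k \<in> borel_measurable (F (a' k))"
    and pos: "\<epsilon> > 0" "\<delta> \<ge> 0" and T: "0 \<le> T"
    and Y: "jointly_measurable M T Y"
      "AE \<omega> in M. set_integrable lborel {0..T} (\<lambda>s. (norm (Y s \<omega>))\<^sup>2)"
  shows "prob {\<omega> \<in> space M. \<exists>r\<in>R. norm (step_integral l K a b \<zeta> r \<omega> - step_integral l K' a' b' \<zeta>' r \<omega>) > \<epsilon>} \<le>
    \<delta> / \<epsilon>\<^sup>2 +
    (prob {\<omega> \<in> space M. (LBINT s:{0..T}. (norm (step_process K a b \<zeta> s \<omega> - Y s \<omega>))\<^sup>2) > \<delta> / 4} +
     prob {\<omega> \<in> space M. (LBINT s:{0..T}. (norm (step_process K' a' b' \<zeta>' s \<omega> - Y s \<omega>))\<^sup>2) > \<delta> / 4})"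
proof -
  \<comment> \<open>The minus sign of the second process is put into its coefficients, so that the
    difference is a single step process over \<open>K <+> K'\<close>.\<close>
  define \<xi> where "\<xi> = case_sum \<zeta> (\<lambda>k \<omega>. - \<zeta>' k \<omega>)"
  let ?A = "case_sum a a'" and ?B = "case_sum b b'" and ?K = "K <+> K'"
  let ?D = "\<lambda>\<omega>. LBINT s:{0..T}. (norm (step_process K a b \<zeta> s \<omega> - Y s \<omega>))\<^sup>2"
  let ?D' = "\<lambda>\<omega>. LBINT s:{0..T}. (norm (step_process K' a' b' \<zeta>' s \<omega> - Y s \<omega>))\<^sup>2"
  have int: "step_integral l ?K ?A ?B \<xi> r \<omega> = step_integral l K a b \<zeta> r \<omega> - step_integral l K' a' b' \<zeta>' r \<omega>" for r \<omega>
    using K by (simp add: step_integral_def \<xi>_def sum.Plus sum_negf)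
  have proc: "step_process ?K ?A ?B \<xi> r \<omega> = step_process K a b \<zeta> r \<omega> - step_process K' a' b' \<zeta>' r \<omega>" for r \<omega>
    unfolding step_process_def \<xi>_def sum.Plus[OF K]
    by (simp only: sum.case o_def scaleR_minus_right sum_negf add_uminus_conv_diff)
  have \<xi>_meas: "\<xi> k \<in> borel_measurable (F (?A k))" if "k \<in> ?K" for k
    using that \<zeta> by (auto simp: \<xi>_def)
  have ab': "0 \<le> ?A k \<and> ?A k \<le> ?B k" if "k \<in> ?K" for k
    using that ab by auto
  have main: "prob {\<omega> \<in> space M. \<exists>r\<in>R. norm (step_integral l K a b \<zeta> r \<omega> - step_integral l K' a' b' \<zeta>' r \<omega>) > \<epsilon>} \<le>
      \<delta> / \<epsilon>\<^sup>2 + prob {\<omega> \<in> space M. (LBINT s:{0..T}. (norm (step_process K a b \<zeta> s \<omega> - step_process K' a' b' \<zeta>' s \<omega>))\<^sup>2) > \<delta>}"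
    using step_maximal_inequality[of l ?K R T ?A ?B \<xi> \<epsilon> \<delta>] l K R ab' \<xi>_meas pos T
    by (simp add: int proc)
  have [measurable]: "?D \<in> borel_measurable M" "?D' \<in> borel_measurable M"
    by (intro square_integral_measurable jointly_measurable_diff Y(1) step_process_jointly_measurable
        \<zeta> conjunct1[OF ab(1)] conjunct1[OF ab(2)]; assumption)+
  have "prob {\<omega> \<in> space M. (LBINT s:{0..T}. (norm (step_process K a b \<zeta> s \<omega> - step_process K' a' b' \<zeta>' s \<omega>))\<^sup>2) > \<delta>}
      \<le> prob ({\<omega> \<in> space M. ?D \<omega> > \<delta> / 4} \<union> {\<omega> \<in> space M. ?D' \<omega> > \<delta> / 4})"
  proof (rule AE_subset_prob_le)
    show "AE \<omega> in M. \<omega> \<in> {\<omega> \<in> space M. (LBINT s:{0..T}. (norm (step_process K a b \<zeta> s \<omega> - step_process K' a' b' \<zeta>' s \<omega>))\<^sup>2) > \<delta>} \<longrightarrow>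
        \<omega> \<in> {\<omega> \<in> space M. ?D \<omega> > \<delta> / 4} \<union> {\<omega> \<in> space M. ?D' \<omega> > \<delta> / 4}"
      using Y(2) AE_space
    proof eventually_elim
      case (elim \<omega>)
      have i: "set_integrable lborel {0..T} (\<lambda>s. (norm (step_process K a b \<zeta> s \<omega> - Y s \<omega>))\<^sup>2)"
        "set_integrable lborel {0..T} (\<lambda>s. (norm (step_process K' a' b' \<zeta>' s \<omega> - Y s \<omega>))\<^sup>2)"
        using step_process_square_integrable[OF Y(1) elim(2) _ elim(1)] K by auto
      have le: "(norm (x - z))\<^sup>2 \<le> 2 * (norm (x - y))\<^sup>2 + 2 * (norm (z - y))\<^sup>2" for x y z :: 'b
        using norm_diff_square_le[of "x - y" "z - y"] by simp
      have "(LBINT s:{0..T}. (norm (step_process K a b \<zeta> s \<omega> - step_process K' a' b' \<zeta>' s \<omega>))\<^sup>2)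
          \<le> (LBINT s:{0..T}. 2 * (norm (step_process K a b \<zeta> s \<omega> - Y s \<omega>))\<^sup>2 + 2 * (norm (step_process K' a' b' \<zeta>' s \<omega> - Y s \<omega>))\<^sup>2)"
        unfolding set_lebesgue_integral_def
      proof (rule integral_mono')
        show "integrable lborel (\<lambda>s. indicat_real {0..T} s *\<^sub>R (2 * (norm (step_process K a b \<zeta> s \<omega> - Y s \<omega>))\<^sup>2 + 2 * (norm (step_process K' a' b' \<zeta>' s \<omega> - Y s \<omega>))\<^sup>2))"
          unfolding set_integrable_def[symmetric]
          by (intro set_integral_add set_integrable_mult_right i)
      qed (use le in \<open>auto simp: indicator_def\<close>)
      also have "\<dots> = 2 * ?D \<omega> + 2 * ?D' \<omega>"
        using i by (subst set_integral_add) auto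
      finally show ?case using elim(2) by auto
    qed
  qed measurable
  also have "\<dots> \<le> prob {\<omega> \<in> space M. ?D \<omega> > \<delta> / 4} + prob {\<omega> \<in> space M. ?D' \<omega> > \<delta> / 4}"
    by (intro measure_subadditive) auto
  finally show ?thesis using main by linarith
qed

section \<open>Independence of the Ito integral from the approximating sequence\<close>

lemma simple_integral_eq_step_integral:
  "simple_integral (W l) n \<tau> \<eta> r = step_integral l {..<n} \<tau> (\<lambda>i. \<tau> (Suc i)) \<eta> r"
  by (auto simp: simple_integral_def step_integral_def fun_eq_iff)

lemma simple_process_eq_step_process:
  "simple_process n \<tau> \<eta> = step_process {..<n} \<tau> (\<lambda>i. \<tau> (Suc i)) \<eta>"
  by (auto simp: simple_process_def step_process_def fun_eq_iff)

lemma simple_data_steps: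
  assumes "simple_data M F n \<tau> \<eta>" "i < n"
  shows "0 \<le> \<tau> i \<and> \<tau> i \<le> \<tau> (Suc i)" "\<eta> i \<in> borel_measurable (F (\<tau> i))"
proof -
  have "0 \<le> \<tau> j" if "j \<le> n" for j
    using that
  proof (induction j)
    case 0
    then show ?case using assms by (simp add: simple_data_def)
  next
    case (Suc j)
    then have "\<tau> j \<le> \<tau> (Suc j)" "0 \<le> \<tau> j" using assms by (auto simp: simple_data_def)
    then show ?case by linarith
  qed
  with assms show "0 \<le> \<tau> i \<and> \<tau> i \<le> \<tau> (Suc i)" "\<eta> i \<in> borel_measurable (F (\<tau> i))"
    by (auto simp: simple_data_def)
qed

lemma square_integral_mono_time:
  fixes Z :: "real \<Rightarrow> 'b::real_normed_vector"
  assumes int: "set_integrable lborel {0..t} (\<lambda>s. (norm (Z s))\<^sup>2)" and "r \<le> t"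
  shows "(LBINT s:{0..r}. (norm (Z s))\<^sup>2) \<le> (LBINT s:{0..t}. (norm (Z s))\<^sup>2)"
  unfolding set_lebesgue_integral_def
proof (rule integral_mono')
  show "integrable lborel (\<lambda>s. indicat_real {0..t} s *\<^sub>R (norm (Z s))\<^sup>2)"
    using int by (simp add: set_integrable_def)
  have "indicat_real {0..r} s \<le> indicat_real {0..t} s" for s
    using order_trans[OF _ \<open>r \<le> t\<close>, of s] by (cases "s \<in> {0..r}") auto
  then show "indicat_real {0..r} s *\<^sub>R (norm (Z s))\<^sup>2 \<le> indicat_real {0..t} s *\<^sub>R (norm (Z s))\<^sup>2" for s
    by (simp add: mult_right_mono)
qed simp

text \<open>The sequence provided by \<open>has_ito_integral\<close> depends on the end time. Here
  one sequence chosen for \<open>[0, t]\<close> is shown to serve every \<open>r\<close> up to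
  \<open>t\<close>, by comparing it with the sequence that belongs to \<open>r\<close>.\<close>

lemma ito_integral_approximation:
  fixes Y :: "real \<Rightarrow> 'w \<Rightarrow> 'b::euclidean_space"
  assumes l: "l \<in> {1..m}" and r: "0 \<le> r" "r \<le> t"
    and Z: "has_ito_integral M F (W l) Y r Z"
    and Y_t: "AE \<omega> in M. set_integrable lborel {0..t} (\<lambda>s. (norm (Y s \<omega>))\<^sup>2)"
    and simple: "\<And>k. simple_data M F (n k) (\<tau> k) (\<eta> k)"
    and approx: "conv_in_prob M (\<lambda>k \<omega>. LBINT s:{0..t}. (norm (simple_process (n k) (\<tau> k) (\<eta> k) s \<omega> - Y s \<omega>))\<^sup>2) (\<lambda>\<omega>. 0)"
  shows "conv_in_prob M (\<lambda>k. simple_integral (W l) (n k) (\<tau> k) (\<eta> k) r) Z"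
  unfolding conv_in_prob_def
proof (intro allI impI)
  fix \<epsilon> :: real assume "\<epsilon> > 0"
  from Z obtain n' \<tau>' \<eta>' where Y: "progressively_measurable F Y"
    "AE \<omega> in M. set_integrable lborel {0..r} (\<lambda>s. (norm (Y s \<omega>))\<^sup>2)"
    and Z_meas [measurable]: "Z \<in> borel_measurable M"
    and simple': "\<And>k. simple_data M F (n' k) (\<tau>' k) (\<eta>' k)"
    and approx': "conv_in_prob M (\<lambda>k \<omega>. LBINT s:{0..r}. (norm (simple_process (n' k) (\<tau>' k) (\<eta>' k) s \<omega> - Y s \<omega>))\<^sup>2) (\<lambda>\<omega>. 0)"
    and conv': "conv_in_prob M (\<lambda>k. simple_integral (W l) (n' k) (\<tau>' k) (\<eta>' k) r) Z"
    unfolding has_ito_integral_def by blast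
  have meas [measurable]: "simple_integral (W l) (n k) (\<tau> k) (\<eta> k) r \<in> borel_measurable M"
    "simple_integral (W l) (n' k) (\<tau>' k) (\<eta>' k) r \<in> borel_measurable M" for k
    unfolding simple_integral_eq_step_integral
    using simple_data_steps[OF simple] simple_data_steps[OF simple'] r
    by (auto intro!: step_integral_measurable[OF l])
  let ?I = "\<lambda>k. simple_integral (W l) (n k) (\<tau> k) (\<eta> k) r"
  let ?I' = "\<lambda>k. simple_integral (W l) (n' k) (\<tau>' k) (\<eta>' k) r"
  let ?Q = "\<lambda>t k \<omega>. LBINT s:{0..t}. (norm (simple_process (n k) (\<tau> k) (\<eta> k) s \<omega> - Y s \<omega>))\<^sup>2"
  let ?Q' = "\<lambda>k \<omega>. LBINT s:{0..r}. (norm (simple_process (n' k) (\<tau>' k) (\<eta>' k) s \<omega> - Y s \<omega>))\<^sup>2"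
  show "(\<lambda>k. prob {\<omega> \<in> space M. \<epsilon> < norm (?I k \<omega> - Z \<omega>)}) \<longlonglongrightarrow> 0"
  proof (rule vanishing_by_bound)
    fix e :: real assume "e > 0"
    \<comment> \<open>Makes the term \<open>\<delta> / (\<epsilon> / 2)^2\<close> of the maximal
      inequality equal to \<open>e\<close>.\<close>
    define \<delta> where "\<delta> = e * (\<epsilon> / 2)\<^sup>2"
    have "\<delta> > 0" using \<open>e > 0\<close> \<open>\<epsilon> > 0\<close> by (simp add: \<delta>_def)
    let ?q = "\<lambda>k. prob {\<omega> \<in> space M. ?Q t k \<omega> > \<delta> / 4} + prob {\<omega> \<in> space M. ?Q' k \<omega> > \<delta> / 4} +
        prob {\<omega> \<in> space M. \<epsilon> / 2 < norm (?I' k \<omega> - Z \<omega>)}"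
    have nn: "\<bar>LBINT s:S. (norm (f s))\<^sup>2\<bar> = (LBINT s:S. (norm (f s))\<^sup>2)" for f :: "real \<Rightarrow> 'b" and S
      unfolding set_lebesgue_integral_def
      by (rule abs_of_nonneg) (auto intro!: Bochner_Integration.integral_nonneg)
    have "?q \<longlonglongrightarrow> 0 + 0 + 0"
    proof (intro tendsto_add)
      show "(\<lambda>k. prob {\<omega> \<in> space M. ?Q t k \<omega> > \<delta> / 4}) \<longlonglongrightarrow> 0"
        "(\<lambda>k. prob {\<omega> \<in> space M. ?Q' k \<omega> > \<delta> / 4}) \<longlonglongrightarrow> 0"
        using conv_in_probD[OF approx, of "\<delta> / 4"] conv_in_probD[OF approx', of "\<delta> / 4"] \<open>\<delta> > 0\<close>
        unfolding diff_zero real_norm_def nn by simp_all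
      show "(\<lambda>k. prob {\<omega> \<in> space M. \<epsilon> / 2 < norm (?I' k \<omega> - Z \<omega>)}) \<longlonglongrightarrow> 0"
        using conv_in_probD[OF conv', of "\<epsilon> / 2"] \<open>\<epsilon> > 0\<close> by simp
    qed
    moreover have "prob {\<omega> \<in> space M. \<epsilon> < norm (?I k \<omega> - Z \<omega>)} \<le> e + ?q k" for k
    proof -
      have 1: "{\<omega> \<in> space M. \<epsilon> < norm (?I k \<omega> - Z \<omega>)} \<subseteq>
          {\<omega> \<in> space M. \<epsilon> / 2 < norm (?I k \<omega> - ?I' k \<omega>)} \<union> {\<omega> \<in> space M. \<epsilon> / 2 < norm (?I' k \<omega> - Z \<omega>)}"
      proof safe
        fix \<omega> assume "\<epsilon> < norm (?I k \<omega> - Z \<omega>)" "\<not> \<epsilon> / 2 < norm (?I' k \<omega> - Z \<omega>)"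
        then show "\<epsilon> / 2 < norm (?I k \<omega> - ?I' k \<omega>)"
          using norm_triangle_ineq[of "?I k \<omega> - ?I' k \<omega>" "?I' k \<omega> - Z \<omega>"] by simp
      qed
      have "prob {\<omega> \<in> space M. \<epsilon> < norm (?I k \<omega> - Z \<omega>)} \<le>
          prob ({\<omega> \<in> space M. \<epsilon> / 2 < norm (?I k \<omega> - ?I' k \<omega>)} \<union> {\<omega> \<in> space M. \<epsilon> / 2 < norm (?I' k \<omega> - Z \<omega>)})"
        by (rule finite_measure_mono[OF 1]) measurable
      also have "\<dots> \<le> prob {\<omega> \<in> space M. \<epsilon> / 2 < norm (?I k \<omega> - ?I' k \<omega>)} + prob {\<omega> \<in> space M. \<epsilon> / 2 < norm (?I' k \<omega> - Z \<omega>)}"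
        by (intro measure_subadditive) auto
      also have "prob {\<omega> \<in> space M. \<epsilon> / 2 < norm (?I k \<omega> - ?I' k \<omega>)} \<le>
          \<delta> / (\<epsilon> / 2)\<^sup>2 + (prob {\<omega> \<in> space M. ?Q r k \<omega> > \<delta> / 4} + prob {\<omega> \<in> space M. ?Q' k \<omega> > \<delta> / 4})"
        using step_comparison[OF l finite_lessThan finite_lessThan, of "{r}" r "n k" "\<tau> k" "\<lambda>i. \<tau> k (Suc i)"
            "n' k" "\<tau>' k" "\<lambda>i. \<tau>' k (Suc i)" "\<eta> k" "\<eta>' k" "\<epsilon> / 2" \<delta> Y]
          simple_data_steps[OF simple] simple_data_steps[OF simple'] r \<open>\<epsilon> > 0\<close> \<open>\<delta> > 0\<close> Y
          progressively_jointly_measurable[OF Y(1) r(1)]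
        by (simp add: simple_integral_eq_step_integral simple_process_eq_step_process)
      \<comment> \<open>The approximation error up to \<open>r\<close> is dominated by the one up to
        \<open>t\<close> on paths where the latter integrand is integrable; elsewhere the Bochner
        integral would be 0 and monotonicity could fail.\<close>
      also have "prob {\<omega> \<in> space M. ?Q r k \<omega> > \<delta> / 4} \<le> prob {\<omega> \<in> space M. ?Q t k \<omega> > \<delta> / 4}"
      proof (rule AE_subset_prob_le)
        have jm: "jointly_measurable M t Y"
          using progressively_jointly_measurable[OF Y(1)] r by simp
        show "AE \<omega> in M. \<omega> \<in> {\<omega> \<in> space M. ?Q r k \<omega> > \<delta> / 4} \<longrightarrow> \<omega> \<in> {\<omega> \<in> space M. ?Q t k \<omega> > \<delta> / 4}"
          using Y_t AE_space
        proof eventually_elim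
          case (elim \<omega>)
          have "?Q r k \<omega> \<le> ?Q t k \<omega>"
            unfolding simple_process_eq_step_process
            by (intro square_integral_mono_time step_process_square_integrable[OF jm elim(2) _ elim(1)] r) auto
          with elim show ?case by auto
        qed
        have "?Q t k \<in> borel_measurable M"
          unfolding simple_process_eq_step_process
          using simple_data_steps[OF simple]
          by (intro square_integral_measurable jointly_measurable_diff jm step_process_jointly_measurable) auto
        then show "{\<omega> \<in> space M. ?Q t k \<omega> > \<delta> / 4} \<in> events" by measurable
      qed
      finally show ?thesis
        using \<open>\<epsilon> > 0\<close> by (simp add: \<delta>_def)
    qed
    ultimately show "\<exists>q. q \<longlonglongrightarrow> 0 \<and> (\<forall>k. prob {\<omega> \<in> space M. \<epsilon> < norm (?I k \<omega> - Z \<omega>)} \<le> e + q k)"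
      by (intro exI[of _ ?q]) auto
  qed simp
qed


end

section \<open>Riemann sums on equidistant grids\<close>

text \<open>There are \<open>Suc n\<close> cells, so the mesh makes sense for every
  \<open>n\<close>, and the last index is \<open>Suc n\<close>.\<close>

definition grid :: "real \<Rightarrow> real \<Rightarrow> nat \<Rightarrow> nat \<Rightarrow> real" where
  "grid s t n i = s + real i * ((t - s) / real (Suc n))"

lemma grid_0 [simp]: "grid s t n 0 = s"
  by (simp add: grid_def)

lemma grid_end [simp]: "grid s t n (Suc n) = t"
  by (simp add: grid_def del: of_nat_Suc)

lemma grid_Suc: "grid s t n (Suc i) - grid s t n i = (t - s) / real (Suc n)"
proof -
  have "s + (1 + real i) * h - (s + real i * h) = h" for h :: real
    by (simp add: algebra_simps)
  then show ?thesis by (simp only: grid_def of_nat_Suc[of i])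
qed

lemma grid_mono: "s \<le> t \<Longrightarrow> i \<le> j \<Longrightarrow> grid s t n i \<le> grid s t n j"
  by (auto simp: grid_def intro!: mult_right_mono divide_right_mono)

lemma grid_less: "s < t \<Longrightarrow> grid s t n i < grid s t n (Suc i)"
  using grid_Suc[of s t n i] by (smt (verit) of_nat_0_less_iff zero_less_Suc divide_pos_pos)

lemma grid_bounds:
  assumes "s \<le> t" "i \<le> Suc n"
  shows "s \<le> grid s t n i" "grid s t n i \<le> t"
  using grid_mono[OF assms(1), of 0 i n] grid_mono[OF assms(1), of i "Suc n" n] assms(2) by auto

lemma grid_cell:
  assumes "s < q" "q \<le> t"
  obtains j where "j \<le> n" "grid s t n j < q" "q \<le> grid s t n (Suc j)"
proof -
  define j where "j = (LEAST i. q \<le> grid s t n i)"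
  have q: "q \<le> grid s t n j" "j \<le> Suc n" "\<And>i. i < j \<Longrightarrow> \<not> q \<le> grid s t n i"
    using assms unfolding j_def by (auto intro: LeastI[of _ "Suc n"] Least_le dest: not_less_Least)
  moreover have "j \<noteq> 0" using q(1) assms by (cases j) auto
  then obtain i where "j = Suc i" using not0_implies_Suc by blast
  ultimately show ?thesis using that[of i] by force
qed

lemma grid_oscillation:
  fixes f :: "real \<Rightarrow> 'b::real_normed_vector"
  assumes cont: "continuous_on {s..t} f" and st: "s < t" and "e > 0"
  shows "\<forall>\<^sub>F n in sequentially. \<forall>j\<le>n. \<forall>q\<in>{grid s t n j..grid s t n (Suc j)}. norm (f q - f (grid s t n j)) < e"
proof -
  have "uniformly_continuous_on {s..t} f"
    using cont by (intro compact_uniformly_continuous) auto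
  then obtain d where d: "d > 0" "\<And>q q'. q \<in> {s..t} \<Longrightarrow> q' \<in> {s..t} \<Longrightarrow> dist q' q < d \<Longrightarrow> dist (f q') (f q) < e"
    using \<open>e > 0\<close> unfolding uniformly_continuous_on_def by metis
  have "(\<lambda>n. (t - s) / real (Suc n)) \<longlonglongrightarrow> 0"
    using LIMSEQ_Suc[OF lim_const_over_n[of "t - s"]] by simp
  then have "\<forall>\<^sub>F n in sequentially. (t - s) / real (Suc n) < d"
    using d(1) by (rule order_tendstoD(2))
  then show ?thesis
  proof eventually_elim
    case (elim n)
    show ?case
    proof (intro allI impI ballI)
      fix j q assume j: "j \<le> n" and q: "q \<in> {grid s t n j..grid s t n (Suc j)}"
      have "dist (f q) (f (grid s t n j)) < e"
        using j q elim grid_Suc[of s t n j] grid_bounds[of s t j n] grid_bounds[of s t "Suc j" n] st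
        by (intro d(2)) (auto simp: dist_real_def)
      then show "norm (f q - f (grid s t n j)) < e"
        by (simp add: dist_norm)
    qed
  qed
qed

text \<open>The left-point discretisation on \<open>(s, t]\<close>, zero up to \<open>s\<close>.
  Taking the left end point makes each coefficient measurable at the start of its cell.\<close>

definition grid_freeze :: "real \<Rightarrow> real \<Rightarrow> nat \<Rightarrow> (real \<Rightarrow> 'w \<Rightarrow> 'b::real_vector) \<Rightarrow> real \<Rightarrow> 'w \<Rightarrow> 'b" where
  "grid_freeze s t n Y q \<omega> =
    (\<Sum>j<Suc n. indicat_real {grid s t n j<..grid s t n (Suc j)} q *\<^sub>R Y (grid s t n j) \<omega>)"

lemma grid_freeze_eq:
  assumes "s < t" "j \<le> n" "grid s t n j < q" "q \<le> grid s t n (Suc j)"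
  shows "grid_freeze s t n Y q \<omega> = Y (grid s t n j) \<omega>"
proof -
  have "indicat_real {grid s t n i<..grid s t n (Suc i)} q = (if i = j then 1 else 0)" for i
    using assms grid_mono[of s t "Suc i" j n] grid_mono[of s t "Suc j" i n]
    by (cases i j rule: linorder_cases) (auto simp: indicator_def)
  then have "grid_freeze s t n Y q \<omega> = (\<Sum>i<Suc n. if i = j then Y (grid s t n i) \<omega> else 0)"
    unfolding grid_freeze_def by (intro sum.cong) auto
  also have "\<dots> = Y (grid s t n j) \<omega>"
    using assms(2) by (subst sum.delta) auto
  finally show ?thesis .
qed

lemma grid_freeze_before:
  assumes "s < t" "q \<le> s"
  shows "grid_freeze s t n Y q \<omega> = 0"
proof -
  have "indicat_real {grid s t n i<..grid s t n (Suc i)} q = 0" for i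
    using assms grid_mono[of s t 0 i n] by (auto simp: indicator_def)
  then show ?thesis by (simp add: grid_freeze_def)
qed

lemma grid_freeze_uniform:
  fixes Y :: "real \<Rightarrow> 'w \<Rightarrow> 'b::real_normed_vector"
  assumes cont: "continuous_on {s..t} (\<lambda>q. Y q \<omega>)" and st: "s < t" and "e > 0"
  shows "\<forall>\<^sub>F n in sequentially. \<forall>q\<in>{s<..t}. norm (grid_freeze s t n Y q \<omega> - Y q \<omega>) < e"
  using grid_oscillation[OF assms]
proof eventually_elim
  case (elim n)
  show ?case
  proof
    fix q assume "q \<in> {s<..t}"
    then obtain j where j: "j \<le> n" "grid s t n j < q" "q \<le> grid s t n (Suc j)"
      using grid_cell[of s q t n] by auto
    then have "norm (Y q \<omega> - Y (grid s t n j) \<omega>) < e"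
      using elim by (simp add: less_imp_le)
    then show "norm (grid_freeze s t n Y q \<omega> - Y q \<omega>) < e"
      using grid_freeze_eq[OF st j, of Y \<omega>] by (simp add: norm_minus_commute)
  qed
qed

context wiener_system
begin

lemma ito_integral_riemann:
  fixes Y :: "real \<Rightarrow> 'w \<Rightarrow> 'b::euclidean_space"
  assumes l: "l \<in> {1..m}" and st: "0 \<le> s" "s < t"
    and I: "\<And>r. r \<in> {0..t} \<Longrightarrow> has_ito_integral M F (W l) Y r (I r)"
    and cont: "AE \<omega> in M. continuous_on {0..} (\<lambda>q. Y q \<omega>)"
    and "\<epsilon> > 0"
  shows "(\<lambda>n. prob {\<omega> \<in> space M. \<exists>i\<in>{..Suc n}. norm (I (grid s t n i) \<omega> - I s \<omega> -
    (\<Sum>j<i. (W l (grid s t n (Suc j)) \<omega> - W l (grid s t n j) \<omega>) *\<^sub>R Y (grid s t n j) \<omega>)) > \<epsilon>}) \<longlonglongrightarrow> 0"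
    (is "(\<lambda>n. prob (?E n)) \<longlonglongrightarrow> 0")
proof (rule vanishing_by_bound)
  fix e :: real assume "e > 0"
  have "t \<in> {0..t}" using st by auto
  from I[OF this] obtain nn \<tau> \<eta> where Y: "progressively_measurable F Y"
    and Y_t: "AE \<omega> in M. set_integrable lborel {0..t} (\<lambda>s. (norm (Y s \<omega>))\<^sup>2)"
    and simple: "\<And>k. simple_data M F (nn k) (\<tau> k) (\<eta> k)"
    and approx: "conv_in_prob M (\<lambda>k \<omega>. LBINT s:{0..t}. (norm (simple_process (nn k) (\<tau> k) (\<eta> k) s \<omega> - Y s \<omega>))\<^sup>2) (\<lambda>\<omega>. 0)"
    unfolding has_ito_integral_def by blast
  note steps = simple_data_steps[OF simple]
  have I_meas [measurable]: "I r \<in> borel_measurable M" if "r \<in> {0..t}" for r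
    using I[OF that] by (simp add: has_ito_integral_def)
  define J where "J k r = simple_integral (W l) (nn k) (\<tau> k) (\<eta> k) r" for k r
  have J_conv: "conv_in_prob M (\<lambda>k. J k r) (I r)" if "r \<in> {0..t}" for r
    unfolding J_def using ito_integral_approximation[OF l _ _ I[OF that] Y_t simple approx] that by auto
  have J_meas [measurable]: "J k r \<in> borel_measurable M" if "r \<in> {0..t}" for k r
    unfolding J_def simple_integral_eq_step_integral
    using steps that by (intro step_integral_measurable[OF l]) auto
  \<comment> \<open>The tolerance is split into shares of \<open>\<epsilon> / 4\<close>, for the
    simple integrals to \<open>r\<close> and to \<open>s\<close> and for their distance from the
    Riemann sum; again \<open>\<delta> / (\<epsilon> / 4)^2 = e\<close>.\<close>
  define \<delta> where "\<delta> = e * (\<epsilon> / 4)\<^sup>2"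
  have "\<delta> > 0" using \<open>e > 0\<close> \<open>\<epsilon> > 0\<close> by (simp add: \<delta>_def)
  have jm: "jointly_measurable M t Y"
    using progressively_jointly_measurable[OF Y] st by simp
  \<comment> \<open>The Riemann sums begin at \<open>s\<close>, so the integrand is switched off up
    to \<open>s\<close> before the comparison.\<close>
  define Y' where "Y' q \<omega> = indicat_real {s<..} q *\<^sub>R Y q \<omega>" for q \<omega>
  have jm': "jointly_measurable M t Y'"
    unfolding Y'_def[abs_def] by (rule jointly_measurable_cut[OF jm])
  have Y'_t: "AE \<omega> in M. set_integrable lborel {0..t} (\<lambda>s. (norm (Y' s \<omega>))\<^sup>2)"
    using Y_t AE_space
  proof eventually_elim
    case (elim \<omega>)
    have [measurable]: "(\<lambda>q. indicat_real {0..t} q *\<^sub>R Y' q \<omega>) \<in> borel_measurable lborel"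
      by (rule jointly_measurable_measurable[OF jm' elim(2)])
    have eq: "(\<lambda>q. indicat_real {0..t} q *\<^sub>R (norm (Y' q \<omega>))\<^sup>2) = (\<lambda>q. (norm (indicat_real {0..t} q *\<^sub>R Y' q \<omega>))\<^sup>2)"
      by (auto simp: indicator_def)
    have meas: "(\<lambda>q. indicat_real {0..t} q *\<^sub>R (norm (Y' q \<omega>))\<^sup>2) \<in> borel_measurable lborel"
      unfolding eq by measurable
    show ?case
      using elim(1) unfolding set_integrable_def
      by (rule Bochner_Integration.integrable_bound[OF _ meas]) (auto simp: Y'_def indicator_def)
  qed
  let ?R = "\<lambda>n. grid s t n ` {..Suc n}"
  let ?D = "\<lambda>n \<omega>. LBINT q:{0..t}. (norm (grid_freeze s t n Y q \<omega> - Y' q \<omega>))\<^sup>2"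
  have grid_in: "grid s t n i \<in> {s..t}" "grid s t n i \<in> {0..t}" if "i \<le> Suc n" for n i
    using grid_bounds[of s t i n] that st by auto
  have frozen: "grid_freeze s t n Y = step_process {..<Suc n} (grid s t n) (\<lambda>j. grid s t n (Suc j)) (\<lambda>j. Y (grid s t n j))" for n
    by (auto simp: grid_freeze_def step_process_def fun_eq_iff)
  have frozen_data: "0 \<le> grid s t n j \<and> grid s t n j \<le> grid s t n (Suc j)"
    "Y (grid s t n j) \<in> borel_measurable (F (grid s t n j))" if "j \<in> {..<Suc n}" for n j
    using that grid_in[of j n] grid_mono[of s t j "Suc j" n] st progressively_adapted[OF Y] by auto
  define S where "S n i \<omega> = (\<Sum>j<i. (W l (grid s t n (Suc j)) \<omega> - W l (grid s t n j) \<omega>) *\<^sub>R Y (grid s t n j) \<omega>)" for n i \<omega>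
  have S_eq: "step_integral l {..<Suc n} (grid s t n) (\<lambda>j. grid s t n (Suc j)) (\<lambda>j. Y (grid s t n j)) (grid s t n i) \<omega> = S n i \<omega>"
    if "i \<le> Suc n" for n i \<omega>
  proof -
    have "step_integral l {..<Suc n} (grid s t n) (\<lambda>j. grid s t n (Suc j)) (\<lambda>j. Y (grid s t n j)) (grid s t n i) \<omega> =
        (\<Sum>j<Suc n. if j \<in> {..<i} then (W l (grid s t n (Suc j)) \<omega> - W l (grid s t n j) \<omega>) *\<^sub>R Y (grid s t n j) \<omega> else 0)"
      unfolding step_integral_def
    proof (intro sum.cong refl)
      fix j
      show "(W l (min (grid s t n i) (grid s t n (Suc j))) \<omega> - W l (min (grid s t n i) (grid s t n j)) \<omega>) *\<^sub>R Y (grid s t n j) \<omega> =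
          (if j \<in> {..<i} then (W l (grid s t n (Suc j)) \<omega> - W l (grid s t n j) \<omega>) *\<^sub>R Y (grid s t n j) \<omega> else 0)"
        using grid_mono[of s t "Suc j" i n] grid_mono[of s t j i n] grid_mono[of s t i j n]
          grid_mono[of s t i "Suc j" n] st
        by (cases "j < i") (auto simp: min_absorb1 min_absorb2)
    qed
    also have "\<dots> = (\<Sum>j\<in>{..<Suc n} \<inter> {..<i}. (W l (grid s t n (Suc j)) \<omega> - W l (grid s t n j) \<omega>) *\<^sub>R Y (grid s t n j) \<omega>)"
      by (rule sum.inter_restrict[symmetric]) simp
    also have "{..<Suc n} \<inter> {..<i} = {..<i}" using that by auto
    finally show ?thesis by (simp add: S_def)
  qed
  have S_meas [measurable]: "S n i \<in> borel_measurable M" if "i \<le> Suc n" for n i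
  proof -
    have "step_integral l {..<Suc n} (grid s t n) (\<lambda>j. grid s t n (Suc j)) (\<lambda>j. Y (grid s t n j)) (grid s t n i) \<in> borel_measurable M"
      using frozen_data grid_in[OF that] by (intro step_integral_measurable[OF l]) auto
    then show ?thesis using S_eq[OF that] by (simp cong: measurable_cong)
  qed
  have bound: "prob (?E n) \<le> e + prob {\<omega> \<in> space M. ?D n \<omega> > \<delta> / 4}" for n
  proof -
    \<comment> \<open>Raising both ends of each interval to at least \<open>s\<close> cuts the
      simple process at \<open>s\<close>; its integral to \<open>r\<close> becomes the difference of
      the original integrals to \<open>r\<close> and to \<open>s\<close>.\<close>
    let ?a = "\<lambda>k i. max s (\<tau> k i)" and ?b = "\<lambda>k i. max s (\<tau> k (Suc i))"
    let ?Q = "\<lambda>k \<omega>. LBINT q:{0..t}. (norm (simple_process (nn k) (\<tau> k) (\<eta> k) q \<omega> - Y q \<omega>))\<^sup>2"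
    let ?Q' = "\<lambda>k \<omega>. LBINT q:{0..t}. (norm (step_process {..<nn k} (?a k) (?b k) (\<eta> k) q \<omega> - Y' q \<omega>))\<^sup>2"
    let ?e = "\<lambda>k r. prob {\<omega> \<in> space M. norm (J k r \<omega> - I r \<omega>) > \<epsilon> / 4}"
    have cut_data: "0 \<le> ?a k i \<and> ?a k i \<le> ?b k i" "\<eta> k i \<in> borel_measurable (F (?a k i))" if "i \<in> {..<nn k}" for k i
    proof -
      have i: "i < nn k" using that by simp
      show "0 \<le> ?a k i \<and> ?a k i \<le> ?b k i"
        using steps(1)[OF i] st(1) by (intro conjI max.mono order_refl) (auto intro: max.coboundedI1)
      show "\<eta> k i \<in> borel_measurable (F (?a k i))"
        using steps[OF i] by (intro measurable_F_mono[OF steps(2)[OF i]]) auto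
    qed
    have cut_int: "step_integral l {..<nn k} (?a k) (?b k) (\<eta> k) r \<omega> = J k r \<omega> - J k s \<omega>" if "s \<le> r" for k r \<omega>
    proof -
      have *: "W l (min r (max s x)) \<omega> = W l (min r x) \<omega> - W l (min s x) \<omega> + W l s \<omega>" for x
        using that by (auto simp: min_def max_def)
      show ?thesis
        unfolding J_def simple_integral_def step_integral_def sum_subtractf[symmetric] *
        by (intro sum.cong) (auto simp: algebra_simps)
    qed
    have cut_proc: "step_process {..<nn k} (?a k) (?b k) (\<eta> k) q \<omega> =
        indicat_real {s<..} q *\<^sub>R simple_process (nn k) (\<tau> k) (\<eta> k) q \<omega>" for k q \<omega>
      unfolding step_process_def simple_process_def scaleR_sum_right
      by (intro sum.cong) (auto simp: indicator_def)
    have Q'_le: "prob {\<omega> \<in> space M. ?Q' k \<omega> > \<delta> / 4} \<le> prob {\<omega> \<in> space M. ?Q k \<omega> > \<delta> / 4}" for k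
    proof (rule AE_subset_prob_le)
      show "AE \<omega> in M. \<omega> \<in> {\<omega> \<in> space M. ?Q' k \<omega> > \<delta> / 4} \<longrightarrow> \<omega> \<in> {\<omega> \<in> space M. ?Q k \<omega> > \<delta> / 4}"
        using Y_t AE_space
      proof eventually_elim
        case (elim \<omega>)
        have "?Q' k \<omega> \<le> ?Q k \<omega>"
          unfolding set_lebesgue_integral_def
        proof (rule integral_mono')
          show "integrable lborel (\<lambda>q. indicat_real {0..t} q *\<^sub>R (norm (simple_process (nn k) (\<tau> k) (\<eta> k) q \<omega> - Y q \<omega>))\<^sup>2)"
            using step_process_square_integrable[OF jm elim(2) finite_lessThan elim(1)]
            unfolding simple_process_eq_step_process set_integrable_def .
        qed (auto simp: cut_proc Y'_def indicator_def)
        with elim show ?case by auto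
      qed
      have "?Q k \<in> borel_measurable M"
        unfolding simple_process_eq_step_process
        using steps by (intro square_integral_measurable jointly_measurable_diff jm step_process_jointly_measurable) auto
      then show "{\<omega> \<in> space M. ?Q k \<omega> > \<delta> / 4} \<in> events" by measurable
    qed
    \<comment> \<open>A bound for every \<open>k\<close> of an event that is independent of
      \<open>k\<close>. The sum runs over the grid points, finitely many for fixed \<open>n\<close>,
      so it vanishes as \<open>k\<close> grows.\<close>
    have "prob (?E n) \<le> (\<Sum>r\<in>?R n. ?e k r) + ?e k s +
        (e + (prob {\<omega> \<in> space M. ?Q k \<omega> > \<delta> / 4} + prob {\<omega> \<in> space M. ?D n \<omega> > \<delta> / 4}))" for k
    proof -
      let ?C = "{\<omega> \<in> space M. \<exists>r\<in>?R n. norm (step_integral l {..<nn k} (?a k) (?b k) (\<eta> k) r \<omega> -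
          step_integral l {..<Suc n} (grid s t n) (\<lambda>j. grid s t n (Suc j)) (\<lambda>j. Y (grid s t n j)) r \<omega>) > \<epsilon> / 4}"
      let ?A = "\<lambda>r. {\<omega> \<in> space M. norm (J k r \<omega> - I r \<omega>) > \<epsilon> / 4}"
      have C_ev: "?C \<in> events"
        using frozen_data cut_data grid_in
        by (intro events_finite_ex borel_measurable_diff step_integral_measurable[OF l]) auto
      have A_ev: "?A r \<in> events" if "r \<in> {0..t}" for r
        using that by measurable
      have sub: "?E n \<subseteq> (\<Union>r\<in>?R n. ?A r) \<union> ?A s \<union> ?C"
      proof
        fix \<omega> assume "\<omega> \<in> ?E n"
        then obtain i where \<omega>: "\<omega> \<in> space M" and i: "i \<le> Suc n"
          and gt: "norm (I (grid s t n i) \<omega> - I s \<omega> - S n i \<omega>) > \<epsilon>"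
          by (auto simp: S_def)
        let ?r = "grid s t n i"
        show "\<omega> \<in> (\<Union>r\<in>?R n. ?A r) \<union> ?A s \<union> ?C"
        proof (rule ccontr)
          assume "\<not> ?thesis"
          then have *: "\<omega> \<notin> ?A ?r" "\<omega> \<notin> ?A s" "\<omega> \<notin> ?C"
            using i by auto
          have "?r \<in> ?R n" using i by simp
          with *(3) \<omega> have "\<not> norm (step_integral l {..<nn k} (?a k) (?b k) (\<eta> k) ?r \<omega> -
            step_integral l {..<Suc n} (grid s t n) (\<lambda>j. grid s t n (Suc j)) (\<lambda>j. Y (grid s t n j)) ?r \<omega>) > \<epsilon> / 4"
            by blast
          then have "norm (J k ?r \<omega> - J k s \<omega> - S n i \<omega>) \<le> \<epsilon> / 4"
            using cut_int[of ?r k \<omega>] S_eq[OF i, of \<omega>] grid_in[OF i] by simp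
          moreover have "norm (J k ?r \<omega> - I ?r \<omega>) \<le> \<epsilon> / 4" "norm (J k s \<omega> - I s \<omega>) \<le> \<epsilon> / 4"
            using * \<omega> by (simp_all add: not_less)
          moreover have "norm (I ?r \<omega> - I s \<omega> - S n i \<omega>) \<le>
              norm (J k ?r \<omega> - J k s \<omega> - S n i \<omega>) + norm (J k ?r \<omega> - I ?r \<omega>) + norm (J k s \<omega> - I s \<omega>)"
            using norm_triangle_ineq[of "(J k ?r \<omega> - J k s \<omega> - S n i \<omega>) - (J k ?r \<omega> - I ?r \<omega>)" "J k s \<omega> - I s \<omega>"]
              norm_triangle_ineq4[of "J k ?r \<omega> - J k s \<omega> - S n i \<omega>" "J k ?r \<omega> - I ?r \<omega>"]
            by (simp add: algebra_simps)
          ultimately show False using gt \<open>\<epsilon> > 0\<close> by linarith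
        qed
      qed
      have un_ev: "(\<Union>r\<in>?R n. ?A r) \<in> events"
        using A_ev grid_in(2) by (intro sets.finite_UN) blast+
      have "prob (?E n) \<le> prob (\<Union>r\<in>?R n. ?A r) + prob (?A s) + prob ?C"
        by (rule prob_subset_Un3[OF sub un_ev A_ev C_ev]) (use st in simp)
      also have "prob (\<Union>r\<in>?R n. ?A r) \<le> (\<Sum>r\<in>?R n. ?e k r)"
      proof (rule finite_measure_subadditive_finite)
        show "?A ` ?R n \<subseteq> events" using A_ev grid_in(2) by blast
      qed simp
      also have "prob ?C \<le> \<delta> / (\<epsilon> / 4)\<^sup>2 + (prob {\<omega> \<in> space M. ?Q' k \<omega> > \<delta> / 4} + prob {\<omega> \<in> space M. ?D n \<omega> > \<delta> / 4})"
        unfolding frozen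
      proof (rule step_comparison[OF l finite_lessThan finite_lessThan _ _ cut_data(1) frozen_data(1)
            cut_data(2) frozen_data(2) _ _ _ jm' Y'_t])
        show "?R n \<subseteq> {0..t}" using grid_in(2) by blast
      qed (use \<open>\<delta> > 0\<close> \<open>\<epsilon> > 0\<close> st in simp_all)
      also have "\<delta> / (\<epsilon> / 4)\<^sup>2 = e"
        using \<open>\<epsilon> > 0\<close> by (simp add: \<delta>_def)
      finally show ?thesis using Q'_le[of k] by linarith
    qed
    moreover have "(\<lambda>k. (\<Sum>r\<in>?R n. ?e k r) + ?e k s +
        (e + (prob {\<omega> \<in> space M. ?Q k \<omega> > \<delta> / 4} + prob {\<omega> \<in> space M. ?D n \<omega> > \<delta> / 4}))) \<longlonglongrightarrow>
        (\<Sum>r\<in>?R n. 0) + 0 + (e + (0 + prob {\<omega> \<in> space M. ?D n \<omega> > \<delta> / 4}))"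
    proof (intro tendsto_add tendsto_sum tendsto_const)
      show "(\<lambda>k. ?e k r) \<longlonglongrightarrow> 0" if "r \<in> ?R n" for r
        using that grid_in \<open>\<epsilon> > 0\<close> by (intro conv_in_probD J_conv) auto
      show "(\<lambda>k. ?e k s) \<longlonglongrightarrow> 0"
        using st \<open>\<epsilon> > 0\<close> by (intro conv_in_probD J_conv) auto
      have abs: "\<bar>LBINT q:A. (norm (f q))\<^sup>2\<bar> = (LBINT q:A. (norm (f q))\<^sup>2)" for f :: "real \<Rightarrow> 'b" and A
        unfolding set_lebesgue_integral_def
        by (rule abs_of_nonneg) (auto intro!: Bochner_Integration.integral_nonneg)
      show "(\<lambda>k. prob {\<omega> \<in> space M. ?Q k \<omega> > \<delta> / 4}) \<longlonglongrightarrow> 0"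
        using conv_in_probD[OF approx, of "\<delta> / 4"] \<open>\<delta> > 0\<close>
        unfolding diff_zero real_norm_def abs by simp
    qed
    ultimately show ?thesis
      by (intro LIMSEQ_le_const[where X = "\<lambda>k. (\<Sum>r\<in>?R n. ?e k r) + ?e k s +
        (e + (prob {\<omega> \<in> space M. ?Q k \<omega> > \<delta> / 4} + prob {\<omega> \<in> space M. ?D n \<omega> > \<delta> / 4}))"]) auto
  qed
  have "(\<lambda>n. prob {\<omega> \<in> space M. ?D n \<omega> > \<delta> / 4}) \<longlonglongrightarrow> 0"
  proof (rule AE_imp_prob_tendsto_0)
    show "{\<omega> \<in> space M. ?D n \<omega> > \<delta> / 4} \<in> events" for n
    proof -
      have "?D n \<in> borel_measurable M"
        unfolding frozen using frozen_data
        by (intro square_integral_measurable jointly_measurable_diff jm' step_process_jointly_measurable) auto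
      then show ?thesis by measurable
    qed
    show "AE \<omega> in M. \<forall>\<^sub>F n in sequentially. \<omega> \<notin> {\<omega> \<in> space M. ?D n \<omega> > \<delta> / 4}"
      using cont
    proof eventually_elim
      case (elim \<omega>)
      define c where "c = sqrt (\<delta> / 4 / t)"
      have "t > 0" using st by simp
      then have c: "c > 0" "c\<^sup>2 * t = \<delta> / 4"
        using \<open>\<delta> > 0\<close> by (auto simp: c_def)
      have "continuous_on {s..t} (\<lambda>q. Y q \<omega>)"
        using elim by (rule continuous_on_subset) (use st in auto)
      from grid_freeze_uniform[where Y = Y and \<omega> = \<omega>, OF this st(2) c(1)] show ?case
      proof eventually_elim
        case (elim n)
        have "?D n \<omega> \<le> c\<^sup>2 * t"
        proof (rule set_lebesgue_integral_le_const)
          fix q assume q: "q \<in> {0..t}"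
          show "(norm (grid_freeze s t n Y q \<omega> - Y' q \<omega>))\<^sup>2 \<le> c\<^sup>2"
          proof (cases "s < q")
            case True
            then have "norm (grid_freeze s t n Y q \<omega> - Y' q \<omega>) < c"
              using elim q by (auto simp: Y'_def)
            then show ?thesis by (intro power_mono) auto
          next
            case False
            then show ?thesis using grid_freeze_before[OF st(2), of q n Y \<omega>] by (simp add: Y'_def)
          qed
        qed (use \<open>t > 0\<close> in auto)
        then show ?case using c(2) by simp
      qed
    qed
  qed
  then show "\<exists>q. q \<longlonglongrightarrow> 0 \<and> (\<forall>n. prob (?E n) \<le> e + q n)"
    using bound by blast
qed simp

end

section \<open>Estimates on single cells and union bounds\<close>

lemma bounded_on_compact_interval:
  fixes f :: "real \<Rightarrow> 'b::real_normed_vector"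
  assumes "continuous_on {s..t} f"
  obtains C where "C \<ge> 0" "\<And>q. q \<in> {s..t} \<Longrightarrow> norm (f q) \<le> C"
proof -
  have "bounded (f ` {s..t})"
    using assms by (intro compact_imp_bounded compact_continuous_image) auto
  then obtain C where "C > 0" "\<And>x. x \<in> f ` {s..t} \<Longrightarrow> norm x \<le> C"
    using bounded_pos by metis
  with that[of C] show thesis by auto
qed

text \<open>The left-point rule on one cell. The cell is written as a difference of integrals from 0
  because the equation is given in integrated form.\<close>

lemma integral_cell:
  fixes f :: "real \<Rightarrow> 'b::euclidean_space"
  assumes cont: "continuous_on {0..b} f" and ab: "0 \<le> a" "a \<le> b"
    and e: "\<And>q. q \<in> {a..b} \<Longrightarrow> norm (f q - c) \<le> e"
  shows "norm ((LBINT q:{0..b}. f q) - (LBINT q:{0..a}. f q) - (b - a) *\<^sub>R c) \<le> e * (b - a)"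
proof -
  have int_b: "set_integrable lborel {0..b} f"
    by (rule borel_integrable_atLeastAtMost') (rule cont)
  have ints: "set_integrable lborel {0..a} f" "set_integrable lborel {a<..b} f"
    by (rule set_integrable_subset[OF int_b]; use ab in auto)+
  have un: "{0..b} = {0..a} \<union> {a<..b}" using ab by auto
  have const: "set_integrable lborel {a<..b} (\<lambda>_. c)"
    unfolding set_integrable_def using ab
    by (intro integrable_scaleR_left integrable_real_indicator) auto
  have "(LBINT q:{0..b}. f q) - (LBINT q:{0..a}. f q) = (LBINT q:{a<..b}. f q)"
    unfolding un using ints by (subst set_integral_Un) auto
  moreover have "(LBINT q:{a<..b}. c) = (b - a) *\<^sub>R c"
    using ab by (simp add: set_lebesgue_integral_def)
  ultimately have "(LBINT q:{0..b}. f q) - (LBINT q:{0..a}. f q) - (b - a) *\<^sub>R c = (LBINT q:{a<..b}. f q - c)"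
    using ints const by (subst set_integral_diff) auto
  also have "norm \<dots> \<le> (\<integral>q. indicat_real {a<..b} q * e \<partial>lborel)"
    unfolding set_lebesgue_integral_def
  proof (rule Bochner_Integration.integral_norm_bound_integral)
    show "integrable lborel (\<lambda>q. indicat_real {a<..b} q *\<^sub>R (f q - c))"
      using set_integral_diff(1)[OF ints(2) const] by (simp add: set_integrable_def)
    show "integrable lborel (\<lambda>q. indicat_real {a<..b} q * e)"
      using ab by (intro integrable_mult_left integrable_real_indicator) auto
    show "norm (indicat_real {a<..b} q *\<^sub>R (f q - c)) \<le> indicat_real {a<..b} q * e" for q
      using e[of q] by (auto simp: indicator_def)
  qed
  also have "\<dots> = e * (b - a)" using ab by simp
  finally show ?thesis .
qed

lemma (in prob_space) prob_exists_sum_le: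
  fixes f :: "nat \<Rightarrow> 'k \<Rightarrow> 'a \<Rightarrow> 'b::euclidean_space" and g :: "'k \<Rightarrow> 'a \<Rightarrow> 'b"
  assumes L: "finite L" and R: "finite R"
    and f: "\<And>l r. l \<in> L \<Longrightarrow> r \<in> R \<Longrightarrow> f l r \<in> borel_measurable M"
    and g: "\<And>r. r \<in> R \<Longrightarrow> g r \<in> borel_measurable M"
    and e: "e + real (card L) * e \<le> \<epsilon>"
  shows "prob {\<omega> \<in> space M. \<exists>r\<in>R. norm (g r \<omega> + (\<Sum>l\<in>L. f l r \<omega>)) > \<epsilon>} \<le>
    prob {\<omega> \<in> space M. \<exists>r\<in>R. norm (g r \<omega>) > e} +
    (\<Sum>l\<in>L. prob {\<omega> \<in> space M. \<exists>r\<in>R. norm (f l r \<omega>) > e})"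
proof -
  let ?A = "\<lambda>l. {\<omega> \<in> space M. \<exists>r\<in>R. norm (f l r \<omega>) > e}"
  let ?B = "{\<omega> \<in> space M. \<exists>r\<in>R. norm (g r \<omega>) > e}"
  have A: "?A l \<in> events" if "l \<in> L" for l
    using that f R by (intro events_finite_ex) auto
  have B: "?B \<in> events"
    using g R by (intro events_finite_ex) auto
  have UA: "(\<Union>l\<in>L. ?A l) \<in> events"
    using A L by (intro sets.finite_UN) auto
  have "{\<omega> \<in> space M. \<exists>r\<in>R. norm (g r \<omega> + (\<Sum>l\<in>L. f l r \<omega>)) > \<epsilon>} \<subseteq> ?B \<union> (\<Union>l\<in>L. ?A l)"
  proof
    fix \<omega> assume "\<omega> \<in> {\<omega> \<in> space M. \<exists>r\<in>R. norm (g r \<omega> + (\<Sum>l\<in>L. f l r \<omega>)) > \<epsilon>}"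
    then obtain r where \<omega>: "\<omega> \<in> space M" and r: "r \<in> R" and gt: "norm (g r \<omega> + (\<Sum>l\<in>L. f l r \<omega>)) > \<epsilon>"
      by auto
    show "\<omega> \<in> ?B \<union> (\<Union>l\<in>L. ?A l)"
    proof (rule ccontr)
      assume "\<not> ?thesis"
      then have le: "norm (g r \<omega>) \<le> e" "\<And>l. l \<in> L \<Longrightarrow> norm (f l r \<omega>) \<le> e"
        using \<omega> r by (auto simp: not_less)
      have "norm (g r \<omega> + (\<Sum>l\<in>L. f l r \<omega>)) \<le> norm (g r \<omega>) + norm (\<Sum>l\<in>L. f l r \<omega>)"
        by (rule norm_triangle_ineq)
      also have "norm (\<Sum>l\<in>L. f l r \<omega>) \<le> (\<Sum>l\<in>L. e)"
        by (rule sum_norm_le) (rule le)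
      finally show False using gt le(1) e by simp
    qed
  qed
  then have "prob {\<omega> \<in> space M. \<exists>r\<in>R. norm (g r \<omega> + (\<Sum>l\<in>L. f l r \<omega>)) > \<epsilon>} \<le> prob (?B \<union> (\<Union>l\<in>L. ?A l))"
    using B UA by (intro finite_measure_mono) auto
  also have "\<dots> \<le> prob ?B + prob (\<Union>l\<in>L. ?A l)"
    using B UA by (intro measure_subadditive) auto
  also have "prob (\<Union>l\<in>L. ?A l) \<le> (\<Sum>l\<in>L. prob (?A l))"
    using A L by (intro finite_measure_subadditive_finite) auto
  finally show ?thesis by simp
qed

section \<open>Linear stochastic differential equations\<close>

text \<open>The equation over a real Euclidean space with operators for matrices. It holds at each
  time almost surely, with integrals that may be chosen separately for each time.\<close>

locale linear_sde = wiener_system M F m W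
  for M :: "'w measure" and F :: "real \<Rightarrow> 'w measure" and m :: nat and W :: "nat \<Rightarrow> real \<Rightarrow> 'w \<Rightarrow> real" +
  fixes G :: "'b::euclidean_space endo" and A :: "nat \<Rightarrow> 'b endo" and \<xi> :: 'b
    and X :: "real \<Rightarrow> 'w \<Rightarrow> 'b"
  assumes X_progressive: "progressively_measurable F X"
    and X_continuous: "AE \<omega> in M. continuous_on {0..} (\<lambda>t. X t \<omega>)"
    and X_0: "AE \<omega> in M. X 0 \<omega> = \<xi>"
    and X_equation: "\<And>t. t \<ge> 0 \<Longrightarrow> \<exists>I.
        (\<forall>l\<in>{1..m}. has_ito_integral M F (W l) (\<lambda>s \<omega>. app (A l) (X s \<omega>)) t (I l)) \<and>
        (AE \<omega> in M. X t \<omega> = \<xi> + (LBINT s:{0..t}. app G (X s \<omega>)) + (\<Sum>l=1..m. I l \<omega>))"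
begin

lemma X_adapted: "0 \<le> s \<Longrightarrow> s \<le> t \<Longrightarrow> X s \<in> borel_measurable (F t)"
  using progressively_adapted[OF X_progressive] measurable_F_mono by blast

lemma X_measurable [measurable]: "0 \<le> s \<Longrightarrow> X s \<in> borel_measurable M"
  using X_adapted measurable_F_M by blast

lemma W_continuous: "l \<in> {1..m} \<Longrightarrow> AE \<omega> in M. continuous_on {0..} (\<lambda>t. W l t \<omega>)"
  using wiener unfolding independent_wiener_processes_def wiener_process_def by blast

text \<open>The solution is inserted into the Euler scheme with drift; this is the residual
  accumulated up to the grid point \<open>i\<close>.\<close>

definition defect :: "real \<Rightarrow> real \<Rightarrow> nat \<Rightarrow> nat \<Rightarrow> 'w \<Rightarrow> 'b" where
  "defect s t n i \<omega> = X (grid s t n i) \<omega> - X s \<omega> -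
    (\<Sum>j<i. ((t - s) / real (Suc n)) *\<^sub>R app G (X (grid s t n j) \<omega>) +
      (\<Sum>l=1..m. (W l (grid s t n (Suc j)) \<omega> - W l (grid s t n j) \<omega>) *\<^sub>R app (A l) (X (grid s t n j) \<omega>)))"

lemma grid_measurable:
  assumes "0 \<le> s" "s < t" "i \<le> Suc n"
  shows "X (grid s t n i) \<in> borel_measurable M" "l \<in> {1..m} \<Longrightarrow> W l (grid s t n i) \<in> borel_measurable M"
  using grid_bounds[of s t i n] assms X_measurable W_measurable by auto

lemma defect_measurable:
  assumes st: "0 \<le> s" "s < t" and i: "i \<le> Suc n"
  shows "defect s t n i \<in> borel_measurable (F (grid s t n i))"
proof -
  have m1: "X (grid s t n j) \<in> borel_measurable (F (grid s t n i))" if "j \<le> i" for j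
    using that grid_mono[of s t j i n] grid_bounds[of s t j n] st i by (intro X_adapted) auto
  have m2: "W l (grid s t n j) \<in> borel_measurable (F (grid s t n i))" if "j \<le> i" "l \<in> {1..m}" for l j
    using that grid_mono[of s t j i n] grid_bounds[of s t j n] st i by (intro W_adapted) auto
  have m3: "X s \<in> borel_measurable (F (grid s t n i))"
    using m1[of 0] by simp
  show ?thesis
    unfolding defect_def
    by (intro borel_measurable_diff borel_measurable_sum borel_measurable_add borel_measurable_scaleR
        borel_measurable_const measurable_app m1 m2 m3) auto
qed

text \<open>The residual splits into a drift part, which is a pathwise error of a left-point rule,
  and one noise part for each Wiener process, which is the error treated in
  \<open>ito_integral_riemann\<close>.\<close>

lemma defect_vanishes:
  assumes st: "0 \<le> s" "s < t" and "\<kappa> > 0"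
  shows "(\<lambda>n. prob {\<omega> \<in> space M. \<exists>i\<in>{..Suc n}. norm (defect s t n i \<omega>) > \<kappa>}) \<longlonglongrightarrow> 0"
proof -
  have "\<forall>r\<in>{0..}. \<exists>I. (\<forall>l\<in>{1..m}. has_ito_integral M F (W l) (\<lambda>s \<omega>. app (A l) (X s \<omega>)) r (I l)) \<and>
        (AE \<omega> in M. X r \<omega> = \<xi> + (LBINT s:{0..r}. app G (X s \<omega>)) + (\<Sum>l=1..m. I l \<omega>))"
    using X_equation by auto
  from bchoice[OF this] obtain J where J_all: "\<forall>r\<in>{0..}.
      (\<forall>l\<in>{1..m}. has_ito_integral M F (W l) (\<lambda>s \<omega>. app (A l) (X s \<omega>)) r (J r l)) \<and>
      (AE \<omega> in M. X r \<omega> = \<xi> + (LBINT s:{0..r}. app G (X s \<omega>)) + (\<Sum>l=1..m. J r l \<omega>))" ..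
  have J: "has_ito_integral M F (W l) (\<lambda>s \<omega>. app (A l) (X s \<omega>)) r (J r l)" if "r \<ge> 0" "l \<in> {1..m}" for r l
    using conjunct1[OF bspec[OF J_all, of r]] that by simp
  have X_eq: "AE \<omega> in M. X r \<omega> = \<xi> + (LBINT s:{0..r}. app G (X s \<omega>)) + (\<Sum>l=1..m. J r l \<omega>)" if "r \<ge> 0" for r
    using conjunct2[OF bspec[OF J_all, of r]] that by simp
  have J_meas: "J r l \<in> borel_measurable M" if "r \<ge> 0" "l \<in> {1..m}" for r l
    using J[OF that] by (simp add: has_ito_integral_def)
  let ?h = "\<lambda>n. (t - s) / real (Suc n)" and ?g = "\<lambda>n i. grid s t n i"
  define noise where "noise n l i \<omega> = J (?g n i) l \<omega> - J s l \<omega> -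
      (\<Sum>j<i. (W l (?g n (Suc j)) \<omega> - W l (?g n j) \<omega>) *\<^sub>R app (A l) (X (?g n j) \<omega>))" for n l i \<omega>
  define drift where "drift n i \<omega> = X (?g n i) \<omega> - X s \<omega> - (\<Sum>l=1..m. J (?g n i) l \<omega> - J s l \<omega>) -
      (\<Sum>j<i. ?h n *\<^sub>R app G (X (?g n j) \<omega>))" for n i \<omega>
  have g_nonneg: "0 \<le> ?g n i" if "i \<le> Suc n" for n i
    using grid_bounds[of s t i n] that st by simp
  have split: "defect s t n i \<omega> = drift n i \<omega> + (\<Sum>l=1..m. noise n l i \<omega>)" for n i \<omega>
  proof -
    have "(\<Sum>j<i. \<Sum>l=1..m. (W l (?g n (Suc j)) \<omega> - W l (?g n j) \<omega>) *\<^sub>R app (A l) (X (?g n j) \<omega>)) =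
        (\<Sum>l=1..m. \<Sum>j<i. (W l (?g n (Suc j)) \<omega> - W l (?g n j) \<omega>) *\<^sub>R app (A l) (X (?g n j) \<omega>))"
      by (rule sum.swap)
    then show ?thesis
      unfolding defect_def drift_def noise_def sum.distrib sum_subtractf by simp
  qed
  have noise_meas: "noise n l i \<in> borel_measurable M" if "l \<in> {1..m}" "i \<le> Suc n" for n l i
    unfolding noise_def using that st
    by (intro borel_measurable_diff borel_measurable_sum borel_measurable_scaleR measurable_app
        J_meas grid_measurable g_nonneg) auto
  have drift_meas: "drift n i \<in> borel_measurable M" if "i \<le> Suc n" for n i
    unfolding drift_def using that st
    by (intro borel_measurable_diff borel_measurable_sum borel_measurable_scaleR measurable_app
        J_meas grid_measurable g_nonneg X_measurable borel_measurable_const) auto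
  \<comment> \<open>One share for the drift and one for each of the \<open>m\<close> noise
    parts.\<close>
  define \<kappa>' where "\<kappa>' = \<kappa> / (1 + real m)"
  have "\<kappa>' * (1 + real m) = \<kappa>" "1 + real m > 0"
    by (simp_all add: \<kappa>'_def)
  then have \<kappa>': "\<kappa>' > 0" "\<kappa>' + real m * \<kappa>' \<le> \<kappa>"
    using \<open>\<kappa> > 0\<close> by (simp add: \<kappa>'_def) (use \<open>\<kappa>' * (1 + real m) = \<kappa>\<close> in \<open>simp add: algebra_simps\<close>)
  have "(\<lambda>n. prob {\<omega> \<in> space M. \<exists>i\<in>{..Suc n}. norm (drift n i \<omega>) > \<kappa>'}) \<longlonglongrightarrow> 0"
  proof (rule AE_imp_prob_tendsto_0)
    show "{\<omega> \<in> space M. \<exists>i\<in>{..Suc n}. norm (drift n i \<omega>) > \<kappa>'} \<in> events" for n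
      using drift_meas by (intro events_finite_ex) auto
    \<comment> \<open>The equation holds outside a null set that depends on the time; the points of
      all grids are countably many, so one null set serves them all.\<close>
    have "AE \<omega> in M. \<forall>n. \<forall>i\<in>{..Suc n}. X (?g n i) \<omega> = \<xi> + (LBINT s:{0..?g n i}. app G (X s \<omega>)) + (\<Sum>l=1..m. J (?g n i) l \<omega>)"
      unfolding AE_all_countable using g_nonneg by (intro allI AE_ball_countable' X_eq) auto
    then show "AE \<omega> in M. \<forall>\<^sub>F n in sequentially. \<omega> \<notin> {\<omega> \<in> space M. \<exists>i\<in>{..Suc n}. norm (drift n i \<omega>) > \<kappa>'}"
      using X_continuous
    proof eventually_elim
      case (elim \<omega>)
      note X_grid = bspec[OF spec[OF elim(1)]]
      let ?f = "\<lambda>q. app G (X q \<omega>)"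
      have cont: "continuous_on {0..} ?f"
        by (rule app.continuous_on[OF continuous_on_const elim(2)])
      define e where "e = \<kappa>' / (t - s)"
      have e: "e > 0" "e * (t - s) = \<kappa>'" using \<kappa>' st by (auto simp: e_def)
      have "continuous_on {s..t} ?f"
        by (rule continuous_on_subset[OF cont]) (use st in auto)
      from grid_oscillation[OF this st(2) e(1)] show ?case
      proof eventually_elim
        case (elim n)
        note osc = this
        let ?I = "\<lambda>i. LBINT q:{0..?g n i}. ?f q"
        have "norm (?I i - ?I 0 - (\<Sum>j<i. ?h n *\<^sub>R ?f (?g n j))) \<le> real i * (e * ?h n)" if "i \<le> Suc n" for i
          using that
        proof (induction i)
          case (Suc i)
          have "norm (?I (Suc i) - ?I i - (?g n (Suc i) - ?g n i) *\<^sub>R ?f (?g n i)) \<le> e * (?g n (Suc i) - ?g n i)"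
          proof (rule integral_cell)
            show "continuous_on {0..?g n (Suc i)} ?f"
              by (rule continuous_on_subset[OF cont]) auto
            show "norm (?f q - ?f (?g n i)) \<le> e" if "q \<in> {?g n i..?g n (Suc i)}" for q
              using osc that Suc.prems by (intro less_imp_le) auto
          qed (use g_nonneg[of i n] grid_less[OF st(2), of n i] Suc.prems in auto)
          then have "norm (?I (Suc i) - ?I i - ?h n *\<^sub>R ?f (?g n i)) \<le> e * ?h n"
            by (simp only: grid_Suc)
          moreover have "norm (?I i - ?I 0 - (\<Sum>j<i. ?h n *\<^sub>R ?f (?g n j))) \<le> real i * (e * ?h n)"
            using Suc by simp
          moreover have "?I (Suc i) - ?I 0 - (\<Sum>j<Suc i. ?h n *\<^sub>R ?f (?g n j)) =
            (?I (Suc i) - ?I i - ?h n *\<^sub>R ?f (?g n i)) + (?I i - ?I 0 - (\<Sum>j<i. ?h n *\<^sub>R ?f (?g n j)))"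
            by simp
          ultimately have "norm (?I (Suc i) - ?I 0 - (\<Sum>j<Suc i. ?h n *\<^sub>R ?f (?g n j))) \<le> e * ?h n + real i * (e * ?h n)"
            by (metis norm_triangle_mono)
          then show ?case by (simp only: of_nat_Suc distrib_right mult_1_left)
        qed simp
        moreover have "drift n i \<omega> = ?I i - ?I 0 - (\<Sum>j<i. ?h n *\<^sub>R ?f (?g n j))" if "i \<le> Suc n" for i
        proof -
          have "X (?g n i) \<omega> = \<xi> + ?I i + (\<Sum>l=1..m. J (?g n i) l \<omega>)"
            "X (?g n 0) \<omega> = \<xi> + ?I 0 + (\<Sum>l=1..m. J (?g n 0) l \<omega>)"
            by (intro X_grid; use that in simp)+
          then show ?thesis by (simp add: drift_def sum_subtractf)
        qed
        moreover have "real i * (e * ?h n) \<le> \<kappa>'" if "i \<le> Suc n" for i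
        proof -
          have "real i * (e * ?h n) \<le> real (Suc n) * (e * ?h n)"
            using that e st by (intro mult_right_mono) auto
          also have "\<dots> = \<kappa>'" using e(2) by (simp del: of_nat_Suc)
          finally show ?thesis .
        qed
        ultimately have "norm (drift n i \<omega>) \<le> \<kappa>'" if "i \<le> Suc n" for i
          using that order_trans[of "norm (drift n i \<omega>)" "real i * (e * ?h n)" \<kappa>'] by metis
        then show ?case by (auto simp: not_less[symmetric])
      qed
    qed
  qed
  moreover have "(\<lambda>n. \<Sum>l=1..m. prob {\<omega> \<in> space M. \<exists>i\<in>{..Suc n}. norm (noise n l i \<omega>) > \<kappa>'}) \<longlonglongrightarrow> (\<Sum>l=1..m. 0)"
  proof (rule tendsto_sum)
    fix l assume l: "l \<in> {1..m}"
    have "AE \<omega> in M. continuous_on {0..} (\<lambda>q. app (A l) (X q \<omega>))"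
      using X_continuous by eventually_elim (rule app.continuous_on[OF continuous_on_const])
    then show "(\<lambda>n. prob {\<omega> \<in> space M. \<exists>i\<in>{..Suc n}. norm (noise n l i \<omega>) > \<kappa>'}) \<longlonglongrightarrow> 0"
      unfolding noise_def
      by (intro ito_integral_riemann[OF l st, of "\<lambda>q \<omega>. app (A l) (X q \<omega>)" "\<lambda>r. J r l"] J l \<kappa>') auto
  qed
  ultimately have lim: "(\<lambda>n. prob {\<omega> \<in> space M. \<exists>i\<in>{..Suc n}. norm (drift n i \<omega>) > \<kappa>'} +
      (\<Sum>l=1..m. prob {\<omega> \<in> space M. \<exists>i\<in>{..Suc n}. norm (noise n l i \<omega>) > \<kappa>'})) \<longlonglongrightarrow> 0"
    using tendsto_add by fastforce
  show ?thesis
  proof (rule tendsto_sandwich[OF _ _ tendsto_const lim])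
    show "\<forall>\<^sub>F n in sequentially. prob {\<omega> \<in> space M. \<exists>i\<in>{..Suc n}. norm (defect s t n i \<omega>) > \<kappa>} \<le>
      prob {\<omega> \<in> space M. \<exists>i\<in>{..Suc n}. norm (drift n i \<omega>) > \<kappa>'} +
      (\<Sum>l=1..m. prob {\<omega> \<in> space M. \<exists>i\<in>{..Suc n}. norm (noise n l i \<omega>) > \<kappa>'})"
      unfolding split using noise_meas drift_meas \<kappa>'(2)
      by (intro always_eventually allI prob_exists_sum_le) auto
  qed simp
qed


section \<open>Removal of the drift\<close>

definition pullback :: "real \<Rightarrow> 'w \<Rightarrow> 'b" where
  "pullback q \<omega> = app (exp (- q *\<^sub>R G)) (X q \<omega>)"

definition coeff :: "nat \<Rightarrow> real \<Rightarrow> 'b endo" where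
  "coeff l = conj_exp G (A l)"

definition pullback_defect :: "real \<Rightarrow> real \<Rightarrow> nat \<Rightarrow> nat \<Rightarrow> 'w \<Rightarrow> 'b" where
  "pullback_defect s t n i \<omega> = pullback (grid s t n i) \<omega> - pullback s \<omega> -
    (\<Sum>j<i. \<Sum>l=1..m. (W l (grid s t n (Suc j)) \<omega> - W l (grid s t n j) \<omega>) *\<^sub>R
      app (coeff l (grid s t n j)) (pullback (grid s t n j) \<omega>))"

text \<open>What the change to the pulled back equation costs in each cell: the drift step
  \<open>1 + hG\<close> in place of \<open>exp(hG)\<close>, and the propagator at the right instead
  of the left end of the cell in front of the noise.\<close>

definition local_error :: "real \<Rightarrow> real \<Rightarrow> nat \<Rightarrow> nat \<Rightarrow> 'w \<Rightarrow> 'b" where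
  "local_error s t n i \<omega> = (let h = (t - s) / real (Suc n) in \<Sum>j<i.
    app (exp (- grid s t n (Suc j) *\<^sub>R G) * (1 + h *\<^sub>R G - exp (h *\<^sub>R G))) (X (grid s t n j) \<omega>) +
    (\<Sum>l=1..m. (W l (grid s t n (Suc j)) \<omega> - W l (grid s t n j) \<omega>) *\<^sub>R
      app ((exp (- grid s t n (Suc j) *\<^sub>R G) - exp (- grid s t n j *\<^sub>R G)) * A l) (X (grid s t n j) \<omega>)))"

lemma coeff_pullback: "app (coeff l q) (pullback q \<omega>) = app (exp (- q *\<^sub>R G) * A l) (X q \<omega>)"
proof -
  have "exp (q *\<^sub>R G) * exp (- q *\<^sub>R G) = 1"
    using exp_minus_inverse[of "q *\<^sub>R G"] by simp
  then have "conj_exp G (A l) q * exp (- q *\<^sub>R G) = exp (- q *\<^sub>R G) * A l"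
    by (simp add: conj_exp_def mult.assoc)
  then show ?thesis
    unfolding coeff_def pullback_def app_times[symmetric] by simp
qed

lemma exp_split: "exp (- q *\<^sub>R G) = exp (- (q + h) *\<^sub>R G) * exp (h *\<^sub>R G)"
  using exp_add_commuting[of "- (q + h) *\<^sub>R G" "h *\<^sub>R G"] by (simp add: algebra_simps)

text \<open>Summation by parts: the defect of the pulled back process is expressed by the defect itself,
  not by its increments, which need not be summable.\<close>

lemma pullback_defect_eq:
  assumes "s < t"
  shows "pullback_defect s t n i \<omega> = local_error s t n i \<omega> +
    (app (exp (- grid s t n i *\<^sub>R G)) (defect s t n i \<omega>) -
     (\<Sum>j<i. app (exp (- grid s t n (Suc j) *\<^sub>R G) - exp (- grid s t n j *\<^sub>R G)) (defect s t n j \<omega>)))"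
proof (induction i)
  case 0
  then show ?case by (simp add: pullback_defect_def local_error_def defect_def app.zero_right)
next
  case (Suc i)
  define h where "h = (t - s) / real (Suc n)"
  define E where "E j = exp (- grid s t n j *\<^sub>R G)" for j
  define x where "x j = X (grid s t n j) \<omega>" for j
  define d where "d l = W l (grid s t n (Suc i)) \<omega> - W l (grid s t n i) \<omega>" for l
  have g: "grid s t n (Suc i) = grid s t n i + h"
    using grid_Suc[of s t n i] by (simp add: h_def)
  \<comment> \<open>All terms of the step are written with the propagator at the right end of the
    cell; here \<open>exp(hG)\<close> appears, to be compared with \<open>1 + hG\<close>.\<close>
  have E: "E i = E (Suc i) * exp (h *\<^sub>R G)"
    unfolding E_def g by (rule exp_split)
  have def_Suc: "defect s t n (Suc i) \<omega> = defect s t n i \<omega> + (x (Suc i) - x i) -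
      (h *\<^sub>R app G (x i) + (\<Sum>l=1..m. d l *\<^sub>R app (A l) (x i)))"
    by (simp add: defect_def x_def h_def d_def)
  have pb_Suc: "pullback_defect s t n (Suc i) \<omega> = pullback_defect s t n i \<omega> +
      (app (E (Suc i)) (x (Suc i)) - app (E i) (x i)) - (\<Sum>l=1..m. d l *\<^sub>R app (E i * A l) (x i))"
    by (simp add: pullback_defect_def coeff_pullback d_def) (simp add: pullback_def E_def x_def)
  have le_Suc: "local_error s t n (Suc i) \<omega> = local_error s t n i \<omega> +
      (app (E (Suc i) * (1 + h *\<^sub>R G - exp (h *\<^sub>R G))) (x i) +
       (\<Sum>l=1..m. d l *\<^sub>R app ((E (Suc i) - E i) * A l) (x i)))"
    by (simp add: local_error_def Let_def h_def E_def x_def d_def)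
  have "app (E (Suc i)) (\<Sum>l=1..m. d l *\<^sub>R app (A l) (x i)) = (\<Sum>l=1..m. d l *\<^sub>R app (E (Suc i) * A l) (x i))"
    by (simp add: app.sum_right app.scaleR_right)
  moreover have "(\<Sum>l=1..m. d l *\<^sub>R app ((E (Suc i) - E i) * A l) (x i)) =
      (\<Sum>l=1..m. d l *\<^sub>R app (E (Suc i) * A l) (x i)) - (\<Sum>l=1..m. d l *\<^sub>R app (E i * A l) (x i))"
    by (simp add: app.diff_left scaleR_diff_right sum_subtractf)
  moreover have "app (E (Suc i) * (1 + h *\<^sub>R G - exp (h *\<^sub>R G))) (x i) =
      app (E (Suc i)) (x i) + app (E (Suc i)) (h *\<^sub>R app G (x i)) - app (E i) (x i)"
    unfolding E by (simp add: app.diff_left app.add_left app.diff_right app.add_right app.scaleR_left)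
  ultimately show ?case
    unfolding pb_Suc le_Suc Suc.IH def_Suc sum.lessThan_Suc E_def[symmetric]
    by (simp add: app.diff_left app.add_right app.diff_right)
qed

lemma pullback_measurable:
  assumes "0 \<le> s" "s \<le> t"
  shows "pullback s \<in> borel_measurable (F t)"
  unfolding pullback_def using X_adapted[OF assms] by measurable

lemma pullback_defect_measurable:
  assumes st: "0 \<le> s" "s < t" and i: "i \<le> Suc n"
  shows "pullback_defect s t n i \<in> borel_measurable (F (grid s t n i))"
proof -
  have m1: "pullback (grid s t n j) \<in> borel_measurable (F (grid s t n i))" if "j \<le> i" for j
    using that grid_mono[of s t j i n] grid_bounds[of s t j n] st i by (intro pullback_measurable) auto
  have m2: "W l (grid s t n j) \<in> borel_measurable (F (grid s t n i))" if "j \<le> i" "l \<in> {1..m}" for l j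
    using that grid_mono[of s t j i n] grid_bounds[of s t j n] st i by (intro W_adapted) auto
  have m3: "pullback s \<in> borel_measurable (F (grid s t n i))"
    using m1[of 0] by simp
  show ?thesis
    unfolding pullback_defect_def
    by (intro borel_measurable_diff borel_measurable_sum borel_measurable_add borel_measurable_scaleR
        borel_measurable_const measurable_app m1 m2 m3) auto
qed

lemma local_error_measurable:
  assumes st: "0 \<le> s" "s < t" and i: "i \<le> Suc n"
  shows "local_error s t n i \<in> borel_measurable M"
  unfolding local_error_def Let_def using assms
  by (intro borel_measurable_sum borel_measurable_add borel_measurable_scaleR borel_measurable_diff
      measurable_app grid_measurable) auto

section \<open>Vanishing of the pulled back defect\<close>

lemma grid_propagator_bounds:
  assumes st: "0 \<le> s" "s < t"
  shows "\<exists>C\<ge>0. \<exists>K\<ge>0. \<forall>n. (\<forall>i\<le>Suc n. norm (exp (- grid s t n i *\<^sub>R G)) \<le> C) \<and>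
    (\<forall>i\<le>n. norm (exp (- grid s t n (Suc i) *\<^sub>R G) - exp (- grid s t n i *\<^sub>R G)) \<le>
      K * ((t - s) / real (Suc n)))"
proof -
  obtain K where K: "\<And>a b. a \<in> {0..t} \<Longrightarrow> b \<in> {0..t} \<Longrightarrow> norm (exp (- a *\<^sub>R G) - exp (- b *\<^sub>R G)) \<le> K * \<bar>a - b\<bar>"
    using exp_Lipschitz_on[of t G] by blast
  have "continuous_on {0..t} (\<lambda>q. exp (q *\<^sub>R - G))"
    using exp_scaleR_has_vector_derivative_right has_vector_derivative_continuous
    by (metis continuous_on_eq_continuous_within)
  then obtain C where "C \<ge> 0" and C: "\<And>q. q \<in> {0..t} \<Longrightarrow> norm (exp (- q *\<^sub>R G)) \<le> C"
    using bounded_on_compact_interval[of 0 t "\<lambda>q. exp (q *\<^sub>R - G)"] by auto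
  have g: "grid s t n i \<in> {0..t}" if "i \<le> Suc n" for n i
    using grid_bounds[of s t i n] that st by auto
  show ?thesis
  proof (rule exI[of _ C], rule conjI, rule \<open>C \<ge> 0\<close>, rule exI[of _ "max K 0"], intro conjI allI impI)
    show "norm (exp (- grid s t n i *\<^sub>R G)) \<le> C" if "i \<le> Suc n" for n i
      using C[OF g[OF that]] .
    show "norm (exp (- grid s t n (Suc i) *\<^sub>R G) - exp (- grid s t n i *\<^sub>R G)) \<le>
      max K 0 * ((t - s) / real (Suc n))" if "i \<le> n" for n i
    proof -
      have "norm (exp (- grid s t n (Suc i) *\<^sub>R G) - exp (- grid s t n i *\<^sub>R G)) \<le>
          K * \<bar>grid s t n (Suc i) - grid s t n i\<bar>"
        using that by (intro K g) auto
      also have "\<dots> \<le> max K 0 * ((t - s) / real (Suc n))"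
        unfolding grid_Suc using st by (intro mult_mono) auto
      finally show ?thesis .
    qed
  qed (use \<open>C \<ge> 0\<close> in auto)
qed

text \<open>A pathwise argument without cancellation. On a path the solution is bounded, the drift
  remainder is \<open>o(h)\<close> in each cell, and in the noise term a small oscillation of
  \<open>W\<close> multiplies a change of the propagator of order \<open>h\<close>. Summing over the
  cells leaves a small multiple of \<open>t - s\<close>.\<close>

lemma local_error_vanishes:
  assumes st: "0 \<le> s" "s < t" and "\<kappa> > 0"
  shows "(\<lambda>n. prob {\<omega> \<in> space M. \<exists>i\<in>{..Suc n}. norm (local_error s t n i \<omega>) > \<kappa>}) \<longlonglongrightarrow> 0"
proof (rule AE_imp_prob_tendsto_0)
  show "{\<omega> \<in> space M. \<exists>i\<in>{..Suc n}. norm (local_error s t n i \<omega>) > \<kappa>} \<in> events" for n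
    using local_error_measurable[OF st] by (intro events_finite_ex) auto
  obtain C K where C: "C \<ge> 0" "K \<ge> 0" "\<And>n i. i \<le> Suc n \<Longrightarrow> norm (exp (- grid s t n i *\<^sub>R G)) \<le> C"
    "\<And>n i. i \<le> n \<Longrightarrow> norm (exp (- grid s t n (Suc i) *\<^sub>R G) - exp (- grid s t n i *\<^sub>R G)) \<le>
      K * ((t - s) / real (Suc n))"
    using grid_propagator_bounds[OF st] by metis
  have "AE \<omega> in M. \<forall>l\<in>{1..m}. continuous_on {0..} (\<lambda>q. W l q \<omega>)"
    by (intro AE_finite_allI W_continuous) auto
  then show "AE \<omega> in M. \<forall>\<^sub>F n in sequentially. \<omega> \<notin> {\<omega> \<in> space M. \<exists>i\<in>{..Suc n}. norm (local_error s t n i \<omega>) > \<kappa>}"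
    using X_continuous
  proof eventually_elim
    case (elim \<omega>)
    note W_cont = bspec[OF elim(1)]
    have "continuous_on {s..t} (\<lambda>q. X q \<omega>)"
      by (rule continuous_on_subset[OF elim(2)]) (use st in auto)
    then obtain N where N: "N \<ge> 0" "\<And>q. q \<in> {s..t} \<Longrightarrow> norm (X q \<omega>) \<le> N"
      using bounded_on_compact_interval by blast
    define a where "a = (\<Sum>l=1..m. norm (A l))"
    have "a \<ge> 0" unfolding a_def by (intro sum_nonneg) auto
    \<comment> \<open>The summand 1 keeps \<open>c\<close> positive even if all the bounds vanish;
      \<open>e\<close> is then chosen so that the cells together contribute at most
      \<kappa>.\<close>
    define c where "c = (C * N + K * a * N + 1) * (t - s)"
    have "c > 0" unfolding c_def using C N \<open>a \<ge> 0\<close> st by (intro mult_pos_pos) (auto intro: add_nonneg_pos)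
    define e where "e = \<kappa> / c"
    have e: "e > 0" "e * c = \<kappa>" using \<open>\<kappa> > 0\<close> \<open>c > 0\<close> by (auto simp: e_def)
    obtain d where d: "d > 0" "\<And>h. 0 < h \<Longrightarrow> h < d \<Longrightarrow> norm (1 + h *\<^sub>R G - exp (h *\<^sub>R G)) \<le> e * h"
      using exp_remainder_little_o[OF e(1), of G] by blast
    have "(\<lambda>n. (t - s) / real (Suc n)) \<longlonglongrightarrow> 0"
      using LIMSEQ_Suc[OF lim_const_over_n[of "t - s"]] by simp
    then have ev1: "\<forall>\<^sub>F n in sequentially. (t - s) / real (Suc n) < d"
      using d(1) by (rule order_tendstoD(2))
    have ev2: "\<forall>\<^sub>F n in sequentially. \<forall>l\<in>{1..m}. \<forall>j\<le>n. \<forall>q\<in>{grid s t n j..grid s t n (Suc j)}.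
        norm (W l q \<omega> - W l (grid s t n j) \<omega>) < e"
    proof (rule eventually_ball_finite[OF _ ballI])
      fix l assume "l \<in> {1..m}"
      then show "\<forall>\<^sub>F n in sequentially. \<forall>j\<le>n. \<forall>q\<in>{grid s t n j..grid s t n (Suc j)}.
          norm (W l q \<omega> - W l (grid s t n j) \<omega>) < e"
        by (intro grid_oscillation st(2) e(1) continuous_on_subset[OF W_cont]) (use st in auto)
    qed simp
    from ev1 ev2 show ?case
    proof eventually_elim
      case (elim n)
      define h where "h = (t - s) / real (Suc n)"
      have h: "h > 0" "h < d" "real (Suc n) * h = t - s"
        using elim(1) st by (auto simp: h_def simp del: of_nat_Suc)
      have term_bound: "norm (app (exp (- grid s t n (Suc j) *\<^sub>R G) * (1 + h *\<^sub>R G - exp (h *\<^sub>R G))) (X (grid s t n j) \<omega>) +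
        (\<Sum>l=1..m. (W l (grid s t n (Suc j)) \<omega> - W l (grid s t n j) \<omega>) *\<^sub>R
          app ((exp (- grid s t n (Suc j) *\<^sub>R G) - exp (- grid s t n j *\<^sub>R G)) * A l) (X (grid s t n j) \<omega>)))
        \<le> e * ((C * N + K * a * N) * h)" if j: "j \<le> n" for j
      proof -
        let ?x = "X (grid s t n j) \<omega>"
        have x: "norm ?x \<le> N"
          using grid_bounds[of s t j n] j st by (intro N(2)) auto
        have "norm (app (exp (- grid s t n (Suc j) *\<^sub>R G) * (1 + h *\<^sub>R G - exp (h *\<^sub>R G))) ?x) \<le>
            (norm (exp (- grid s t n (Suc j) *\<^sub>R G)) * norm (1 + h *\<^sub>R G - exp (h *\<^sub>R G))) * norm ?x"
          by (intro order_trans[OF norm_app] mult_right_mono norm_mult_ineq) auto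
        also have "\<dots> \<le> (C * (e * h)) * N"
          using C(1) C(3)[of "Suc j" n] d(2)[OF h(1,2)] x j e h by (intro mult_mono) auto
        finally have 1: "norm (app (exp (- grid s t n (Suc j) *\<^sub>R G) * (1 + h *\<^sub>R G - exp (h *\<^sub>R G))) ?x) \<le> (C * (e * h)) * N" .
        have "norm (\<Sum>l=1..m. (W l (grid s t n (Suc j)) \<omega> - W l (grid s t n j) \<omega>) *\<^sub>R
            app ((exp (- grid s t n (Suc j) *\<^sub>R G) - exp (- grid s t n j *\<^sub>R G)) * A l) ?x) \<le>
            (\<Sum>l=1..m. e * ((K * h * norm (A l)) * N))"
        proof (rule sum_norm_le)
          fix l assume l: "l \<in> {1..m}"
          have "norm (app ((exp (- grid s t n (Suc j) *\<^sub>R G) - exp (- grid s t n j *\<^sub>R G)) * A l) ?x) \<le>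
            (norm (exp (- grid s t n (Suc j) *\<^sub>R G) - exp (- grid s t n j *\<^sub>R G)) * norm (A l)) * norm ?x"
            by (intro order_trans[OF norm_app] mult_right_mono norm_mult_ineq) auto
          also have "\<dots> \<le> (K * h * norm (A l)) * N"
            using C(2) C(4)[OF j] x h(1) unfolding h_def[symmetric]
            by (intro mult_mono mult_nonneg_nonneg) auto
          finally have "norm (app ((exp (- grid s t n (Suc j) *\<^sub>R G) - exp (- grid s t n j *\<^sub>R G)) * A l) ?x) \<le> (K * h * norm (A l)) * N" .
          moreover have "\<bar>W l (grid s t n (Suc j)) \<omega> - W l (grid s t n j) \<omega>\<bar> \<le> e"
          proof -
            have "grid s t n (Suc j) \<in> {grid s t n j..grid s t n (Suc j)}"
              using grid_less[OF st(2), of n j] by auto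
            then show ?thesis using elim(2) l j by (force intro: less_imp_le)
          qed
          ultimately show "norm ((W l (grid s t n (Suc j)) \<omega> - W l (grid s t n j) \<omega>) *\<^sub>R
            app ((exp (- grid s t n (Suc j) *\<^sub>R G) - exp (- grid s t n j *\<^sub>R G)) * A l) ?x) \<le> e * ((K * h * norm (A l)) * N)"
            unfolding norm_scaleR by (intro mult_mono) (use e in auto)
        qed
        also have "\<dots> = e * (K * h * a * N)"
          by (simp add: a_def sum_distrib_left sum_distrib_right mult_ac)
        finally show ?thesis
          using 1 by (intro order_trans[OF norm_triangle_ineq]) (simp add: algebra_simps)
      qed
      have "norm (local_error s t n i \<omega>) \<le> \<kappa>" if "i \<le> Suc n" for i
      proof -
        have "norm (local_error s t n i \<omega>) \<le> (\<Sum>j<i. e * ((C * N + K * a * N) * h))"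
          unfolding local_error_def Let_def h_def[symmetric]
          using that by (intro sum_norm_le term_bound) auto
        also have "\<dots> = real i * (e * ((C * N + K * a * N) * h))" by simp
        also have "\<dots> \<le> real (Suc n) * (e * ((C * N + K * a * N + 1) * h))"
          using that e h C N \<open>a \<ge> 0\<close> by (intro mult_mono mult_nonneg_nonneg add_nonneg_nonneg) auto
        also have "\<dots> = e * ((C * N + K * a * N + 1) * (real (Suc n) * h))"
          by (simp only: mult_ac)
        also have "\<dots> = \<kappa>" using e(2) by (simp only: h(3) c_def)
        finally show ?thesis .
      qed
      then show ?case by (auto simp: not_less[symmetric])
    qed
  qed
qed

text \<open>In the formula from summation by parts the defects are weighted by a propagator of norm
  at most \<open>C\<close> and by increments of propagators whose norms add up to at most
  \<open>K (t - s)\<close>. The total weight is below \<open>c\<close> for every grid, so uniform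
  smallness of the defect is enough.\<close>

lemma pullback_defect_vanishes:
  assumes st: "0 \<le> s" "s < t" and "\<kappa> > 0"
  shows "(\<lambda>n. prob {\<omega> \<in> space M. \<exists>i\<in>{..Suc n}. norm (pullback_defect s t n i \<omega>) > \<kappa>}) \<longlonglongrightarrow> 0"
proof -
  obtain C K where C: "C \<ge> 0" "K \<ge> 0" "\<And>n i. i \<le> Suc n \<Longrightarrow> norm (exp (- grid s t n i *\<^sub>R G)) \<le> C"
    "\<And>n i. i \<le> n \<Longrightarrow> norm (exp (- grid s t n (Suc i) *\<^sub>R G) - exp (- grid s t n i *\<^sub>R G)) \<le>
      K * ((t - s) / real (Suc n))"
    using grid_propagator_bounds[OF st] by metis
  define c where "c = C + K * (t - s) + 1"
  have c: "c > 0" using C st by (auto simp: c_def intro: add_nonneg_pos)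
  let ?P = "\<lambda>n. {\<omega> \<in> space M. \<exists>i\<in>{..Suc n}. norm (pullback_defect s t n i \<omega>) > \<kappa>}"
  let ?L = "\<lambda>n. {\<omega> \<in> space M. \<exists>i\<in>{..Suc n}. norm (local_error s t n i \<omega>) > \<kappa> / 2}"
  let ?D = "\<lambda>n. {\<omega> \<in> space M. \<exists>i\<in>{..Suc n}. norm (defect s t n i \<omega>) > \<kappa> / (2 * c)}"
  have meas_L: "?L n \<in> events" for n
    using local_error_measurable[OF st] by (intro events_finite_ex) auto
  have meas_D: "?D n \<in> events" for n
  proof (rule events_finite_ex)
    show "defect s t n i \<in> borel_measurable M" if "i \<in> {..Suc n}" for i
      using measurable_F_M[OF defect_measurable[OF st, of i n]] grid_bounds[of s t i n] st that by auto
  qed simp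
  have sub: "?P n \<subseteq> ?L n \<union> ?D n" for n
  proof
    fix \<omega> assume "\<omega> \<in> ?P n"
    then obtain i where \<omega>: "\<omega> \<in> space M" and i: "i \<le> Suc n" and gt: "norm (pullback_defect s t n i \<omega>) > \<kappa>"
      by auto
    show "\<omega> \<in> ?L n \<union> ?D n"
    proof (rule ccontr)
      assume "\<not> ?thesis"
      then have L: "norm (local_error s t n i \<omega>) \<le> \<kappa> / 2"
        and D: "\<And>j. j \<le> Suc n \<Longrightarrow> norm (defect s t n j \<omega>) \<le> \<kappa> / (2 * c)"
        using \<omega> i by (auto simp: not_less)
      let ?h = "(t - s) / real (Suc n)"
      have 1: "norm (app (exp (- grid s t n i *\<^sub>R G)) (defect s t n i \<omega>)) \<le> C * (\<kappa> / (2 * c))"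
        using C(1) C(3)[OF i] D[OF i] by (intro order_trans[OF norm_app] mult_mono) auto
      have "norm (\<Sum>j<i. app (exp (- grid s t n (Suc j) *\<^sub>R G) - exp (- grid s t n j *\<^sub>R G)) (defect s t n j \<omega>))
          \<le> (\<Sum>j<i. (K * ?h) * (\<kappa> / (2 * c)))"
      proof (rule sum_norm_le)
        fix j assume "j \<in> {..<i}"
        then have "j \<le> n" using i by auto
        then show "norm (app (exp (- grid s t n (Suc j) *\<^sub>R G) - exp (- grid s t n j *\<^sub>R G)) (defect s t n j \<omega>)) \<le> (K * ?h) * (\<kappa> / (2 * c))"
          using C(2) C(4)[of j n] D[of j] st by (intro order_trans[OF norm_app] mult_mono mult_nonneg_nonneg) auto
      qed
      also have "\<dots> = real i * ((K * ?h) * (\<kappa> / (2 * c)))" by simp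
      also have "\<dots> \<le> real (Suc n) * ((K * ?h) * (\<kappa> / (2 * c)))"
        using i C(2) st c \<open>\<kappa> > 0\<close> by (intro mult_right_mono of_nat_mono mult_nonneg_nonneg) auto
      also have "\<dots> = (K * (real (Suc n) * ?h)) * (\<kappa> / (2 * c))"
        by (simp only: mult_ac)
      also have "real (Suc n) * ?h = t - s" by (simp del: of_nat_Suc)
      finally have 2: "norm (\<Sum>j<i. app (exp (- grid s t n (Suc j) *\<^sub>R G) - exp (- grid s t n j *\<^sub>R G)) (defect s t n j \<omega>))
          \<le> (K * (t - s)) * (\<kappa> / (2 * c))" .
      have "norm (pullback_defect s t n i \<omega>) \<le> \<kappa> / 2 + (C * (\<kappa> / (2 * c)) + (K * (t - s)) * (\<kappa> / (2 * c)))"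
        unfolding pullback_defect_eq[OF st(2)]
        by (intro norm_triangle_mono L order_trans[OF norm_triangle_ineq4] add_mono 1 2)
      also have "\<dots> \<le> \<kappa> / 2 + c * (\<kappa> / (2 * c))"
        using c \<open>\<kappa> > 0\<close> by (simp add: c_def distrib_right[symmetric] del: times_divide_eq_right)
      also have "\<dots> = \<kappa>" using c by simp
      finally show False using gt by simp
    qed
  qed
  have lim: "(\<lambda>n. prob (?L n) + prob (?D n)) \<longlonglongrightarrow> 0"
    using tendsto_add[OF local_error_vanishes[OF st, of "\<kappa> / 2"] defect_vanishes[OF st, of "\<kappa> / (2 * c)"]]
      \<open>\<kappa> > 0\<close> c by simp
  show ?thesis
  proof (rule tendsto_sandwich[OF _ _ tendsto_const lim])
    have "prob (?P n) \<le> prob (?L n) + prob (?D n)" for n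
    proof -
      have "prob (?P n) \<le> prob (?L n \<union> ?D n)"
        by (intro finite_measure_mono sub sets.Un meas_L meas_D)
      also have "\<dots> \<le> prob (?L n) + prob (?D n)"
        by (intro measure_subadditive meas_L meas_D) simp_all
      finally show ?thesis .
    qed
    then show "\<forall>\<^sub>F n in sequentially. prob (?P n) \<le> prob (?L n) + prob (?D n)"
      by simp
  qed simp
qed

end

section \<open>The Euler scheme\<close>

context prob_space
begin

lemma integrable_scaleR_of_squares:
  fixes T :: "'a \<Rightarrow> real" and Z :: "'a \<Rightarrow> 'b::euclidean_space"
  assumes [measurable]: "T \<in> borel_measurable M" "Z \<in> borel_measurable M"
    and "integrable M (\<lambda>\<omega>. (T \<omega>)\<^sup>2)" "integrable M (\<lambda>\<omega>. (norm (Z \<omega>))\<^sup>2)"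
  shows "integrable M (\<lambda>\<omega>. T \<omega> *\<^sub>R Z \<omega>)"
proof (rule Bochner_Integration.integrable_bound)
  show "integrable M (\<lambda>\<omega>. (T \<omega>)\<^sup>2 + (norm (Z \<omega>))\<^sup>2)"
    using assms by simp
  have "\<bar>a\<bar> * norm z \<le> a\<^sup>2 + (norm z)\<^sup>2" for a :: real and z :: 'b
  proof -
    have "0 \<le> (\<bar>a\<bar> - norm z)\<^sup>2" by simp
    then have "2 * (\<bar>a\<bar> * norm z) \<le> a\<^sup>2 + (norm z)\<^sup>2"
      by (simp add: power2_diff)
    moreover have "0 \<le> \<bar>a\<bar> * norm z" by simp
    ultimately show ?thesis by linarith
  qed
  then show "AE \<omega> in M. norm (T \<omega> *\<^sub>R Z \<omega>) \<le> norm ((T \<omega>)\<^sup>2 + (norm (Z \<omega>))\<^sup>2)"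
    by (auto intro!: AE_I2)
qed simp

text \<open>Absolute continuity of the integral. Above a high level \<open>k\<close> the function
  \<open>g\<close> has small integral by dominated convergence; below it the integral over
  \<open>E n\<close> is at most \<open>k\<close> times the probability.\<close>

lemma expectation_on_vanishing_events:
  fixes g :: "'a \<Rightarrow> real"
  assumes g: "integrable M g" "\<And>\<omega>. g \<omega> \<ge> 0" and E [measurable]: "\<And>n. E n \<in> events"
    and lim: "(\<lambda>n. prob (E n)) \<longlonglongrightarrow> 0"
  shows "(\<lambda>n. expectation (\<lambda>\<omega>. g \<omega> * indicat_real (E n) \<omega>)) \<longlonglongrightarrow> 0"
proof (rule vanishing_by_bound)
  have g_meas [measurable]: "g \<in> borel_measurable M" using g by auto
  fix e :: real assume "e > 0"
  have "(\<lambda>k. expectation (\<lambda>\<omega>. g \<omega> * indicat_real {x. x > real k} (g \<omega>))) \<longlonglongrightarrow> expectation (\<lambda>_. 0)"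
  proof (rule integral_dominated_convergence[where w = g])
    have "(\<lambda>k. g \<omega> * indicat_real {x. x > real k} (g \<omega>)) \<longlonglongrightarrow> 0" for \<omega>
    proof (rule tendsto_eventually)
      obtain K where "g \<omega> \<le> real K" using real_arch_simple by blast
      then show "\<forall>\<^sub>F k in sequentially. g \<omega> * indicat_real {x. x > real k} (g \<omega>) = 0"
        by (intro eventually_sequentiallyI[of K]) (auto simp: indicator_def)
    qed
    then show "AE \<omega> in M. (\<lambda>k. g \<omega> * indicat_real {x. x > real k} (g \<omega>)) \<longlonglongrightarrow> 0" by simp
    show "AE \<omega> in M. norm (g \<omega> * indicat_real {x. x > real k} (g \<omega>)) \<le> g \<omega>" for k
      using g(2) by (auto simp: indicator_def)
  qed (use g in auto)
  then have "(\<lambda>k. expectation (\<lambda>\<omega>. g \<omega> * indicat_real {x. x > real k} (g \<omega>))) \<longlonglongrightarrow> 0"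
    by simp
  from order_tendstoD(2)[OF this \<open>e > 0\<close>]
  obtain k where k: "expectation (\<lambda>\<omega>. g \<omega> * indicat_real {x. x > real k} (g \<omega>)) < e"
    by (auto simp: eventually_sequentially)
  have "expectation (\<lambda>\<omega>. g \<omega> * indicat_real (E n) \<omega>) \<le> e + real k * prob (E n)" for n
  proof -
    have int: "integrable M (\<lambda>\<omega>. g \<omega> * indicat_real {x. x > real k} (g \<omega>))"
      using g(1) by (rule Bochner_Integration.integrable_bound) (auto simp: indicator_def)
    have "expectation (\<lambda>\<omega>. g \<omega> * indicat_real (E n) \<omega>) \<le>
        expectation (\<lambda>\<omega>. g \<omega> * indicat_real {x. x > real k} (g \<omega>) + real k * indicat_real (E n) \<omega>)"
    proof (rule integral_mono)
      show "integrable M (\<lambda>\<omega>. g \<omega> * indicat_real (E n) \<omega>)"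
        using g(1) by (rule Bochner_Integration.integrable_bound) (auto simp: indicator_def)
      show "integrable M (\<lambda>\<omega>. g \<omega> * indicat_real {x. x > real k} (g \<omega>) + real k * indicat_real (E n) \<omega>)"
        using int by (intro Bochner_Integration.integrable_add integrable_mult_right) (auto simp: emeasure_eq_measure)
      show "g \<omega> * indicat_real (E n) \<omega> \<le> g \<omega> * indicat_real {x. x > real k} (g \<omega>) + real k * indicat_real (E n) \<omega>" for \<omega>
        using g(2)[of \<omega>] by (auto simp: indicator_def)
    qed
    also have "\<dots> = expectation (\<lambda>\<omega>. g \<omega> * indicat_real {x. x > real k} (g \<omega>)) + real k * prob (E n)"
      using int by (subst Bochner_Integration.integral_add) (auto simp: emeasure_eq_measure)
    finally show ?thesis using k by linarith
  qed
  moreover have "(\<lambda>n. real k * prob (E n)) \<longlonglongrightarrow> 0"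
    using tendsto_mult_left[OF lim, of "real k"] by simp
  ultimately show "\<exists>q. q \<longlonglongrightarrow> 0 \<and> (\<forall>n. expectation (\<lambda>\<omega>. g \<omega> * indicat_real (E n) \<omega>) \<le> e + q n)"
    by blast
next
  show "0 \<le> expectation (\<lambda>\<omega>. g \<omega> * indicat_real (E n) \<omega>)" for n
    using g(2) by (intro Bochner_Integration.integral_nonneg) auto
qed

text \<open>A fixed square integrable factor makes up for the lack of convergence in mean square.
  Pointwise, \<open>|T| |Z|\<close> is at most \<open>\<epsilon> |T| + c |Z|^2\<close>, plus
  \<open>T^2 / c\<close> on the event where \<open>|Z|\<close> exceeds \<epsilon>. The first two
  terms are small uniformly in \<open>n\<close>; the last has vanishing expectation.\<close>

lemma expectation_scaleR_vanishes:
  fixes T :: "'a \<Rightarrow> real" and Z :: "nat \<Rightarrow> 'a \<Rightarrow> 'b::euclidean_space"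
  assumes T [measurable]: "T \<in> borel_measurable M" and T2: "integrable M (\<lambda>\<omega>. (T \<omega>)\<^sup>2)"
    and Z [measurable]: "\<And>n. Z n \<in> borel_measurable M"
    and Z2: "\<And>n. integrable M (\<lambda>\<omega>. (norm (Z n \<omega>))\<^sup>2)" "\<And>n. expectation (\<lambda>\<omega>. (norm (Z n \<omega>))\<^sup>2) \<le> C"
    and lim: "\<And>\<epsilon>. \<epsilon> > 0 \<Longrightarrow> (\<lambda>n. prob {\<omega> \<in> space M. norm (Z n \<omega>) > \<epsilon>}) \<longlonglongrightarrow> 0"
  shows "(\<lambda>n. expectation (\<lambda>\<omega>. T \<omega> *\<^sub>R Z n \<omega>)) \<longlonglongrightarrow> 0"
proof -
  have "0 \<le> expectation (\<lambda>\<omega>. (norm (Z 0 \<omega>))\<^sup>2)"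
    by (intro Bochner_Integration.integral_nonneg) auto
  then have "C \<ge> 0" using Z2(2)[of 0] by linarith
  have T1: "integrable M (\<lambda>\<omega>. \<bar>T \<omega>\<bar>)"
    using integrable_of_square[of T] T2 by simp
  have "(\<lambda>n. norm (expectation (\<lambda>\<omega>. T \<omega> *\<^sub>R Z n \<omega>))) \<longlonglongrightarrow> 0"
  proof (rule vanishing_by_bound)
    fix e :: real assume "e > 0"
    define x where "x = expectation (\<lambda>\<omega>. \<bar>T \<omega>\<bar>)"
    have "0 \<le> x" unfolding x_def by (intro Bochner_Integration.integral_nonneg) auto
    \<comment> \<open>Adding 1 to the mean of \<open>|T|\<close> and to \<open>C\<close> keeps the
      denominators below positive; each of the two uniform terms gets the share
      \<open>e / 2\<close>.\<close>
    define x' where "x' = x + 1"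
    define C' where "C' = C + 1"
    define \<epsilon> where "\<epsilon> = e / (2 * x')"
    define c where "c = e / (2 * C')"
    have pos': "x' > 0" "C' > 0" using \<open>0 \<le> x\<close> \<open>0 \<le> C\<close> by (auto simp: x'_def C'_def)
    then have pos: "\<epsilon> > 0" "c > 0"
      using \<open>e > 0\<close> by (auto simp: \<epsilon>_def c_def)
    have "\<epsilon> * x \<le> \<epsilon> * x'" "c * C \<le> c * C'" using pos by (auto simp: x'_def C'_def)
    moreover have "\<epsilon> * x' = e / 2" "c * C' = e / 2" using pos' by (auto simp: \<epsilon>_def c_def)
    ultimately have small: "\<epsilon> * expectation (\<lambda>\<omega>. \<bar>T \<omega>\<bar>) + c * C \<le> e"
      unfolding x_def[symmetric] by linarith
    let ?E = "\<lambda>n. {\<omega> \<in> space M. norm (Z n \<omega>) > \<epsilon>}"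
    have bound: "norm (expectation (\<lambda>\<omega>. T \<omega> *\<^sub>R Z n \<omega>)) \<le>
        e + inverse c * expectation (\<lambda>\<omega>. (T \<omega>)\<^sup>2 * indicat_real (?E n) \<omega>)" for n
    proof -
      have int: "integrable M (\<lambda>\<omega>. (T \<omega>)\<^sup>2 * indicat_real (?E n) \<omega>)"
        using T2 by (rule Bochner_Integration.integrable_bound) (auto simp: indicator_def)
      have point: "\<bar>a\<bar> * norm z \<le> \<epsilon> * \<bar>a\<bar> + c * (norm z)\<^sup>2 + inverse c * (a\<^sup>2 * (if \<epsilon> < norm z then 1 else 0))"
        for a :: real and z :: 'b
      proof (cases "\<epsilon> < norm z")
        case True
        have "0 \<le> inverse c * (\<bar>a\<bar> - c * norm z)\<^sup>2" using pos by simp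
        also have "\<dots> = inverse c * a\<^sup>2 - 2 * (inverse c * c) * (\<bar>a\<bar> * norm z) + (inverse c * c) * (c * (norm z)\<^sup>2)"
          by (simp add: power2_eq_square algebra_simps)
        finally have "2 * (\<bar>a\<bar> * norm z) \<le> inverse c * a\<^sup>2 + c * (norm z)\<^sup>2" using pos by simp
        moreover have "0 \<le> \<bar>a\<bar> * norm z" "0 \<le> \<epsilon> * \<bar>a\<bar>" using pos by auto
        ultimately have "\<bar>a\<bar> * norm z \<le> \<epsilon> * \<bar>a\<bar> + c * (norm z)\<^sup>2 + inverse c * a\<^sup>2" by linarith
        then show ?thesis using True by simp
      next
        case False
        then have "\<bar>a\<bar> * norm z \<le> \<epsilon> * \<bar>a\<bar>"
          using mult_left_mono[of "norm z" \<epsilon> "\<bar>a\<bar>"] by (simp add: mult.commute)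
        moreover have "0 \<le> c * (norm z)\<^sup>2" using pos by simp
        ultimately show ?thesis using False by simp
      qed
      have "norm (expectation (\<lambda>\<omega>. T \<omega> *\<^sub>R Z n \<omega>)) \<le>
          expectation (\<lambda>\<omega>. \<epsilon> * \<bar>T \<omega>\<bar> + c * (norm (Z n \<omega>))\<^sup>2 + inverse c * ((T \<omega>)\<^sup>2 * indicat_real (?E n) \<omega>))"
      proof (rule order_trans[OF integral_norm_bound integral_mono])
        show "integrable M (\<lambda>\<omega>. norm (T \<omega> *\<^sub>R Z n \<omega>))"
          using T2 Z2 by (intro integrable_norm integrable_scaleR_of_squares) auto
        show "integrable M (\<lambda>\<omega>. \<epsilon> * \<bar>T \<omega>\<bar> + c * (norm (Z n \<omega>))\<^sup>2 + inverse c * ((T \<omega>)\<^sup>2 * indicat_real (?E n) \<omega>))"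
          using T1 Z2 int by (intro Bochner_Integration.integrable_add integrable_mult_right)
        show "norm (T \<omega> *\<^sub>R Z n \<omega>) \<le> \<epsilon> * \<bar>T \<omega>\<bar> + c * (norm (Z n \<omega>))\<^sup>2 + inverse c * ((T \<omega>)\<^sup>2 * indicat_real (?E n) \<omega>)"
          if "\<omega> \<in> space M" for \<omega>
          using point[of "T \<omega>" "Z n \<omega>"] that
          by (cases "\<epsilon> < norm (Z n \<omega>)") (simp_all add: indicator_def)
      qed
      also have "\<dots> = \<epsilon> * expectation (\<lambda>\<omega>. \<bar>T \<omega>\<bar>) + c * expectation (\<lambda>\<omega>. (norm (Z n \<omega>))\<^sup>2) +
          inverse c * expectation (\<lambda>\<omega>. (T \<omega>)\<^sup>2 * indicat_real (?E n) \<omega>)"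
        using T1 Z2 int by simp
      also have "c * expectation (\<lambda>\<omega>. (norm (Z n \<omega>))\<^sup>2) \<le> c * C"
        using Z2(2) pos by simp
      finally show ?thesis using small by linarith
    qed
    have "(\<lambda>n. expectation (\<lambda>\<omega>. (T \<omega>)\<^sup>2 * indicat_real (?E n) \<omega>)) \<longlonglongrightarrow> 0"
      using T2 lim[OF pos(1)] by (intro expectation_on_vanishing_events) auto
    then have "(\<lambda>n. inverse c * expectation (\<lambda>\<omega>. (T \<omega>)\<^sup>2 * indicat_real (?E n) \<omega>)) \<longlonglongrightarrow> 0"
      using tendsto_mult_left by fastforce
    with bound show "\<exists>q. q \<longlonglongrightarrow> 0 \<and> (\<forall>n. norm (expectation (\<lambda>\<omega>. T \<omega> *\<^sub>R Z n \<omega>)) \<le> e + q n)"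
      by blast
  qed simp
  then show ?thesis by (rule tendsto_norm_zero_cancel)
qed

end

section \<open>Moments of vector valued increments and of perturbed Euler recursions\<close>

context wiener_system
begin

lemma vector_increment_mean:
  fixes \<phi> :: "'w \<Rightarrow> 'b::euclidean_space"
  assumes "l \<in> {1..m}" "0 \<le> s" "s < t" and \<phi>: "\<phi> \<in> borel_measurable (F s)" "integrable M \<phi>"
  shows "integrable M (\<lambda>\<omega>. (W l t \<omega> - W l s \<omega>) *\<^sub>R \<phi> \<omega>)"
    "expectation (\<lambda>\<omega>. (W l t \<omega> - W l s \<omega>) *\<^sub>R \<phi> \<omega>) = 0"
proof -
  have eq: "(W l t \<omega> - W l s \<omega>) *\<^sub>R \<phi> \<omega> = (\<Sum>b\<in>Basis. ((\<phi> \<omega> \<bullet> b) * (W l t \<omega> - W l s \<omega>)) *\<^sub>R b)" for \<omega>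
    by (subst euclidean_representation[of "\<phi> \<omega>", symmetric]) (simp only: scaleR_sum_right scaleR_scaleR mult.commute)
  have meas: "(\<lambda>\<omega>. \<phi> \<omega> \<bullet> b) \<in> borel_measurable (F s)" for b
    using \<phi>(1) by measurable
  have int: "integrable M (\<lambda>\<omega>. \<phi> \<omega> \<bullet> b)" for b
    using \<phi>(2) by simp
  note im = increment_mean[OF assms(1-3) meas int]
  show "integrable M (\<lambda>\<omega>. (W l t \<omega> - W l s \<omega>) *\<^sub>R \<phi> \<omega>)"
    unfolding eq using im(1) by (intro Bochner_Integration.integrable_sum integrable_scaleR_left)
  show "expectation (\<lambda>\<omega>. (W l t \<omega> - W l s \<omega>) *\<^sub>R \<phi> \<omega>) = 0"
    unfolding eq using im by (subst Bochner_Integration.integral_sum) auto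
qed

lemma vector_increment_covariance:
  fixes \<phi> :: "'w \<Rightarrow> 'b::euclidean_space"
  assumes "k \<in> {1..m}" "l \<in> {1..m}" "0 \<le> s" "s < t" and \<phi>: "\<phi> \<in> borel_measurable (F s)" "integrable M \<phi>"
  shows "integrable M (\<lambda>\<omega>. ((W k t \<omega> - W k s \<omega>) * (W l t \<omega> - W l s \<omega>)) *\<^sub>R \<phi> \<omega>)"
    "expectation (\<lambda>\<omega>. ((W k t \<omega> - W k s \<omega>) * (W l t \<omega> - W l s \<omega>)) *\<^sub>R \<phi> \<omega>) =
      (if k = l then (t - s) *\<^sub>R expectation \<phi> else 0)"
proof -
  let ?d = "\<lambda>\<omega>. (W k t \<omega> - W k s \<omega>) * (W l t \<omega> - W l s \<omega>)"
  have eq: "?d \<omega> *\<^sub>R \<phi> \<omega> = (\<Sum>b\<in>Basis. ((\<phi> \<omega> \<bullet> b) * ?d \<omega>) *\<^sub>R b)" for \<omega>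
    by (subst euclidean_representation[of "\<phi> \<omega>", symmetric])
      (simp only: scaleR_sum_right scaleR_scaleR mult.commute)
  have meas: "(\<lambda>\<omega>. \<phi> \<omega> \<bullet> b) \<in> borel_measurable (F s)" for b
    using \<phi>(1) by measurable
  have int: "integrable M (\<lambda>\<omega>. \<phi> \<omega> \<bullet> b)" for b
    using \<phi>(2) by simp
  note im = increment_covariance[OF assms(1-4) meas int]
  show "integrable M (\<lambda>\<omega>. ?d \<omega> *\<^sub>R \<phi> \<omega>)"
    unfolding eq using im(1) by (intro Bochner_Integration.integrable_sum integrable_scaleR_left)
  have "expectation (\<lambda>\<omega>. ?d \<omega> *\<^sub>R \<phi> \<omega>) = (\<Sum>b\<in>Basis. (if k = l then (t - s) * (expectation \<phi> \<bullet> b) else 0) *\<^sub>R b)"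
  proof -
    have "expectation (\<lambda>\<omega>. \<phi> \<omega> \<bullet> b) = expectation \<phi> \<bullet> b" for b
      using \<phi>(2) by simp
    then show ?thesis
      unfolding eq using im by (subst Bochner_Integration.integral_sum) (cases "k = l"; auto)+
  qed
  also have "\<dots> = (if k = l then (t - s) *\<^sub>R (\<Sum>b\<in>Basis. (expectation \<phi> \<bullet> b) *\<^sub>R b) else 0)"
    by (simp add: scaleR_sum_right)
  finally show "expectation (\<lambda>\<omega>. ?d \<omega> *\<^sub>R \<phi> \<omega>) = (if k = l then (t - s) *\<^sub>R expectation \<phi> else 0)"
    by (simp only: euclidean_representation)
qed

text \<open>A discrete Gronwall argument. Adding \<open>\<kappa>^2\<close> to the second moment
  makes the recursion homogeneous with factor \<open>1 + 2ch\<close>, and \<open>Suc n\<close> such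
  factors stay below \<open>exp(2c(t - s))\<close> for every mesh. It serves twice: with
  \<open>\<rho> = 0\<close> for the scheme itself, and with a zero start and a truncated defect as
  \<rho> for the error of the scheme.\<close>

lemma euler_second_moment:
  fixes B :: "nat \<Rightarrow> real \<Rightarrow> 'b::euclidean_space endo" and f \<rho> :: "nat \<Rightarrow> 'w \<Rightarrow> 'b"
  assumes st: "0 \<le> s" "s < t"
    and f0: "f 0 \<in> borel_measurable (F s)" "integrable M (\<lambda>\<omega>. (norm (f 0 \<omega>))\<^sup>2)"
    and f_Suc: "\<And>i \<omega>. i \<le> n \<Longrightarrow> f (Suc i) \<omega> = f i \<omega> +
      (\<Sum>l=1..m. (W l (grid s t n (Suc i)) \<omega> - W l (grid s t n i) \<omega>) *\<^sub>R app (B l (grid s t n i)) (f i \<omega> + \<rho> i \<omega>))"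
    and \<rho>: "\<And>i. i \<le> n \<Longrightarrow> \<rho> i \<in> borel_measurable (F (grid s t n i))" "\<And>i \<omega>. i \<le> n \<Longrightarrow> norm (\<rho> i \<omega>) \<le> \<kappa>"
    and B: "\<And>i. i \<le> n \<Longrightarrow> (\<Sum>l=1..m. (norm (B l (grid s t n i)))\<^sup>2) \<le> c" and "\<kappa> \<ge> 0"
    and i: "i \<le> Suc n"
  shows "f i \<in> borel_measurable (F (grid s t n i))" "integrable M (\<lambda>\<omega>. (norm (f i \<omega>))\<^sup>2)"
    "expectation (\<lambda>\<omega>. (norm (f i \<omega>))\<^sup>2) \<le> exp (2 * c * (t - s)) * (expectation (\<lambda>\<omega>. (norm (f 0 \<omega>))\<^sup>2) + \<kappa>\<^sup>2)"
proof -
  define h where "h = (t - s) / real (Suc n)"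
  have h: "h > 0" "real (Suc n) * h = t - s" using st by (simp_all add: h_def del: of_nat_Suc)
  have "0 \<le> (\<Sum>l=1..m. (norm (B l (grid s t n 0)))\<^sup>2)" by (intro sum_nonneg) auto
  then have "c \<ge> 0" using B[of 0] by linarith
  let ?a = "\<lambda>i. expectation (\<lambda>\<omega>. (norm (f i \<omega>))\<^sup>2)"
  have main: "f i \<in> borel_measurable (F (grid s t n i)) \<and> integrable M (\<lambda>\<omega>. (norm (f i \<omega>))\<^sup>2) \<and>
      ?a i + \<kappa>\<^sup>2 \<le> (1 + 2 * c * h) ^ i * (?a 0 + \<kappa>\<^sup>2)"
    using i
  proof (induction i)
    case 0
    then show ?case using f0 by simp
  next
    case (Suc i)
    then have "i \<le> n" and IH: "f i \<in> borel_measurable (F (grid s t n i))" "integrable M (\<lambda>\<omega>. (norm (f i \<omega>))\<^sup>2)"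
      "?a i + \<kappa>\<^sup>2 \<le> (1 + 2 * c * h) ^ i * (?a 0 + \<kappa>\<^sup>2)" by auto
    have g: "0 \<le> grid s t n i" using grid_bounds[of s t i n] st Suc.prems by auto
    note [measurable] = IH(1) \<rho>(1)[OF \<open>i \<le> n\<close>]
    have [measurable]: "f i \<in> borel_measurable M" "\<rho> i \<in> borel_measurable M"
      by (rule measurable_F_M[OF IH(1) g], rule measurable_F_M[OF \<rho>(1)[OF \<open>i \<le> n\<close>] g])
    let ?b = "\<lambda>l \<omega>. app (B l (grid s t n i)) (f i \<omega> + \<rho> i \<omega>)"
    have sq: "(norm (f i \<omega> + \<rho> i \<omega>))\<^sup>2 \<le> 2 * (norm (f i \<omega>))\<^sup>2 + 2 * \<kappa>\<^sup>2" for \<omega>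
      using norm_diff_square_le[of "f i \<omega>" "- \<rho> i \<omega>"] power_mono[OF \<rho>(2)[OF \<open>i \<le> n\<close>, of \<omega>] norm_ge_zero, of 2]
      by simp
    have bl: "(norm (?b l \<omega>))\<^sup>2 \<le> (norm (B l (grid s t n i)))\<^sup>2 * (2 * (norm (f i \<omega>))\<^sup>2 + 2 * \<kappa>\<^sup>2)" for l \<omega>
    proof -
      have "(norm (?b l \<omega>))\<^sup>2 \<le> (norm (B l (grid s t n i)) * norm (f i \<omega> + \<rho> i \<omega>))\<^sup>2"
        by (intro power_mono norm_app) auto
      also have "\<dots> \<le> (norm (B l (grid s t n i)))\<^sup>2 * (2 * (norm (f i \<omega>))\<^sup>2 + 2 * \<kappa>\<^sup>2)"
        unfolding power_mult_distrib by (intro mult_left_mono sq) auto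
      finally show ?thesis .
    qed
    have dom: "integrable M (\<lambda>\<omega>. (norm (B l (grid s t n i)))\<^sup>2 * (2 * (norm (f i \<omega>))\<^sup>2 + 2 * \<kappa>\<^sup>2))" for l
      using IH(2) by simp
    have b2: "integrable M (\<lambda>\<omega>. (norm (?b l \<omega>))\<^sup>2)" for l
      by (rule Bochner_Integration.integrable_bound[OF dom[of l]]) (use bl in auto)
    have b_meas: "?b l \<in> borel_measurable (F (grid s t n i))" for l
      by measurable
    have Eb: "expectation (\<lambda>\<omega>. (norm (?b l \<omega>))\<^sup>2) \<le> (norm (B l (grid s t n i)))\<^sup>2 * (2 * ?a i + 2 * \<kappa>\<^sup>2)" for l
    proof -
      have "expectation (\<lambda>\<omega>. (norm (?b l \<omega>))\<^sup>2) \<le> expectation (\<lambda>\<omega>. (norm (B l (grid s t n i)))\<^sup>2 * (2 * (norm (f i \<omega>))\<^sup>2 + 2 * \<kappa>\<^sup>2))"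
        by (rule integral_mono[OF b2 dom]) (rule bl)
      also have "\<dots> = (norm (B l (grid s t n i)))\<^sup>2 * (2 * ?a i + 2 * \<kappa>\<^sup>2)"
        using IH(2) by (simp add: prob_space)
      finally show ?thesis .
    qed
    have a_nonneg: "0 \<le> ?a i" by (intro Bochner_Integration.integral_nonneg) auto
    note step = square_increment_step[OF order_refl g grid_less[OF st(2)] IH(1,2) b_meas b2]
    have f_eq: "f (Suc i) = (\<lambda>\<omega>. f i \<omega> + (\<Sum>l=1..m. (W l (grid s t n (Suc i)) \<omega> - W l (grid s t n i) \<omega>) *\<^sub>R ?b l \<omega>))"
      using f_Suc[OF \<open>i \<le> n\<close>] by auto
    have "?a (Suc i) = ?a i + h * (\<Sum>l=1..m. expectation (\<lambda>\<omega>. (norm (?b l \<omega>))\<^sup>2))"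
      unfolding f_eq using step(3) by (simp only: grid_Suc h_def)
    also have "\<dots> \<le> ?a i + h * (\<Sum>l=1..m. (norm (B l (grid s t n i)))\<^sup>2 * (2 * ?a i + 2 * \<kappa>\<^sup>2))"
      using h by (intro add_left_mono mult_left_mono sum_mono Eb) auto
    also have "\<dots> = ?a i + h * ((\<Sum>l=1..m. (norm (B l (grid s t n i)))\<^sup>2) * (2 * ?a i + 2 * \<kappa>\<^sup>2))"
      by (simp only: sum_distrib_right)
    also have "\<dots> \<le> ?a i + h * (c * (2 * ?a i + 2 * \<kappa>\<^sup>2))"
      using h a_nonneg B[OF \<open>i \<le> n\<close>] by (intro add_left_mono mult_left_mono mult_right_mono) auto
    finally have "?a (Suc i) + \<kappa>\<^sup>2 \<le> (1 + 2 * c * h) * (?a i + \<kappa>\<^sup>2)"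
      by (simp add: algebra_simps)
    also have "\<dots> \<le> (1 + 2 * c * h) * ((1 + 2 * c * h) ^ i * (?a 0 + \<kappa>\<^sup>2))"
      using h \<open>c \<ge> 0\<close> IH(3) by (intro mult_left_mono) auto
    finally have "?a (Suc i) + \<kappa>\<^sup>2 \<le> (1 + 2 * c * h) ^ Suc i * (?a 0 + \<kappa>\<^sup>2)" by (simp only: power_Suc mult.assoc)
    then show ?case
      unfolding f_eq using step(1,2) by (auto simp: f_eq)
  qed
  then show "f i \<in> borel_measurable (F (grid s t n i))" "integrable M (\<lambda>\<omega>. (norm (f i \<omega>))\<^sup>2)" by auto
  have a0: "0 \<le> ?a 0" by (intro Bochner_Integration.integral_nonneg) auto
  have "(1 + 2 * c * h) ^ i \<le> (1 + 2 * c * h) ^ Suc n"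
    using h \<open>c \<ge> 0\<close> i by (intro power_increasing) auto
  also have "\<dots> \<le> exp (2 * c * h) ^ Suc n"
    using h \<open>c \<ge> 0\<close> by (intro power_mono exp_ge_add_one_self add_nonneg_nonneg mult_nonneg_nonneg) auto
  also have "\<dots> = exp (2 * c * (t - s))"
    by (subst exp_of_nat_mult[symmetric]) (use h(2) in \<open>simp add: mult_ac del: of_nat_Suc\<close>)
  finally have "(1 + 2 * c * h) ^ i * (?a 0 + \<kappa>\<^sup>2) \<le> exp (2 * c * (t - s)) * (?a 0 + \<kappa>\<^sup>2)"
    using a0 by (intro mult_right_mono) auto
  moreover have "0 \<le> \<kappa>\<^sup>2" by simp
  ultimately show "?a i \<le> exp (2 * c * (t - s)) * (?a 0 + \<kappa>\<^sup>2)"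
    using main by linarith
qed

end

section \<open>The Euler scheme of the driftless equation and its convergence\<close>

context linear_sde
begin

primrec euler :: "real \<Rightarrow> real \<Rightarrow> nat \<Rightarrow> ('w \<Rightarrow> 'b) \<Rightarrow> nat \<Rightarrow> 'w \<Rightarrow> 'b" where
  "euler s t n y 0 = y"
| "euler s t n y (Suc i) = (\<lambda>\<omega>. euler s t n y i \<omega> +
    (\<Sum>l=1..m. (W l (grid s t n (Suc i)) \<omega> - W l (grid s t n i) \<omega>) *\<^sub>R app (coeff l (grid s t n i)) (euler s t n y i \<omega>)))"

lemma coeff_bound:
  assumes "s < t"
  shows "\<exists>c\<ge>0. \<forall>n. \<forall>i\<le>Suc n. (\<Sum>l=1..m. (norm (coeff l (grid s t n i)))\<^sup>2) \<le> c"
proof -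
  have "continuous_on {s..t} (\<lambda>q. \<Sum>l=1..m. (norm (coeff l q))\<^sup>2)"
    unfolding coeff_def by (intro continuous_intros continuous_on_conj_exp)
  then obtain c where c: "c \<ge> 0" "\<And>q. q \<in> {s..t} \<Longrightarrow> norm (\<Sum>l=1..m. (norm (coeff l q))\<^sup>2) \<le> c"
    using bounded_on_compact_interval by blast
  have "(\<Sum>l=1..m. (norm (coeff l (grid s t n i)))\<^sup>2) \<le> c" if "i \<le> Suc n" for n i
    using c(2)[of "grid s t n i"] grid_bounds[of s t i n] that assms by simp
  with c(1) show ?thesis by blast
qed

lemma euler_moments:
  assumes st: "0 \<le> s" "s < t" and y: "y \<in> borel_measurable (F s)" "integrable M (\<lambda>\<omega>. (norm (y \<omega>))\<^sup>2)"
  obtains C where "\<And>n i. i \<le> Suc n \<Longrightarrow> euler s t n y i \<in> borel_measurable (F (grid s t n i)) \<and>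
    integrable M (\<lambda>\<omega>. (norm (euler s t n y i \<omega>))\<^sup>2) \<and> expectation (\<lambda>\<omega>. (norm (euler s t n y i \<omega>))\<^sup>2) \<le> C"
proof -
  obtain c where c: "\<And>n i. i \<le> Suc n \<Longrightarrow> (\<Sum>l=1..m. (norm (coeff l (grid s t n i)))\<^sup>2) \<le> c"
    using coeff_bound[OF st(2)] by blast
  have "euler s t n y i \<in> borel_measurable (F (grid s t n i)) \<and>
    integrable M (\<lambda>\<omega>. (norm (euler s t n y i \<omega>))\<^sup>2) \<and>
    expectation (\<lambda>\<omega>. (norm (euler s t n y i \<omega>))\<^sup>2) \<le> exp (2 * c * (t - s)) * (expectation (\<lambda>\<omega>. (norm (y \<omega>))\<^sup>2) + 0\<^sup>2)"
    if "i \<le> Suc n" for n i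
    using euler_second_moment[OF st, of "euler s t n y" n coeff "\<lambda>_ _. 0" 0 c i] c[of _ n] y that by simp
  with that show thesis by blast
qed

text \<open>The weight supplies the square integrable start that the moment bounds of the scheme ask
  for, whatever the moments of \<open>X s\<close>.\<close>

lemma weighted_start:
  assumes s: "0 \<le> s"
    and \<theta>: "\<theta> \<in> borel_measurable (F s)" "\<And>\<omega>. \<bar>\<theta> \<omega>\<bar> * norm (X s \<omega>) \<le> K"
  shows "(\<lambda>\<omega>. \<theta> \<omega> *\<^sub>R pullback s \<omega>) \<in> borel_measurable (F s)" (is "?y \<in> _")
    "integrable M (\<lambda>\<omega>. (norm (\<theta> \<omega> *\<^sub>R pullback s \<omega>))\<^sup>2)"
proof -
  show meas: "?y \<in> borel_measurable (F s)"
    using \<theta>(1) pullback_measurable[OF s order_refl] by measurable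
  have bound: "norm (?y \<omega>) \<le> norm (exp (- s *\<^sub>R G)) * K" for \<omega>
  proof -
    have "norm (?y \<omega>) \<le> \<bar>\<theta> \<omega>\<bar> * (norm (exp (- s *\<^sub>R G)) * norm (X s \<omega>))"
      unfolding pullback_def norm_scaleR by (intro mult_left_mono norm_app) auto
    also have "\<dots> = norm (exp (- s *\<^sub>R G)) * (\<bar>\<theta> \<omega>\<bar> * norm (X s \<omega>))" by simp
    also have "\<dots> \<le> norm (exp (- s *\<^sub>R G)) * K" by (intro mult_left_mono \<theta>(2)) auto
    finally show ?thesis .
  qed
  show "integrable M (\<lambda>\<omega>. (norm (?y \<omega>))\<^sup>2)"
  proof (rule integrable_const_bound)
    show "AE \<omega> in M. norm ((norm (?y \<omega>))\<^sup>2) \<le> (norm (exp (- s *\<^sub>R G)) * K)\<^sup>2"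
      using bound by (intro AE_I2) (simp add: power_mono)
    show "(\<lambda>\<omega>. (norm (?y \<omega>))\<^sup>2) \<in> borel_measurable M"
      using measurable_F_M[OF meas s] by measurable
  qed
qed

text \<open>The error of the scheme need not have moments, and the increments of the defect
  \<open>d\<close> need not be summable. Subtracting \<open>\<theta> d\<close> from the error avoids
  both: the remainder \<open>f\<close> starts at 0 and obeys the Euler recursion with
  \<open>f + \<theta> d\<close> under the noise coefficients, so the perturbation is
  \<open>d\<close> itself. Replacing \<open>\<theta> d\<close> by the bounded adapted \<rho> gives
  \<open>f\<close> a second moment of order \<open>\<kappa>^2\<close>, and this changes nothing
  where the defect stays within \<kappa>, which fails with vanishing probability.\<close>

lemma euler_converges:
  assumes st: "0 \<le> s" "s < t"
    and \<theta>: "\<theta> \<in> borel_measurable (F s)" "\<And>\<omega>. \<bar>\<theta> \<omega>\<bar> \<le> K" "\<And>\<omega>. \<bar>\<theta> \<omega>\<bar> * norm (X s \<omega>) \<le> K"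
    and "\<epsilon> > 0"
  shows "(\<lambda>n. prob {\<omega> \<in> space M.
    norm (\<theta> \<omega> *\<^sub>R pullback t \<omega> - euler s t n (\<lambda>\<omega>. \<theta> \<omega> *\<^sub>R pullback s \<omega>) (Suc n) \<omega>) > \<epsilon>}) \<longlonglongrightarrow> 0"
proof (rule vanishing_by_bound)
  fix e :: real assume "e > 0"
  have "0 \<le> K" using \<theta>(2) abs_ge_zero order_trans by blast
  obtain c where c: "c \<ge> 0" "\<And>n i. i \<le> Suc n \<Longrightarrow> (\<Sum>l=1..m. (norm (coeff l (grid s t n i)))\<^sup>2) \<le> c"
    using coeff_bound[OF st(2)] by blast
  \<comment> \<open>\<open>a\<close> times \<open>\<kappa>^2\<close> is the Chebyshev bound for the
    tail of \<open>f\<close> at \<open>\<epsilon> / 2\<close>. The second entry of the minimum below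
    brings it under \<open>e\<close>; the first brings the explicit part \<open>\<theta> d\<close>
    under \<open>\<epsilon> / 2\<close>.\<close>
  define a where "a = exp (2 * c * (t - s)) * K\<^sup>2 * 4 / \<epsilon>\<^sup>2"
  have "a \<ge> 0" by (simp add: a_def)
  define \<kappa> where "\<kappa> = min (\<epsilon> / (2 * (K + 1))) (sqrt (e / (a + 1)))"
  have \<kappa>: "\<kappa> > 0" using \<open>0 \<le> K\<close> \<open>\<epsilon> > 0\<close> \<open>e > 0\<close> \<open>a \<ge> 0\<close>
    by (simp add: \<kappa>_def add_nonneg_pos)
  have \<kappa>_1: "K * \<kappa> \<le> \<epsilon> / 2"
  proof -
    have "K * \<kappa> \<le> (K + 1) * \<kappa>" using \<kappa> by simp
    also have "\<dots> \<le> (K + 1) * (\<epsilon> / (2 * (K + 1)))"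
      unfolding \<kappa>_def using \<open>0 \<le> K\<close> by (intro mult_left_mono) auto
    also have "\<dots> = \<epsilon> / 2"
      using \<open>0 \<le> K\<close> nonzero_mult_divide_mult_cancel_left[of "K + 1" \<epsilon> 2] by (simp add: mult.commute)
    finally show ?thesis .
  qed
  have \<kappa>_2: "a * \<kappa>\<^sup>2 \<le> e"
  proof -
    have "\<kappa>\<^sup>2 \<le> (sqrt (e / (a + 1)))\<^sup>2"
      using \<kappa> by (intro power_mono) (auto simp: \<kappa>_def)
    also have "\<dots> = e / (a + 1)" using \<open>e > 0\<close> \<open>a \<ge> 0\<close> by simp
    finally have "(a + 1) * \<kappa>\<^sup>2 \<le> e" using \<open>a \<ge> 0\<close> by (simp add: pos_le_divide_eq mult.commute)
    then show ?thesis by (smt (verit) \<kappa> mult_right_mono zero_le_power2)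
  qed
  define y where "y \<omega> = \<theta> \<omega> *\<^sub>R pullback s \<omega>" for \<omega>
  let ?d = "\<lambda>n. pullback_defect s t n"
  let ?g = "\<lambda>n i. grid s t n i"
  let ?dW = "\<lambda>n i l \<omega>. W l (?g n (Suc i)) \<omega> - W l (?g n i) \<omega>"
  \<comment> \<open>The cut looks at defects up to the present index only, so \<rho> remains
    adapted.\<close>
  define good where "good n i \<omega> \<longleftrightarrow> (\<forall>j\<in>{..i}. norm (?d n j \<omega>) \<le> \<kappa>)" for n i \<omega>
  define \<rho> where "\<rho> n i \<omega> = (if good n i \<omega> then \<theta> \<omega> *\<^sub>R ?d n i \<omega> else 0)" for n i \<omega>
  define f where "f n = rec_nat (\<lambda>_. 0) (\<lambda>i f \<omega>. f \<omega> +
      (\<Sum>l=1..m. ?dW n i l \<omega> *\<^sub>R app (coeff l (?g n i)) (f \<omega> + \<rho> n i \<omega>)))" for n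
  have f_0: "f n 0 = (\<lambda>_. 0)" for n by (simp add: f_def)
  have f_Suc: "f n (Suc i) \<omega> = f n i \<omega> +
      (\<Sum>l=1..m. ?dW n i l \<omega> *\<^sub>R app (coeff l (?g n i)) (f n i \<omega> + \<rho> n i \<omega>))" for n i \<omega>
    by (simp add: f_def)
  have d_meas: "?d n j \<in> borel_measurable (F (?g n i))" if "j \<le> i" "i \<le> Suc n" for n i j
    using pullback_defect_measurable[OF st, of j n] that grid_bounds[of s t j n] grid_mono[of s t j i n] st
    by (intro measurable_F_mono[of _ "?g n j" _ "?g n i"]) auto
  have \<rho>_meas: "\<rho> n i \<in> borel_measurable (F (?g n i))" if "i \<le> n" for n i
  proof -
    have [measurable]: "\<theta> \<in> borel_measurable (F (?g n i))"
      using measurable_F_mono[OF \<theta>(1) st(1)] grid_bounds[of s t i n] that st by auto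
    have [measurable]: "?d n j \<in> borel_measurable (F (?g n i))" if "j \<in> {..i}" for j
      using d_meas[of j i n] that \<open>i \<le> n\<close> by auto
    have [measurable]: "?d n i \<in> borel_measurable (F (?g n i))"
      using d_meas[of i i n] that by auto
    have [measurable]: "Measurable.pred (F (?g n i)) (good n i)"
      unfolding good_def[abs_def] by measurable
    show ?thesis unfolding \<rho>_def[abs_def] by measurable
  qed
  have \<rho>_bound: "norm (\<rho> n i \<omega>) \<le> K * \<kappa>" for n i \<omega>
    using \<theta>(2)[of \<omega>] \<open>0 \<le> K\<close> \<kappa> by (auto simp: \<rho>_def good_def intro!: mult_mono)
  have f_second: "f n (Suc n) \<in> borel_measurable (F (?g n (Suc n)))" "integrable M (\<lambda>\<omega>. (norm (f n (Suc n) \<omega>))\<^sup>2)"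
    "expectation (\<lambda>\<omega>. (norm (f n (Suc n) \<omega>))\<^sup>2) \<le> exp (2 * c * (t - s)) * (K * \<kappa>)\<^sup>2" for n
    using euler_second_moment[OF st, of "f n" n coeff "\<rho> n" "K * \<kappa>" c "Suc n"]
      f_0 f_Suc \<rho>_meas \<rho>_bound c(2)[of _ n] \<open>0 \<le> K\<close> \<kappa> by simp_all
  have f_meas: "f n (Suc n) \<in> borel_measurable M" for n
    using measurable_F_M[OF f_second(1), of n] st by simp
  have f_tail: "prob {\<omega> \<in> space M. \<epsilon> / 2 < norm (f n (Suc n) \<omega>)} \<le> e" for n
  proof -
    have "prob {\<omega> \<in> space M. \<epsilon> / 2 < norm (f n (Suc n) \<omega>)} \<le> expectation (\<lambda>\<omega>. (norm (f n (Suc n) \<omega>))\<^sup>2) / (\<epsilon> / 2)\<^sup>2"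
      by (rule chebyshev[OF f_meas f_second(2)]) (use \<open>\<epsilon> > 0\<close> in simp)
    also have "\<dots> \<le> exp (2 * c * (t - s)) * (K * \<kappa>)\<^sup>2 / (\<epsilon> / 2)\<^sup>2"
      by (intro divide_right_mono f_second(3)) simp
    also have "\<dots> = a * \<kappa>\<^sup>2"
      by (simp add: a_def power_mult_distrib power_divide)
    finally show ?thesis using \<kappa>_2 by simp
  qed
  let ?E = "\<lambda>n. {\<omega> \<in> space M. norm (\<theta> \<omega> *\<^sub>R pullback t \<omega> - euler s t n y (Suc n) \<omega>) > \<epsilon>}"
  let ?B = "\<lambda>n. {\<omega> \<in> space M. \<exists>i\<in>{..Suc n}. norm (?d n i \<omega>) > \<kappa>}"
  \<comment> \<open>On paths that are good to the end the cut is inactive at every index, and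
    \<open>f\<close> is exactly the error of the scheme minus \<open>\<theta> d\<close>.\<close>
  have f_eq: "f n i \<omega> = \<theta> \<omega> *\<^sub>R pullback (?g n i) \<omega> - euler s t n y i \<omega> - \<theta> \<omega> *\<^sub>R ?d n i \<omega>"
    if "good n (Suc n) \<omega>" "i \<le> Suc n" for n i \<omega>
    using that(2)
  proof (induction i)
    case 0
    then show ?case by (simp add: f_0 y_def pullback_defect_def)
  next
    case (Suc i)
    have "good n i \<omega>" using that(1) Suc.prems by (auto simp: good_def)
    then have arg: "f n i \<omega> + \<rho> n i \<omega> = \<theta> \<omega> *\<^sub>R pullback (?g n i) \<omega> - euler s t n y i \<omega>"
      using Suc by (simp add: \<rho>_def)
    have d_Suc: "?d n (Suc i) \<omega> = ?d n i \<omega> + pullback (?g n (Suc i)) \<omega> - pullback (?g n i) \<omega> -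
        (\<Sum>l=1..m. ?dW n i l \<omega> *\<^sub>R app (coeff l (?g n i)) (pullback (?g n i) \<omega>))"
      by (simp add: pullback_defect_def)
    have "(\<Sum>l=1..m. ?dW n i l \<omega> *\<^sub>R app (coeff l (?g n i)) (\<theta> \<omega> *\<^sub>R pullback (?g n i) \<omega> - euler s t n y i \<omega>)) =
        \<theta> \<omega> *\<^sub>R (\<Sum>l=1..m. ?dW n i l \<omega> *\<^sub>R app (coeff l (?g n i)) (pullback (?g n i) \<omega>)) -
        (\<Sum>l=1..m. ?dW n i l \<omega> *\<^sub>R app (coeff l (?g n i)) (euler s t n y i \<omega>))"
      by (simp add: app.diff_right app.scaleR_right scaleR_diff_right sum_subtractf scaleR_sum_right mult.commute)
    then show ?case
      using Suc unfolding f_Suc arg d_Suc euler.simps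
      by (simp add: scaleR_diff_right scaleR_add_right)
  qed
  have B_ev: "?B n \<in> events" for n
  proof (rule events_finite_ex)
    show "?d n i \<in> borel_measurable M" if "i \<in> {..Suc n}" for i
      using measurable_F_M[OF pullback_defect_measurable[OF st, of i n]] grid_bounds[of s t i n] st that by auto
  qed simp
  have f_ev: "{\<omega> \<in> space M. \<epsilon> / 2 < norm (f n (Suc n) \<omega>)} \<in> events" for n
    using f_meas by measurable
  have "prob (?E n) \<le> e + prob (?B n)" for n
  proof -
    have "?E n \<subseteq> {\<omega> \<in> space M. \<epsilon> / 2 < norm (f n (Suc n) \<omega>)} \<union> ?B n"
    proof
      fix \<omega> assume \<omega>: "\<omega> \<in> ?E n"
      show "\<omega> \<in> {\<omega> \<in> space M. \<epsilon> / 2 < norm (f n (Suc n) \<omega>)} \<union> ?B n"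
      proof (rule ccontr)
        assume neg: "\<not> ?thesis"
        then have good: "good n (Suc n) \<omega>" using \<omega> by (auto simp: good_def not_less)
        then have "norm (?d n (Suc n) \<omega>) \<le> \<kappa>" by (auto simp: good_def)
        then have "norm (\<theta> \<omega> *\<^sub>R ?d n (Suc n) \<omega>) \<le> K * \<kappa>"
          using \<theta>(2)[of \<omega>] \<open>0 \<le> K\<close> by (auto intro!: mult_mono)
        moreover have "norm (f n (Suc n) \<omega>) \<le> \<epsilon> / 2" using neg \<omega> by auto
        moreover have "\<theta> \<omega> *\<^sub>R pullback t \<omega> - euler s t n y (Suc n) \<omega> = f n (Suc n) \<omega> + \<theta> \<omega> *\<^sub>R ?d n (Suc n) \<omega>"
          using f_eq[OF good order_refl] by (simp del: euler.simps)
        ultimately have "norm (\<theta> \<omega> *\<^sub>R pullback t \<omega> - euler s t n y (Suc n) \<omega>) \<le> \<epsilon> / 2 + K * \<kappa>"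
          using norm_triangle_ineq[of "f n (Suc n) \<omega>" "\<theta> \<omega> *\<^sub>R ?d n (Suc n) \<omega>"] by (simp del: euler.simps)
        then show False using \<omega> \<kappa>_1 by (simp del: euler.simps)
      qed
    qed
    then have "prob (?E n) \<le> prob ({\<omega> \<in> space M. \<epsilon> / 2 < norm (f n (Suc n) \<omega>)} \<union> ?B n)"
      using B_ev f_ev by (intro finite_measure_mono) auto
    also have "\<dots> \<le> prob {\<omega> \<in> space M. \<epsilon> / 2 < norm (f n (Suc n) \<omega>)} + prob (?B n)"
      by (intro measure_subadditive B_ev f_ev) simp_all
    finally show ?thesis using f_tail[of n] by linarith
  qed
  then show "\<exists>q. q \<longlonglongrightarrow> 0 \<and> (\<forall>n. prob {\<omega> \<in> space M.
      norm (\<theta> \<omega> *\<^sub>R pullback t \<omega> - euler s t n (\<lambda>\<omega>. \<theta> \<omega> *\<^sub>R pullback s \<omega>) (Suc n) \<omega>) > \<epsilon>} \<le> e + q n)"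
    using pullback_defect_vanishes[OF st \<kappa>] unfolding y_def[abs_def] by blast
qed simp

end

section \<open>Annihilators of the solution\<close>

lemma (in prob_space) AE_zero_of_tails:
  fixes Z :: "'a \<Rightarrow> 'b::euclidean_space"
  assumes [measurable]: "Z \<in> borel_measurable M"
    and tails: "\<And>\<epsilon>. \<epsilon> > 0 \<Longrightarrow> prob {\<omega> \<in> space M. norm (Z \<omega>) > \<epsilon>} = 0"
  shows "AE \<omega> in M. Z \<omega> = 0"
proof -
  have "AE \<omega> in M. \<forall>k. \<not> norm (Z \<omega>) > 1 / real (Suc k)"
    unfolding AE_all_countable
  proof
    fix k
    have "prob {\<omega> \<in> space M. norm (Z \<omega>) > 1 / real (Suc k)} = 0"
      by (intro tails) simp
    then show "AE \<omega> in M. \<not> norm (Z \<omega>) > 1 / real (Suc k)"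
      by (subst AE_iff_measurable[of "{\<omega> \<in> space M. norm (Z \<omega>) > 1 / real (Suc k)}"])
        (auto simp: emeasure_eq_measure)
  qed
  then show ?thesis
  proof eventually_elim
    case (elim \<omega>)
    show ?case
    proof (rule ccontr)
      assume "Z \<omega> \<noteq> 0"
      then obtain k where "inverse (real (Suc k)) < norm (Z \<omega>)"
        using reals_Archimedean[of "norm (Z \<omega>)"] by auto
      with elim show False by (simp add: inverse_eq_divide)
    qed
  qed
qed

section \<open>Martingale identities and annihilation\<close>

context linear_sde
begin

text \<open>Each step adds increments multiplied by coefficients from the past, hence nothing in the
  mean: the scheme is a martingale.\<close>

lemma euler_mean:
  assumes st: "0 \<le> s" "s < t" and y: "y \<in> borel_measurable (F s)" "integrable M (\<lambda>\<omega>. (norm (y \<omega>))\<^sup>2)"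
    and i: "i \<le> Suc n"
  shows "expectation (euler s t n y i) = expectation y"
  using i
proof (induction i)
  case (Suc i)
  obtain C where mom: "\<And>n i. i \<le> Suc n \<Longrightarrow> euler s t n y i \<in> borel_measurable (F (grid s t n i)) \<and>
    integrable M (\<lambda>\<omega>. (norm (euler s t n y i \<omega>))\<^sup>2) \<and> expectation (\<lambda>\<omega>. (norm (euler s t n y i \<omega>))\<^sup>2) \<le> C"
    using euler_moments[OF st y] by blast
  let ?g = "grid s t n i" and ?g' = "grid s t n (Suc i)"
  define Y where "Y = euler s t n y i"
  define b where "b k \<omega> = app (coeff k ?g) (Y \<omega>)" for k \<omega>
  have g: "0 \<le> ?g" "?g < ?g'" using grid_bounds[of s t i n] st Suc.prems grid_less[OF st(2)] by auto
  have Y: "Y \<in> borel_measurable (F ?g)" "integrable M (\<lambda>\<omega>. (norm (Y \<omega>))\<^sup>2)"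
    using mom[of i n] Suc.prems by (auto simp: Y_def)
  have Y_int: "integrable M Y" using integrable_of_square[OF measurable_F_M[OF Y(1) g(1)] Y(2)] .
  have b: "b k \<in> borel_measurable (F ?g)" "integrable M (b k)" for k
    unfolding b_def using Y(1) integrable_bounded_linear[OF app.bounded_linear_right Y_int]
    by measurable
  have mean: "integrable M (\<lambda>\<omega>. (W k ?g' \<omega> - W k ?g \<omega>) *\<^sub>R b k \<omega>)"
    "expectation (\<lambda>\<omega>. (W k ?g' \<omega> - W k ?g \<omega>) *\<^sub>R b k \<omega>) = 0" if "k \<in> {1..m}" for k
    using vector_increment_mean[OF that g b] by auto
  have "expectation (euler s t n y (Suc i)) = expectation Y +
      (\<Sum>k=1..m. expectation (\<lambda>\<omega>. (W k ?g' \<omega> - W k ?g \<omega>) *\<^sub>R b k \<omega>))"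
    unfolding euler.simps Y_def[symmetric] b_def[symmetric] using Y_int mean(1)
    by (subst Bochner_Integration.integral_add) (auto intro!: Bochner_Integration.integral_sum)
  also have "\<dots> = expectation y"
    using mean(2) Suc by (simp add: sum.neutral Y_def)
  finally show ?case .
qed simp

text \<open>A discrete product rule. Of the terms added in one step only the product of the
  increment of \<open>W l\<close> with itself survives in the mean; it contributes the mesh times
  the coefficient applied to the mean of the scheme, which is constant by
  \<open>euler_mean\<close>.\<close>

lemma euler_covariation:
  assumes st: "0 \<le> s" "s < t" and y: "y \<in> borel_measurable (F s)" "integrable M (\<lambda>\<omega>. (norm (y \<omega>))\<^sup>2)"
    and l: "l \<in> {1..m}" and i: "i \<le> Suc n"
  shows "expectation (\<lambda>\<omega>. (W l (grid s t n i) \<omega> - W l s \<omega>) *\<^sub>R euler s t n y i \<omega>) =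
      ((t - s) / real (Suc n)) *\<^sub>R (\<Sum>j<i. app (coeff l (grid s t n j)) (expectation y))"
  using i
proof (induction i)
  case 0
  then show ?case by simp
next
  case (Suc i)
  obtain C where mom: "\<And>n i. i \<le> Suc n \<Longrightarrow> euler s t n y i \<in> borel_measurable (F (grid s t n i)) \<and>
    integrable M (\<lambda>\<omega>. (norm (euler s t n y i \<omega>))\<^sup>2) \<and> expectation (\<lambda>\<omega>. (norm (euler s t n y i \<omega>))\<^sup>2) \<le> C"
    using euler_moments[OF st y] by blast
  let ?g = "grid s t n i" and ?g' = "grid s t n (Suc i)"
  define h where "h = (t - s) / real (Suc n)"
  define Y where "Y = euler s t n y i"
  define d where "d k \<omega> = W k ?g' \<omega> - W k ?g \<omega>" for k \<omega>
  define T where "T \<omega> = W l ?g \<omega> - W l s \<omega>" for \<omega>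
  define b where "b k \<omega> = app (coeff k ?g) (Y \<omega>)" for k \<omega>
  have g: "s \<le> ?g" "0 \<le> ?g" "?g < ?g'" using grid_bounds[of s t i n] st Suc.prems grid_less[OF st(2)] by auto
  have Y: "Y \<in> borel_measurable (F ?g)" "integrable M (\<lambda>\<omega>. (norm (Y \<omega>))\<^sup>2)"
    using mom[of i n] Suc.prems by (auto simp: Y_def)
  have Y_M [measurable]: "Y \<in> borel_measurable M" using measurable_F_M[OF Y(1) g(2)] .
  have Y_int: "integrable M Y" using integrable_of_square[OF Y_M Y(2)] .
  have T_F: "T \<in> borel_measurable (F ?g)"
    unfolding T_def using W_adapted[OF l st(1) g(1)] W_adapted[OF l g(2) order_refl] by measurable
  have T_M [measurable]: "T \<in> borel_measurable M" using measurable_F_M[OF T_F g(2)] .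
  have T2: "integrable M (\<lambda>\<omega>. (T \<omega>)\<^sup>2)"
  \<comment> \<open>The moments of an increment are available for intervals of positive length; at
    the first grid point \<open>T\<close> is identically 0.\<close>
  proof (cases "?g = s")
    case True
    then show ?thesis by (simp add: T_def)
  next
    case False
    then show ?thesis unfolding T_def using increment_moments(3)[OF l st(1), of ?g] g by auto
  qed
  have TY: "integrable M (\<lambda>\<omega>. T \<omega> *\<^sub>R Y \<omega>)"
    by (rule integrable_scaleR_of_squares[OF T_M Y_M T2 Y(2)])
  have b_F: "b k \<in> borel_measurable (F ?g)" for k
    unfolding b_def using Y(1) by measurable
  have b_int: "integrable M (b k)" "expectation (b k) = app (coeff k ?g) (expectation Y)" for k
    unfolding b_def
    using integrable_bounded_linear[OF app.bounded_linear_right Y_int]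
      integral_bounded_linear[OF app.bounded_linear_right Y_int] by auto
  have Tb: "(\<lambda>\<omega>. T \<omega> *\<^sub>R b k \<omega>) \<in> borel_measurable (F ?g)" "integrable M (\<lambda>\<omega>. T \<omega> *\<^sub>R b k \<omega>)" for k
  proof -
    show "(\<lambda>\<omega>. T \<omega> *\<^sub>R b k \<omega>) \<in> borel_measurable (F ?g)"
      using T_F b_F by measurable
    show "integrable M (\<lambda>\<omega>. T \<omega> *\<^sub>R b k \<omega>)"
      using integrable_bounded_linear[OF app.bounded_linear_right[of "coeff k ?g"] TY]
      by (simp add: b_def app.scaleR_right)
  qed
  have mean_Y: "integrable M (\<lambda>\<omega>. d l \<omega> *\<^sub>R Y \<omega>)" "expectation (\<lambda>\<omega>. d l \<omega> *\<^sub>R Y \<omega>) = 0"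
    unfolding d_def using vector_increment_mean[OF l g(2,3) Y(1) Y_int] by auto
  have mean_Tb: "integrable M (\<lambda>\<omega>. d k \<omega> *\<^sub>R (T \<omega> *\<^sub>R b k \<omega>))" "expectation (\<lambda>\<omega>. d k \<omega> *\<^sub>R (T \<omega> *\<^sub>R b k \<omega>)) = 0"
    if "k \<in> {1..m}" for k
    unfolding d_def using vector_increment_mean[OF that g(2,3) Tb] by auto
  have cov: "integrable M (\<lambda>\<omega>. (d l \<omega> * d k \<omega>) *\<^sub>R b k \<omega>)"
    "expectation (\<lambda>\<omega>. (d l \<omega> * d k \<omega>) *\<^sub>R b k \<omega>) = (if l = k then h *\<^sub>R expectation (b k) else 0)" if "k \<in> {1..m}" for k
    unfolding d_def h_def using vector_increment_covariance[OF l that g(2,3) b_F b_int(1)] by (auto simp: grid_Suc)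
  have Y_Suc: "euler s t n y (Suc i) = (\<lambda>\<omega>. Y \<omega> + (\<Sum>k=1..m. d k \<omega> *\<^sub>R b k \<omega>))"
    by (simp add: Y_def d_def b_def)
  have EY: "expectation Y = expectation y"
    using euler_mean[OF st y, of i n] Suc.prems by (simp add: Y_def)
  have ETY: "expectation (\<lambda>\<omega>. T \<omega> *\<^sub>R Y \<omega>) =
      h *\<^sub>R (\<Sum>j<i. app (coeff l (grid s t n j)) (expectation y))"
    using Suc by (auto simp: Y_def T_def h_def)
  have expand: "(W l ?g' \<omega> - W l s \<omega>) *\<^sub>R euler s t n y (Suc i) \<omega> =
      T \<omega> *\<^sub>R Y \<omega> + d l \<omega> *\<^sub>R Y \<omega> + (\<Sum>k=1..m. d k \<omega> *\<^sub>R (T \<omega> *\<^sub>R b k \<omega>)) + (\<Sum>k=1..m. (d l \<omega> * d k \<omega>) *\<^sub>R b k \<omega>)" for \<omega>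
  proof -
    have "W l ?g' \<omega> - W l s \<omega> = T \<omega> + d l \<omega>" by (simp add: T_def d_def)
    then show ?thesis
      unfolding Y_Suc by (simp add: scaleR_add_left scaleR_add_right scaleR_sum_right
          sum.distrib[symmetric] distrib_left mult.commute)
  qed
  have "expectation (\<lambda>\<omega>. (W l ?g' \<omega> - W l s \<omega>) *\<^sub>R euler s t n y (Suc i) \<omega>) =
      expectation (\<lambda>\<omega>. T \<omega> *\<^sub>R Y \<omega>) + expectation (\<lambda>\<omega>. d l \<omega> *\<^sub>R Y \<omega>) +
      (\<Sum>k=1..m. expectation (\<lambda>\<omega>. d k \<omega> *\<^sub>R (T \<omega> *\<^sub>R b k \<omega>))) + (\<Sum>k=1..m. expectation (\<lambda>\<omega>. (d l \<omega> * d k \<omega>) *\<^sub>R b k \<omega>))"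
  proof -
    have i1: "integrable M (\<lambda>\<omega>. \<Sum>k=1..m. d k \<omega> *\<^sub>R (T \<omega> *\<^sub>R b k \<omega>))"
      "integrable M (\<lambda>\<omega>. \<Sum>k=1..m. (d l \<omega> * d k \<omega>) *\<^sub>R b k \<omega>)"
      by (intro Bochner_Integration.integrable_sum mean_Tb(1) cov(1); assumption)+
    have "expectation (\<lambda>\<omega>. \<Sum>k=1..m. d k \<omega> *\<^sub>R (T \<omega> *\<^sub>R b k \<omega>)) = (\<Sum>k=1..m. expectation (\<lambda>\<omega>. d k \<omega> *\<^sub>R (T \<omega> *\<^sub>R b k \<omega>)))"
      "expectation (\<lambda>\<omega>. \<Sum>k=1..m. (d l \<omega> * d k \<omega>) *\<^sub>R b k \<omega>) = (\<Sum>k=1..m. expectation (\<lambda>\<omega>. (d l \<omega> * d k \<omega>) *\<^sub>R b k \<omega>))"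
      by (intro Bochner_Integration.integral_sum mean_Tb(1) cov(1); assumption)+
    then show ?thesis
      unfolding expand using TY mean_Y(1) i1 by (simp only: Bochner_Integration.integral_add Bochner_Integration.integrable_add)
  qed
  also have "(\<Sum>k=1..m. expectation (\<lambda>\<omega>. d k \<omega> *\<^sub>R (T \<omega> *\<^sub>R b k \<omega>))) = 0"
    by (intro sum.neutral ballI mean_Tb(2))
  also have "(\<Sum>k=1..m. expectation (\<lambda>\<omega>. (d l \<omega> * d k \<omega>) *\<^sub>R b k \<omega>)) = (\<Sum>k=1..m. if l = k then h *\<^sub>R expectation (b k) else 0)"
    by (intro sum.cong refl cov(2))
  also have "\<dots> = h *\<^sub>R app (coeff l ?g) (expectation y)"
    using l by (simp add: b_int(2) EY)
  finally show ?case
    using mean_Y(2) ETY by (simp add: h_def scaleR_add_right)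
qed

context
  fixes s t :: real and u :: "'b endo"
  assumes st: "0 \<le> s" "s < t" and u: "AE \<omega> in M. app u (pullback t \<omega>) = 0"
begin

text \<open>As \<open>u\<close> kills the solution at \<open>t\<close>, it sends the Euler scheme to
  0 in probability, with bounded second moments; hence the expectation tested with any square
  integrable \<open>T\<close> vanishes in the limit. The last claim stays a limit of Riemann sums:
  \<open>t\<close> will be moved towards \<open>s\<close>, and the integral itself is never
  formed.\<close>

lemma weighted_annihilation:
  assumes \<theta>: "\<theta> \<in> borel_measurable (F s)" "\<And>\<omega>. \<bar>\<theta> \<omega>\<bar> \<le> K" "\<And>\<omega>. \<bar>\<theta> \<omega>\<bar> * norm (X s \<omega>) \<le> K"
  defines "e \<equiv> expectation (\<lambda>\<omega>. \<theta> \<omega> *\<^sub>R pullback s \<omega>)"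
  shows "integrable M (\<lambda>\<omega>. \<theta> \<omega> *\<^sub>R pullback s \<omega>)"
    "app u e = 0"
    "l \<in> {1..m} \<Longrightarrow> (\<lambda>n. app u (((t - s) / real (Suc n)) *\<^sub>R (\<Sum>j<Suc n. app (coeff l (grid s t n j)) e))) \<longlonglongrightarrow> 0"
proof -
  define y where "y \<omega> = \<theta> \<omega> *\<^sub>R pullback s \<omega>" for \<omega>
  note y_meas = weighted_start(1)[OF st(1) \<theta>(1,3), folded y_def]
    and y2 = weighted_start(2)[OF st(1) \<theta>(1,3), folded y_def]
  have y_M [measurable]: "y \<in> borel_measurable M" using measurable_F_M[OF y_meas st(1)] .
  show "integrable M (\<lambda>\<omega>. \<theta> \<omega> *\<^sub>R pullback s \<omega>)"
    using integrable_of_square[OF y_M y2] unfolding y_def .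
  obtain C where mom: "\<And>n i. i \<le> Suc n \<Longrightarrow> euler s t n y i \<in> borel_measurable (F (grid s t n i)) \<and>
    integrable M (\<lambda>\<omega>. (norm (euler s t n y i \<omega>))\<^sup>2) \<and> expectation (\<lambda>\<omega>. (norm (euler s t n y i \<omega>))\<^sup>2) \<le> C"
    using euler_moments[OF st y_meas y2] by blast
  define Y where "Y n = euler s t n y (Suc n)" for n
  have Y: "Y n \<in> borel_measurable (F t)" "integrable M (\<lambda>\<omega>. (norm (Y n \<omega>))\<^sup>2)"
    "expectation (\<lambda>\<omega>. (norm (Y n \<omega>))\<^sup>2) \<le> C" for n
    using mom[of "Suc n" n] unfolding Y_def by (simp_all del: euler.simps)
  have Y_M [measurable]: "Y n \<in> borel_measurable M" for n
    using measurable_F_M[OF Y(1)] st by simp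
  have pb_M [measurable]: "pullback t \<in> borel_measurable M" "pullback s \<in> borel_measurable M" "\<theta> \<in> borel_measurable M"
    using measurable_F_M[OF pullback_measurable[of t t]] measurable_F_M[OF pullback_measurable[of s s]]
      measurable_F_M[OF \<theta>(1)] st by auto
  have uY2: "integrable M (\<lambda>\<omega>. (norm (app u (Y n \<omega>)))\<^sup>2)"
    "expectation (\<lambda>\<omega>. (norm (app u (Y n \<omega>)))\<^sup>2) \<le> (norm u)\<^sup>2 * C" for n
  proof -
    have le: "(norm (app u (Y n \<omega>)))\<^sup>2 \<le> (norm u)\<^sup>2 * (norm (Y n \<omega>))\<^sup>2" for \<omega>
      unfolding power_mult_distrib[symmetric] by (intro power_mono norm_app) auto
    have dom: "integrable M (\<lambda>\<omega>. (norm u)\<^sup>2 * (norm (Y n \<omega>))\<^sup>2)" using Y(2) by simp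
    show *: "integrable M (\<lambda>\<omega>. (norm (app u (Y n \<omega>)))\<^sup>2)"
      by (rule Bochner_Integration.integrable_bound[OF dom]) (use le in auto)
    have "expectation (\<lambda>\<omega>. (norm (app u (Y n \<omega>)))\<^sup>2) \<le> expectation (\<lambda>\<omega>. (norm u)\<^sup>2 * (norm (Y n \<omega>))\<^sup>2)"
      by (rule integral_mono[OF * dom le])
    also have "\<dots> \<le> (norm u)\<^sup>2 * C"
      using Y(3)[of n] by (simp add: mult_left_mono)
    finally show "expectation (\<lambda>\<omega>. (norm (app u (Y n \<omega>)))\<^sup>2) \<le> (norm u)\<^sup>2 * C" .
  qed
  have lim: "(\<lambda>n. prob {\<omega> \<in> space M. norm (app u (Y n \<omega>)) > \<epsilon>}) \<longlonglongrightarrow> 0" if "\<epsilon> > 0" for \<epsilon>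
  proof (rule tails_vanish_by_domination[OF _ _ _ that])
    show "AE \<omega> in M. norm (app u (Y n \<omega>)) \<le> norm u * norm (\<theta> \<omega> *\<^sub>R pullback t \<omega> - Y n \<omega>)" for n
      using u
    proof eventually_elim
      case (elim \<omega>)
      then have "app u (\<theta> \<omega> *\<^sub>R pullback t \<omega> - Y n \<omega>) = - app u (Y n \<omega>)"
        by (simp add: app.diff_right app.scaleR_right)
      then show ?case using norm_app[of u "\<theta> \<omega> *\<^sub>R pullback t \<omega> - Y n \<omega>"] by simp
    qed
    show "(\<lambda>n. prob {\<omega> \<in> space M. norm (\<theta> \<omega> *\<^sub>R pullback t \<omega> - Y n \<omega>) > \<epsilon>}) \<longlonglongrightarrow> 0" if "\<epsilon> > 0" for \<epsilon>
      using euler_converges[OF st \<theta> that] unfolding Y_def y_def[abs_def] .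
  qed measurable
  have test: "(\<lambda>n. app u (expectation (\<lambda>\<omega>. T \<omega> *\<^sub>R Y n \<omega>))) \<longlonglongrightarrow> 0"
    if T: "T \<in> borel_measurable M" "integrable M (\<lambda>\<omega>. (T \<omega>)\<^sup>2)" for T
  proof -
    have "expectation (\<lambda>\<omega>. T \<omega> *\<^sub>R app u (Y n \<omega>)) = app u (expectation (\<lambda>\<omega>. T \<omega> *\<^sub>R Y n \<omega>))" for n
      using integral_bounded_linear[OF app.bounded_linear_right[of u]
          integrable_scaleR_of_squares[OF T(1) Y_M T(2) Y(2)], of n]
      by (simp add: app.scaleR_right)
    moreover have "(\<lambda>n. expectation (\<lambda>\<omega>. T \<omega> *\<^sub>R app u (Y n \<omega>))) \<longlonglongrightarrow> 0"
      by (rule expectation_scaleR_vanishes[OF T _ uY2 lim]) measurable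
    ultimately show ?thesis by simp
  qed
  have e: "e = expectation y" by (simp add: e_def y_def[abs_def])
  show "app u e = 0"
  proof -
    \<comment> \<open>With \<open>T = 1\<close> the tested sequence is constant, so that its limit 0
      is its value.\<close>
    have "expectation (Y n) = e" for n
      using euler_mean[OF st y_meas y2, of "Suc n" n] unfolding Y_def e by blast
    then have "(\<lambda>n. app u e) \<longlonglongrightarrow> 0"
      using test[of "\<lambda>_. 1"] by simp
    then show ?thesis by (simp add: LIMSEQ_const_iff)
  qed
  show "(\<lambda>n. app u (((t - s) / real (Suc n)) *\<^sub>R (\<Sum>j<Suc n. app (coeff l (grid s t n j)) e))) \<longlonglongrightarrow> 0"
    if l: "l \<in> {1..m}"
  proof -
    have "expectation (\<lambda>\<omega>. (W l t \<omega> - W l s \<omega>) *\<^sub>R Y n \<omega>) =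
        ((t - s) / real (Suc n)) *\<^sub>R (\<Sum>j<Suc n. app (coeff l (grid s t n j)) e)" for n
      using euler_covariation[OF st y_meas y2 l order_refl, of n]
      unfolding Y_def e grid_end .
    moreover have "(\<lambda>\<omega>. W l t \<omega> - W l s \<omega>) \<in> borel_measurable M"
      using W_measurable[OF l] st by (intro borel_measurable_diff) auto
    ultimately show ?thesis
      using test[of "\<lambda>\<omega>. W l t \<omega> - W l s \<omega>"] increment_moments(3)[OF l st] by simp
  qed
qed

end


text \<open>For a component \<open>q\<close> of \<open>v\<close> applied to the pulled back
  solution, the weight \<open>q / (1 + |X|^2)\<close> turns that component into the nonnegative
  \<open>q^2 / (1 + |X|^2)\<close> with mean zero, so \<open>q\<close> vanishes almost surely. As
  \<open>|q|\<close> is at most \<open>c |X|\<close>, both the weight and its product with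
  \<open>|X|\<close> are bounded by \<open>c\<close>.\<close>

lemma zero_of_weighted_expectations:
  assumes "0 \<le> s"
    and weighted: "\<And>\<theta> K. \<theta> \<in> borel_measurable (F s) \<Longrightarrow> (\<And>\<omega>. \<bar>\<theta> \<omega>\<bar> \<le> K) \<Longrightarrow> (\<And>\<omega>. \<bar>\<theta> \<omega>\<bar> * norm (X s \<omega>) \<le> K) \<Longrightarrow>
      integrable M (\<lambda>\<omega>. \<theta> \<omega> *\<^sub>R pullback s \<omega>) \<and> app v (expectation (\<lambda>\<omega>. \<theta> \<omega> *\<^sub>R pullback s \<omega>)) = 0"
  shows "AE \<omega> in M. app v (pullback s \<omega>) = 0"
proof -
  define c where "c = norm v * norm (exp (- s *\<^sub>R G))"
  have "c \<ge> 0" by (simp add: c_def)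
  have bound: "norm (app v (pullback s \<omega>)) \<le> c * norm (X s \<omega>)" for \<omega>
    unfolding pullback_def c_def mult.assoc
    by (intro order_trans[OF norm_app] mult_left_mono norm_app) auto
  have pb [measurable]: "pullback s \<in> borel_measurable (F s)" "X s \<in> borel_measurable (F s)"
    using pullback_measurable X_adapted assms(1) by auto
  have "AE \<omega> in M. app v (pullback s \<omega>) \<bullet> b = 0" if b: "b \<in> Basis" for b
  proof -
    define q where "q \<omega> = app v (pullback s \<omega>) \<bullet> b" for \<omega>
    define \<theta> where "\<theta> \<omega> = q \<omega> / (1 + (norm (X s \<omega>))\<^sup>2)" for \<omega>
    have \<theta>_meas: "\<theta> \<in> borel_measurable (F s)"
      unfolding \<theta>_def q_def by measurable
    have q: "\<bar>q \<omega>\<bar> \<le> c * norm (X s \<omega>)" for \<omega>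
      using Basis_le_norm[OF b, of "app v (pullback s \<omega>)"] bound[of \<omega>] unfolding q_def by linarith
    have pos: "0 < 1 + x\<^sup>2" for x :: real by (simp add: add_pos_nonneg)
    have x_le: "x \<le> 1 + x\<^sup>2" for x :: real
    proof -
      have "0 \<le> (x - 1 / 2)\<^sup>2" by simp
      then have "x \<le> 1 / 4 + x\<^sup>2" by (simp add: power2_eq_square algebra_simps)
      then show ?thesis by simp
    qed
    have \<theta>_1: "\<bar>\<theta> \<omega>\<bar> \<le> c" for \<omega>
    proof -
      have "\<bar>q \<omega>\<bar> \<le> c * (1 + (norm (X s \<omega>))\<^sup>2)"
        using q[of \<omega>] mult_left_mono[OF x_le \<open>c \<ge> 0\<close>, of "norm (X s \<omega>)"] by linarith
      then show ?thesis
        unfolding \<theta>_def abs_divide using pos[of "norm (X s \<omega>)"] by (simp add: pos_divide_le_eq)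
    qed
    have \<theta>_2: "\<bar>\<theta> \<omega>\<bar> * norm (X s \<omega>) \<le> c" for \<omega>
    proof -
      have "\<bar>q \<omega>\<bar> * norm (X s \<omega>) \<le> c * norm (X s \<omega>) * norm (X s \<omega>)"
        using q[of \<omega>] by (rule mult_right_mono) simp
      also have "\<dots> \<le> c * (1 + (norm (X s \<omega>))\<^sup>2)"
        using \<open>c \<ge> 0\<close> by (simp add: power2_eq_square algebra_simps)
      finally show ?thesis
        unfolding \<theta>_def abs_divide using pos[of "norm (X s \<omega>)"] by (simp add: pos_divide_le_eq)
    qed
    note w = weighted[OF \<theta>_meas \<theta>_1 \<theta>_2]
    have lin: "bounded_linear (\<lambda>x. app v x \<bullet> b)"
      by (intro bounded_linear_inner_left_comp app.bounded_linear_right)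
    have eq: "app v (\<theta> \<omega> *\<^sub>R pullback s \<omega>) \<bullet> b = (q \<omega>)\<^sup>2 / (1 + (norm (X s \<omega>))\<^sup>2)" for \<omega>
      by (simp add: app.scaleR_right \<theta>_def q_def power2_eq_square)
    have int: "integrable M (\<lambda>\<omega>. (q \<omega>)\<^sup>2 / (1 + (norm (X s \<omega>))\<^sup>2))"
      using integrable_bounded_linear[OF lin conjunct1[OF w]] by (simp only: eq)
    have "expectation (\<lambda>\<omega>. (q \<omega>)\<^sup>2 / (1 + (norm (X s \<omega>))\<^sup>2)) = 0"
      using integral_bounded_linear[OF lin conjunct1[OF w]] conjunct2[OF w] by (simp only: eq inner_zero_left)
    then have "AE \<omega> in M. (q \<omega>)\<^sup>2 / (1 + (norm (X s \<omega>))\<^sup>2) = 0"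
      using integral_nonneg_eq_0_iff_AE[OF int] pos by (simp add: less_imp_le)
    then show ?thesis
    proof eventually_elim
      case (elim \<omega>)
      then show ?case using pos[of "norm (X s \<omega>)"] by (simp add: q_def)
    qed
  qed
  then have "AE \<omega> in M. \<forall>b\<in>Basis. app v (pullback s \<omega>) \<bullet> b = 0"
    by (intro AE_finite_allI) auto
  then show ?thesis
    by eventually_elim (simp add: euclidean_all_zero_iff)
qed

section \<open>From annihilating the solution to annihilating words\<close>

lemma annihilated_past:
  assumes "0 \<le> s" "s < t" "AE \<omega> in M. app u (pullback t \<omega>) = 0"
  shows "AE \<omega> in M. app u (pullback s \<omega>) = 0"
  using weighted_annihilation(1,2)[OF assms] by (intro zero_of_weighted_expectations assms(1)) blast

text \<open>The assumption passes from \<open>t\<close> to every \<open>r\<close> between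
  \<open>s\<close> and \<open>t\<close>, so the Riemann sums vanish in the limit over arbitrarily
  short intervals after \<open>s\<close>. There the coefficient is close to its value at
  \<open>s\<close>, and division by \<open>r - s\<close> isolates that value.\<close>

lemma annihilated_coefficient:
  assumes st: "0 \<le> s" "s < t" and u: "AE \<omega> in M. app u (pullback t \<omega>) = 0" and l: "l \<in> {1..m}"
  shows "AE \<omega> in M. app (u * coeff l s) (pullback s \<omega>) = 0"
proof (rule zero_of_weighted_expectations[OF st(1)])
  fix \<theta> K assume \<theta>: "\<theta> \<in> borel_measurable (F s)" "\<And>\<omega>. \<bar>\<theta> \<omega>\<bar> \<le> K" "\<And>\<omega>. \<bar>\<theta> \<omega>\<bar> * norm (X s \<omega>) \<le> K"
  define e where "e = expectation (\<lambda>\<omega>. \<theta> \<omega> *\<^sub>R pullback s \<omega>)"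
  let ?v = "app (u * coeff l s) e"
  have "norm ?v \<le> 0 + \<eta>" if "\<eta> > 0" for \<eta>
  proof -
    \<comment> \<open>A deviation \<eta>' of the coefficient is amplified by at most
      \<open>norm u\<close> and \<open>norm e\<close>; the summand 1 keeps the denominator
      positive.\<close>
    define \<eta>' where "\<eta>' = \<eta> / (norm u * norm e + 1)"
    have c_pos: "norm u * norm e + 1 > 0" by (simp add: add_nonneg_pos)
    then have \<eta>': "\<eta>' > 0" "\<eta>' * (norm u * norm e + 1) = \<eta>"
      using that by (auto simp: \<eta>'_def)
    have "isCont (coeff l) s"
      using continuous_on_conj_exp[of UNIV G "A l"] by (simp add: coeff_def continuous_on_eq_continuous_at)
    then obtain d where d: "d > 0" "\<And>q. dist q s < d \<Longrightarrow> dist (coeff l q) (coeff l s) < \<eta>'"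
      using \<eta>'(1) unfolding continuous_at_eps_delta by (metis dist_real_def dist_norm real_norm_def)
    \<comment> \<open>The interval from \<open>s\<close> to \<open>r\<close> has positive length,
      stays below \<open>t\<close>, and keeps the coefficient within \<eta>' of its value at
      \<open>s\<close>.\<close>
    define r where "r = min t (s + d / 2)"
    have r: "s < r" "r \<le> t" "r < s + d" using st d(1) by (auto simp: r_def)
    have u_r: "AE \<omega> in M. app u (pullback r \<omega>) = 0"
      using u annihilated_past[OF _ _ u, of r] r st by (cases "r = t") auto
    let ?h = "\<lambda>n. (r - s) / real (Suc n)"
    let ?S = "\<lambda>n. app u (?h n *\<^sub>R (\<Sum>j<Suc n. app (coeff l (grid s r n j)) e))"
    have lim: "?S \<longlonglongrightarrow> 0"
      using weighted_annihilation(3)[OF st(1) r(1) u_r \<theta> l] unfolding e_def .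
    have close: "norm ((r - s) *\<^sub>R ?v) \<le> norm (?S n) + (r - s) * \<eta>" for n
    proof -
      have "?S n = (\<Sum>j<Suc n. ?h n *\<^sub>R app u (app (coeff l (grid s r n j)) e))"
        by (simp only: app.scaleR_right app.sum_right scaleR_sum_right)
      moreover have "(r - s) *\<^sub>R ?v = (\<Sum>j<Suc n. ?h n *\<^sub>R app u (app (coeff l s) e))"
        by (simp add: scaleR_left.sum[symmetric] del: sum.lessThan_Suc of_nat_Suc)
      ultimately have diff: "(r - s) *\<^sub>R ?v - ?S n =
          (\<Sum>j<Suc n. ?h n *\<^sub>R app u (app (coeff l s - coeff l (grid s r n j)) e))"
        by (simp only: sum_subtractf[symmetric] scaleR_diff_right[symmetric] app.diff_right[symmetric] app.diff_left[symmetric])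
      have "norm ((r - s) *\<^sub>R ?v - ?S n) \<le> (\<Sum>j<Suc n. ?h n * \<eta>)"
        unfolding diff
      proof (rule sum_norm_le)
        fix j assume "j \<in> {..<Suc n}"
        then have "grid s r n j \<in> {s..r}" using grid_bounds[of s r j n] r by auto
        then have "dist (coeff l (grid s r n j)) (coeff l s) < \<eta>'"
          using r by (intro d(2)) (auto simp: dist_real_def)
        then have "norm (coeff l s - coeff l (grid s r n j)) \<le> \<eta>'" by (simp add: dist_norm norm_minus_commute)
        then have "norm (app u (app (coeff l s - coeff l (grid s r n j)) e)) \<le> norm u * (\<eta>' * norm e)"
          by (intro order_trans[OF norm_app] mult_left_mono mult_right_mono) auto
        also have "\<dots> \<le> \<eta>' * (norm u * norm e + 1)"
          using \<eta>'(1) by (simp add: algebra_simps)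
        finally have "norm (app u (app (coeff l s - coeff l (grid s r n j)) e)) \<le> \<eta>" using \<eta>'(2) by simp
        moreover have "\<bar>?h n\<bar> = ?h n" using r(1) by simp
        ultimately show "norm (?h n *\<^sub>R app u (app (coeff l s - coeff l (grid s r n j)) e)) \<le> ?h n * \<eta>"
          unfolding norm_scaleR by (metis abs_ge_zero mult_left_mono)
      qed
      also have "\<dots> = (r - s) * \<eta>" by (simp del: sum.lessThan_Suc of_nat_Suc)
      finally show ?thesis
        using norm_triangle_ineq[of "(r - s) *\<^sub>R ?v - ?S n" "?S n"] by simp
    qed
    have "(\<lambda>n. norm (?S n) + (r - s) * \<eta>) \<longlonglongrightarrow> 0 + (r - s) * \<eta>"
      by (intro tendsto_add tendsto_const tendsto_norm_zero lim)
    then have "norm ((r - s) *\<^sub>R ?v) \<le> 0 + (r - s) * \<eta>"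
      by (rule LIMSEQ_le_const) (use close in blast)
    then show ?thesis using r(1) by simp
  qed
  then have "norm ?v \<le> 0" by (rule field_le_epsilon)
  then show "integrable M (\<lambda>\<omega>. \<theta> \<omega> *\<^sub>R pullback s \<omega>) \<and> app (u * coeff l s) (expectation (\<lambda>\<omega>. \<theta> \<omega> *\<^sub>R pullback s \<omega>)) = 0"
    using weighted_annihilation(1)[OF st u \<theta>] by (simp add: e_def)
qed

text \<open>The first entry of a chain is the latest time.\<close>

fun chain_op :: "(real \<times> nat) list \<Rightarrow> 'b endo" where
  "chain_op [] = 1"
| "chain_op ((r, l) # rs) = coeff l r * chain_op rs"

fun chain_below :: "real \<Rightarrow> (real \<times> nat) list \<Rightarrow> bool" where
  "chain_below t [] \<longleftrightarrow> True"
| "chain_below t ((r, l) # rs) \<longleftrightarrow> 0 < r \<and> r < t \<and> l \<in> {1..m} \<and> chain_below r rs"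

text \<open>The latest coefficient is absorbed into \<open>u\<close>, which then annihilates the
  solution at that earlier time; at time 0 the solution is \<xi>.\<close>

lemma chain_annihilates:
  assumes "t > 0" "chain_below t rs" "AE \<omega> in M. app u (pullback t \<omega>) = 0"
  shows "app (u * chain_op rs) \<xi> = 0"
  using assms
proof (induction rs arbitrary: t u)
  case Nil
  have "AE \<omega> in M. app u \<xi> = 0"
    using annihilated_past[OF order_refl Nil(1,3)] X_0
    by eventually_elim (simp add: pullback_def)
  then show ?case by (simp add: AE_const)
next
  case (Cons rl rs)
  obtain r l where rl: "rl = (r, l)" by (cases rl)
  have "AE \<omega> in M. app (u * coeff l r) (pullback r \<omega>) = 0"
    using Cons.prems rl by (intro annihilated_coefficient[of r t u l]) auto
  then have "app (u * coeff l r * chain_op rs) \<xi> = 0"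
    using Cons.prems rl by (intro Cons.IH[of r]) auto
  then show ?case using rl by (simp add: mult.assoc)
qed

lemma chain_op_append: "chain_op (rs @ [(r, l)]) = chain_op rs * coeff l r"
  by (induction rs rule: chain_op.induct) (auto simp: mult.assoc)

text \<open>There is always room before the earliest time of a chain, down to 0, which is where the
  new time will tend.\<close>

lemma chain_below_append:
  assumes "chain_below t rs" "t > 0"
  shows "\<exists>r0>0. \<forall>r l. 0 < r \<and> r < r0 \<and> l \<in> {1..m} \<longrightarrow> chain_below t (rs @ [(r, l)])"
  using assms
proof (induction t rs rule: chain_below.induct)
  case (1 t)
  then show ?case by (intro exI[of _ t]) auto
next
  case (2 t r l rs)
  then show ?case by auto
qed

text \<open>A mixture of both sides: the later factors are still conjugations at the times of
  \<open>rs\<close>, the earlier ones are already iterated commutators from \<open>w\<close>. To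
  gain one letter, a new earliest time \<open>r\<close> is appended to \<open>rs\<close>; the
  induction hypothesis holds for all small \<open>r\<close>, and
  \<open>ad_vanishes_of_conj_exp\<close> extracts the commutators at 0. This is why
  \<open>rs\<close> is arbitrary in the induction.\<close>

lemma word_annihilated:
  assumes "t > 0" "AE \<omega> in M. app u (pullback t \<omega>) = 0" "snd ` set w \<subseteq> {1..m}" "chain_below t rs"
  shows "app (u * chain_op rs) (foldr (\<lambda>(n, l) v. app (ad G n (A l)) v) w \<xi>) = 0"
  using assms(3,4)
proof (induction w arbitrary: rs)
  case Nil
  then show ?case using chain_annihilates[OF assms(1) _ assms(2)] by simp
next
  case (Cons nl w)
  obtain n l where nl: "nl = (n, l)" by (cases nl)
  define v where "v = foldr (\<lambda>(n, l) v. app (ad G n (A l)) v) w \<xi>"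
  have l: "l \<in> {1..m}" using Cons.prems nl by auto
  obtain r0 where r0: "r0 > 0" "\<And>r. 0 < r \<Longrightarrow> r < r0 \<Longrightarrow> chain_below t (rs @ [(r, l)])"
    using chain_below_append[OF Cons.prems(2) assms(1)] l by blast
  have lin: "bounded_linear (\<lambda>x. app (u * chain_op rs * x) v)"
    by (intro bounded_linear_compose[OF app.bounded_linear_left] bounded_linear_mult_right)
  have "app (u * chain_op rs * ad G n (A l)) v = 0"
  proof (rule ad_vanishes_of_conj_exp[OF lin r0(1)])
    fix r assume r: "0 < r" "r < r0"
    have "app (u * chain_op (rs @ [(r, l)])) v = 0"
      unfolding v_def using Cons.prems(1) r0(2)[OF r] by (intro Cons.IH) auto
    then show "app (u * chain_op rs * conj_exp G (A l) r) v = 0"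
      by (simp only: chain_op_append coeff_def mult.assoc)
  qed
  then show ?case by (simp add: nl v_def)
qed

text \<open>The partial sums of the commutator series stay in \<open>V\<close>, and a subspace of a
  Euclidean space is closed.\<close>

lemma coeff_invariant:
  assumes V: "subspace V" and inv: "\<And>n v. v \<in> V \<Longrightarrow> app (ad G n (A l)) v \<in> V" and v: "v \<in> V"
  shows "app (coeff l q) v \<in> V"
proof -
  have "(\<lambda>n. ((- q) ^ n * inverse (fact n)) *\<^sub>R ad G n (A l)) sums coeff l q"
    unfolding coeff_def conj_exp_series by (rule summable_sums[OF summable_conj_exp_series])
  from app.bounded_linear_left[THEN bounded_linear.sums, OF this, of v]
  have lim: "(\<lambda>n. \<Sum>k<n. app (((- q) ^ k * inverse (fact k)) *\<^sub>R ad G k (A l)) v) \<longlonglongrightarrow> app (coeff l q) v"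
    by (simp add: sums_def)
  have mem: "(\<Sum>k<n. app (((- q) ^ k * inverse (fact k)) *\<^sub>R ad G k (A l)) v) \<in> V" for n
    unfolding app.scaleR_left by (intro subspace_sum[OF V] subspace_scale[OF V] inv v)
  show ?thesis
    by (rule closed_sequentially[OF closed_subspace[OF V] mem lim])
qed

text \<open>An Euler path that starts in \<open>V\<close> never leaves it. Since \<open>P\<close>
  kills \<open>V\<close>, the weighted image of the solution under \<open>P\<close> is bounded by
  \<open>norm P\<close> times the error of the scheme.\<close>

lemma stays_in_invariant_subspace:
  assumes V: "subspace V" and inv: "\<And>n l v. l \<in> {1..m} \<Longrightarrow> v \<in> V \<Longrightarrow> app (ad G n (A l)) v \<in> V"
    and \<xi>: "\<xi> \<in> V" and P: "\<And>v. v \<in> V \<Longrightarrow> app P v = 0" and "t > 0"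
  shows "AE \<omega> in M. app P (pullback t \<omega>) = 0"
proof -
  \<comment> \<open>The start equals \<xi> only almost surely, whereas the bounds on a weight are
    required at every outcome. This weight meets them and is positive everywhere, so that it can be
    divided out at the end.\<close>
  define \<theta> where "\<theta> \<omega> = 1 / (1 + (norm (X 0 \<omega>))\<^sup>2)" for \<omega>
  have X0 [measurable]: "X 0 \<in> borel_measurable (F 0)" by (intro X_adapted) auto
  have \<theta>_meas: "\<theta> \<in> borel_measurable (F 0)" unfolding \<theta>_def by measurable
  have pos: "0 < 1 + x\<^sup>2" for x :: real by (simp add: add_pos_nonneg)
  have \<theta>_pos: "\<theta> \<omega> > 0" for \<omega> using pos by (simp add: \<theta>_def)
  have \<theta>_1: "\<bar>\<theta> \<omega>\<bar> \<le> 1" for \<omega>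
    using pos[of "norm (X 0 \<omega>)"] by (simp add: \<theta>_def)
  have \<theta>_2: "\<bar>\<theta> \<omega>\<bar> * norm (X 0 \<omega>) \<le> 1" for \<omega>
  proof -
    have "2 * norm (X 0 \<omega>) \<le> 1 + (norm (X 0 \<omega>))\<^sup>2"
      using sum_squares_bound[of 1 "norm (X 0 \<omega>)"] by simp
    then have "norm (X 0 \<omega>) \<le> 1 + (norm (X 0 \<omega>))\<^sup>2"
      using norm_ge_zero[of "X 0 \<omega>"] by linarith
    then show ?thesis using pos[of "norm (X 0 \<omega>)"] by (simp add: \<theta>_def)
  qed
  define y where "y \<omega> = \<theta> \<omega> *\<^sub>R pullback 0 \<omega>" for \<omega>
  have euler_V: "euler 0 t n y i \<omega> \<in> V" if "y \<omega> \<in> V" for n i \<omega>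
  proof (induction i)
    case (Suc i)
    then show ?case
      by (auto intro!: subspace_add[OF V] subspace_sum[OF V] subspace_scale[OF V] coeff_invariant[OF V inv])
  qed (use that in simp)
  have y_V: "AE \<omega> in M. y \<omega> \<in> V"
    using X_0
  proof eventually_elim
    case (elim \<omega>)
    show ?case unfolding y_def pullback_def elim by (simp add: subspace_scale[OF V \<xi>])
  qed
  have pb_M [measurable]: "pullback t \<in> borel_measurable M" "\<theta> \<in> borel_measurable M"
    using measurable_F_M[OF pullback_measurable[of t t]] measurable_F_M[OF \<theta>_meas] \<open>t > 0\<close> by auto
  note y_meas = weighted_start(1)[OF order_refl \<theta>_meas \<theta>_2, folded y_def]
    and y2 = weighted_start(2)[OF order_refl \<theta>_meas \<theta>_2, folded y_def]
  have e_M [measurable]: "euler 0 t n y (Suc n) \<in> borel_measurable M" for n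
  proof -
    have "euler 0 t n y (Suc n) \<in> borel_measurable (F (grid 0 t n (Suc n)))"
      using euler_moments[OF order_refl \<open>t > 0\<close> y_meas y2] by (metis order_refl)
    then show ?thesis using \<open>t > 0\<close> by (intro measurable_F_M[of _ t]) (simp_all del: euler.simps)
  qed
  have "AE \<omega> in M. app P (\<theta> \<omega> *\<^sub>R pullback t \<omega>) = 0"
  proof (rule AE_zero_of_tails)
    fix \<epsilon> :: real assume "\<epsilon> > 0"
    \<comment> \<open>The left side does not depend on \<open>n\<close>; a constant sequence with
      limit 0 is 0.\<close>
    have "(\<lambda>n::nat. prob {\<omega> \<in> space M. norm (app P (\<theta> \<omega> *\<^sub>R pullback t \<omega>)) > \<epsilon>}) \<longlonglongrightarrow> 0"
    proof (rule tails_vanish_by_domination[OF _ _ _ \<open>\<epsilon> > 0\<close>])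
      show "AE \<omega> in M. norm (app P (\<theta> \<omega> *\<^sub>R pullback t \<omega>)) \<le>
          norm P * norm (\<theta> \<omega> *\<^sub>R pullback t \<omega> - euler 0 t n y (Suc n) \<omega>)" for n
        using y_V
      proof eventually_elim
        case (elim \<omega>)
        have "app P (\<theta> \<omega> *\<^sub>R pullback t \<omega>) = app P (\<theta> \<omega> *\<^sub>R pullback t \<omega> - euler 0 t n y (Suc n) \<omega>)"
          using P[OF euler_V[OF elim]] by (simp add: app.diff_right del: euler.simps)
        then show ?case by (simp only: norm_app)
      qed
      show "(\<lambda>n. prob {\<omega> \<in> space M. norm (\<theta> \<omega> *\<^sub>R pullback t \<omega> - euler 0 t n y (Suc n) \<omega>) > \<epsilon>}) \<longlonglongrightarrow> 0"
        if "\<epsilon> > 0" for \<epsilon>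
        using euler_converges[OF order_refl \<open>t > 0\<close> \<theta>_meas \<theta>_1 \<theta>_2 that] unfolding y_def[abs_def] .
    qed measurable
    then show "prob {\<omega> \<in> space M. norm (app P (\<theta> \<omega> *\<^sub>R pullback t \<omega>)) > \<epsilon>} = 0"
      by (simp add: LIMSEQ_const_iff)
  qed measurable
  then show ?thesis
  proof eventually_elim
    case (elim \<omega>)
    then show ?case using \<theta>_pos[of \<omega>] by (simp add: app.scaleR_right)
  qed
qed

end

section \<open>Matrices and the theorem\<close>

text \<open>A complex linear map that fixes one vector outside the span and kills a basis of the
  span. A matrix in place of a functional stays within the operator algebra.\<close>

lemma matrix_annihilating_span:
  fixes S :: "(complex^'d) set"
  assumes "vec.span S \<noteq> UNIV"
  shows "\<exists>P :: complex^'d^'d. P \<noteq> 0 \<and> (\<forall>v\<in>vec.span S. P *v v = 0)"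
proof -
  obtain a where a: "a \<notin> vec.span S" using assms by auto
  obtain B where B: "B \<subseteq> vec.span S" "vec.independent B" "vec.span S \<subseteq> vec.span B"
    using vec.maximal_independent_subset[of "vec.span S"] by blast
  have span_B: "vec.span B = vec.span S"
    using B(1,3) vec.span_minimal[OF B(1) vec.subspace_span] by auto
  then have ind: "vec.independent (insert a B)"
    using a B(2) vec.independent_insertI by blast
  obtain g where g: "Vector_Spaces.linear (*s) (*s) g" "\<forall>x\<in>insert a B. g x = (if x = a then a else 0)"
    using vec.linear_independent_extend[OF ind, of "\<lambda>x. if x = a then a else 0"] by blast
  have "a \<notin> B" using a B(1) by auto
  then have "g x = 0" if "x \<in> B" for x using g(2) that by auto
  then have "g v = 0" if "v \<in> vec.span S" for v
    using vec.linear_eq_0_on_span[OF g(1), of B v] that span_B by blast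
  moreover have "a \<noteq> 0" using a vec.span_zero by metis
  then have "g a \<noteq> 0" using g(2) by simp
  ultimately show ?thesis
    using matrix_works[OF g(1)] by (intro exI[of _ "matrix g"]) (metis matrix_vector_mult_0)
qed

section \<open>Complex matrices as real operators\<close>

definition matrix_endo :: "complex^'d^'d \<Rightarrow> (complex^'d) endo" where
  "matrix_endo A = endo_of ((*v) A)"

text \<open>Complex linearity of a real operator is commutation with all of these.\<close>

definition scalar_endo :: "complex \<Rightarrow> (complex^'d) endo" where
  "scalar_endo c = endo_of ((*s) c)"

lemma scaleR_eq_scalar: "r *\<^sub>R (v :: complex^'d) = complex_of_real r *s v"
  unfolding vec_eq_iff vector_scaleR_component vector_smult_component
  by (simp add: scaleR_conv_of_real)

lemma app_matrix_endo [simp]: "app (matrix_endo A) (v :: complex^'d) = A *v v"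
proof -
  have "linear ((*v) A)"
    by (rule linearI) (simp_all add: matrix_vector_right_distrib scaleR_eq_scalar vector_scalar_commute)
  then show ?thesis by (simp add: matrix_endo_def app_endo_of)
qed

lemma app_scalar_endo [simp]: "app (scalar_endo c) (v :: complex^'d) = c *s v"
proof -
  have "linear ((*s) c :: complex^'d \<Rightarrow> complex^'d)"
    by (rule linearI) (simp_all add: vec_eq_iff algebra_simps)
  then show ?thesis by (simp add: scalar_endo_def app_endo_of)
qed

lemma matrix_endo_delta: "matrix_endo (delta G n A) = ad (matrix_endo G) n (matrix_endo A)"
proof (induction n)
  case (Suc n)
  then show ?case
    by (intro endo_eqI)
      (simp add: commutator_def app.diff_left matrix_vector_mult_diff_rdistrib matrix_vector_mul_assoc[symmetric]
        Suc.IH[symmetric])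
qed simp

lemma exp_matrix_endo_scalar:
  "app (exp (r *\<^sub>R matrix_endo A)) (c *s v) = c *s app (exp (r *\<^sub>R matrix_endo A)) v"
proof -
  have "(r *\<^sub>R matrix_endo A) * scalar_endo c = scalar_endo c * (r *\<^sub>R matrix_endo A)"
    by (intro endo_eqI)
      (simp add: app.scaleR_left vector_scalar_commute scaleR_eq_scalar vector_smult_assoc mult.commute)
  note comm = exp_commute_left[OF this]
  have "app (exp (r *\<^sub>R matrix_endo A)) (c *s v) = app (exp (r *\<^sub>R matrix_endo A) * scalar_endo c) v"
    by simp
  also have "\<dots> = c *s app (exp (r *\<^sub>R matrix_endo A)) v"
    unfolding comm by simp
  finally show ?thesis .
qed

text \<open>Allows passing from a set to its complex span by \<open>vec.span_minimal\<close>,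
  although the exponential is only known as a real operator.\<close>

lemma kernel_complex_subspace:
  "vec.subspace {v. app (matrix_endo P * exp (r *\<^sub>R matrix_endo A)) v = 0}"
  unfolding vec.subspace_def
  by (auto simp: app.zero_right app.add_right matrix_vector_right_distrib exp_matrix_endo_scalar vector_scalar_commute)

text \<open>The complement of the essential range is the union of all open sets of probability zero.
  By Lindelof's theorem countably many of them have the same union, which is therefore avoided
  almost surely.\<close>

lemma AE_in_essential_range:
  fixes Y :: "'w \<Rightarrow> complex^'d"
  assumes "prob_space M" and Y: "Y \<in> borel_measurable M"
  shows "AE \<omega> in M. Y \<omega> \<in> essential_range M Y"
proof -
  interpret prob_space M by fact
  let ?N = "{U. open U \<and> measure M {\<omega> \<in> space M. Y \<omega> \<in> U} = 0}"
  have "\<And>U. U \<in> ?N \<Longrightarrow> open U" by simp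
  then obtain N' where N': "N' \<subseteq> ?N" "countable N'" "\<Union>N' = \<Union>?N"
    by (rule Lindelof)
  have "AE \<omega> in M. \<forall>U\<in>N'. Y \<omega> \<notin> U"
  proof (rule AE_ball_countable'[OF _ N'(2)])
    fix U assume "U \<in> N'"
    then have U: "open U" "measure M {\<omega> \<in> space M. Y \<omega> \<in> U} = 0" using N'(1) by auto
    have "{\<omega> \<in> space M. Y \<omega> \<in> U} \<in> events"
      using measurable_sets[OF Y borel_open[OF U(1)]] by (simp add: vimage_def Int_def conj_commute)
    then show "AE \<omega> in M. Y \<omega> \<notin> U"
      using U(2) by (subst AE_iff_measurable[of "{\<omega> \<in> space M. Y \<omega> \<in> U}"]) (auto simp: emeasure_eq_measure)
  qed
  then show ?thesis
  proof eventually_elim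
    case (elim \<omega>)
    show ?case
      unfolding essential_range_def
    proof (intro CollectI allI impI)
      fix U assume U: "open U \<and> Y \<omega> \<in> U"
      then have "U \<notin> ?N" using elim N'(3) by blast
      then show "measure M {\<omega> \<in> space M. Y \<omega> \<in> U} > 0"
        using U by (simp add: less_le measure_nonneg)
    qed
  qed
qed

lemma essential_range_subset_closed:
  fixes Y :: "'w \<Rightarrow> complex^'d"
  assumes "closed C" and AE: "AE \<omega> in M. Y \<omega> \<in> C"
  shows "essential_range M Y \<subseteq> C"
proof
  fix u assume u: "u \<in> essential_range M Y"
  show "u \<in> C"
  proof (rule ccontr)
    assume "u \<notin> C"
    then have "measure M {\<omega> \<in> space M. Y \<omega> \<in> - C} > 0"
      using u \<open>closed C\<close> by (auto simp: essential_range_def open_Compl)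
    \<comment> \<open>In either case \<open>measure\<close> gives 0, by nullity or by its value
      outside the measurable sets.\<close>
    moreover have "{\<omega> \<in> space M. Y \<omega> \<in> - C} \<in> null_sets M \<or> {\<omega> \<in> space M. Y \<omega> \<in> - C} \<notin> sets M"
      using AE AE_iff_null_sets[of "{\<omega> \<in> space M. Y \<omega> \<in> - C}" M] by (auto elim!: eventually_mono)
    ultimately show False
      by (auto simp: measure_notin_sets measure_eq_0_null_sets)
  qed
qed

lemma foldr_delta_in_S_space:
  "set w \<subseteq> UNIV \<times> {1..m} \<Longrightarrow> foldr (\<lambda>(n, l) v. delta G n (L l) *v v) w \<psi> \<in> S_space m G L \<psi>"
  unfolding S_space_def by (cases "w = []") (auto intro!: vec.span_base)

text \<open>Multiplication from the left lengthens a word by one letter, and the generator \<psi>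
  itself is the empty word; complex linearity carries this over to the span.\<close>

lemma S_space_invariant:
  assumes l: "l \<in> {1..m}" and v: "v \<in> S_space m G L \<psi>"
  shows "delta G n (L l) *v v \<in> S_space m G L \<psi>"
proof -
  let ?D = "delta G n (L l)"
  let ?words = "insert \<psi> {foldr (\<lambda>(n, l) v. delta G n (L l) *v v) w \<psi> | w. w \<noteq> [] \<and> set w \<subseteq> UNIV \<times> {1..m}}"
  have "vec.subspace {v. ?D *v v \<in> S_space m G L \<psi>}"
    using vec.subspace_span unfolding S_space_def vec.subspace_def
    by (auto simp: matrix_vector_right_distrib vector_scalar_commute)
  moreover have "?words \<subseteq> {v. ?D *v v \<in> S_space m G L \<psi>}"
  proof
    fix x assume "x \<in> ?words"
    then obtain w where w: "set w \<subseteq> UNIV \<times> {1..m}" "x = foldr (\<lambda>(n, l) v. delta G n (L l) *v v) w \<psi>"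
      by (auto intro: that[of "[]"])
    then show "x \<in> {v. ?D *v v \<in> S_space m G L \<psi>}"
      using foldr_delta_in_S_space[of "(n, l) # w" m G L \<psi>] l by simp
  qed
  ultimately have "vec.span ?words \<subseteq> {v. ?D *v v \<in> S_space m G L \<psi>}"
    by (intro vec.span_minimal)
  then show ?thesis using v unfolding S_space_def by blast
qed

lemma linear_sde_of_lsse:
  assumes "filtered_complete_prob_space M F" "independent_wiener_processes M F m W"
    and "lsse_solution M F m W G L \<xi> X"
  shows "linear_sde M F m W (matrix_endo G) (\<lambda>l. matrix_endo (L l)) \<xi> X"
proof -
  interpret wiener_system M F m W by unfold_locales fact+
  show ?thesis
    using assms(3) by unfold_locales (simp_all add: lsse_solution_def)
qed

text \<open>Each direction by contradiction, with a nonzero matrix annihilating the span that is too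
  small. An exponential carries the annihilator from one of the two spaces to the other; being
  invertible, it cannot turn a nonzero annihilator into zero.\<close>

lemma total_iff_S_space:
  fixes G :: "complex^'d^'d"
  assumes sde: "linear_sde M F m W (matrix_endo G) (\<lambda>l. matrix_endo (L l)) \<xi> X" and "t > 0"
  shows "total_set (essential_range M (X t)) \<longleftrightarrow> S_space m G L \<xi> = UNIV"
proof -
  interpret linear_sde M F m W "matrix_endo G" "\<lambda>l. matrix_endo (L l)" \<xi> X by (rule sde)
  let ?E = "\<lambda>r. exp (r *\<^sub>R matrix_endo G)"
  have inv: "?E t * ?E (- t) = 1" "?E (- t) * ?E t = 1"
    using exp_minus_inverse[of "t *\<^sub>R matrix_endo G"] exp_minus_inverse[of "- t *\<^sub>R matrix_endo G"] by auto
  have P_zero: "P = 0" if "\<And>v. app (matrix_endo P * ?E r) v = 0" "r = t \<or> r = - t" for P r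
  proof -
    have "?E r * ?E (- r) = 1" using inv that(2) by auto
    then have "matrix_endo P = (matrix_endo P * ?E r) * ?E (- r)" by (simp add: mult.assoc)
    then have "P *v v = 0" for v
      using that(1)[of "app (?E (- r)) v"] by (metis app_matrix_endo app_times)
    then show ?thesis by (simp add: matrix_eq)
  qed
  have X_M: "X t \<in> borel_measurable M" using X_measurable \<open>t > 0\<close> by simp
  show ?thesis
  proof
    assume total: "total_set (essential_range M (X t))"
    show "S_space m G L \<xi> = UNIV"
    proof (rule ccontr)
      assume "S_space m G L \<xi> \<noteq> UNIV"
      then obtain P :: "complex^'d^'d" where P: "P \<noteq> 0" "\<forall>v\<in>S_space m G L \<xi>. P *v v = 0"
        unfolding S_space_def using matrix_annihilating_span by blast
      have "AE \<omega> in M. app (matrix_endo P) (pullback t \<omega>) = 0"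
      proof (rule stays_in_invariant_subspace[OF _ _ _ _ \<open>t > 0\<close>])
        \<comment> \<open>The confinement argument wants a real subspace; a complex one qualifies,
          as real scaling is multiplication by a real complex number.\<close>
        show "subspace (S_space m G L \<xi>)"
          using vec.subspace_span unfolding S_space_def subspace_def vec.subspace_def scaleR_eq_scalar by blast
        show "app (ad (matrix_endo G) n (matrix_endo (L l))) v \<in> S_space m G L \<xi>"
          if "l \<in> {1..m}" "v \<in> S_space m G L \<xi>" for n l v
          using S_space_invariant[OF that] by (simp add: matrix_endo_delta[symmetric])
        show "\<xi> \<in> S_space m G L \<xi>" using foldr_delta_in_S_space[of "[]"] by simp
      qed (use P in simp)
      then have "AE \<omega> in M. X t \<omega> \<in> {v. app (matrix_endo P * ?E (- t)) v = 0}"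
        by (simp add: pullback_def)
      moreover have "closed {v. app (matrix_endo P * ?E (- t)) v = 0}"
        by (intro closed_Collect_eq continuous_on_const linear_continuous_on app.bounded_linear_right)
      ultimately have "essential_range M (X t) \<subseteq> {v. app (matrix_endo P * ?E (- t)) v = 0}"
        by (intro essential_range_subset_closed)
      then have "vec.span (essential_range M (X t)) \<subseteq> {v. app (matrix_endo P * ?E (- t)) v = 0}"
        by (rule vec.span_minimal[OF _ kernel_complex_subspace])
      then have "app (matrix_endo P * ?E (- t)) v = 0" for v
        using total by (auto simp: total_set_def)
      then show False using P_zero P(1) by blast
    qed
  next
    assume S: "S_space m G L \<xi> = UNIV"
    show "total_set (essential_range M (X t))"
    proof (rule ccontr)
      assume "\<not> total_set (essential_range M (X t))"
      then obtain P :: "complex^'d^'d" where P: "P \<noteq> 0" "\<forall>v\<in>vec.span (essential_range M (X t)). P *v v = 0"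
        unfolding total_set_def using matrix_annihilating_span by blast
      \<comment> \<open>The factor \<open>exp(tG)\<close> undoes the pull back, so \<open>?u\<close>
        applied to the pulled back solution is \<open>P\<close> applied to \<open>X t\<close>, which
        lies in the essential range almost surely.\<close>
      let ?u = "matrix_endo P * ?E t"
      have "AE \<omega> in M. app ?u (pullback t \<omega>) = 0"
        using AE_in_essential_range[OF prob_space_axioms X_M]
      proof eventually_elim
        case (elim \<omega>)
        have "app ?u (pullback t \<omega>) = app (matrix_endo P * (?E t * ?E (- t))) (X t \<omega>)"
          by (simp add: pullback_def)
        also have "\<dots> = 0"
          using P(2) elim vec.span_base unfolding inv by auto
        finally show ?case .
      qed
      note words = word_annihilated[OF \<open>t > 0\<close> this _ chain_below.simps(1)[THEN iffD2, OF TrueI], simplified]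
      have "foldr (\<lambda>(n, l) v. delta G n (L l) *v v) w \<xi> \<in> {v. app ?u v = 0}" if "set w \<subseteq> UNIV \<times> {1..m}" for w
      proof -
        have "snd ` set w \<subseteq> {1..m}" using that by auto
        moreover have "app (matrix_endo A) = (*v) A" for A :: "complex^'d^'d"
          by (rule ext) simp
        ultimately show ?thesis using words[of w] by (simp add: matrix_endo_delta[symmetric])
      qed
      from this[of "[]"] this have "insert \<xi> {foldr (\<lambda>(n, l) v. delta G n (L l) *v v) w \<xi> | w. w \<noteq> [] \<and> set w \<subseteq> UNIV \<times> {1..m}} \<subseteq> {v. app ?u v = 0}"
        by auto
      then have "S_space m G L \<xi> \<subseteq> {v. app ?u v = 0}"
        unfolding S_space_def by (rule vec.span_minimal[OF _ kernel_complex_subspace])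
      then have "app ?u v = 0" for v using S by auto
      then show False using P_zero P(1) by blast
    qed
  qed
qed

theorem theorem8:
  fixes L :: "nat \<Rightarrow> complex^'d^'d" and H :: "complex^'d^'d" and m :: nat
    and M :: "'w measure" and F :: "real \<Rightarrow> 'w measure"
    and W :: "nat \<Rightarrow> real \<Rightarrow> 'w \<Rightarrow> real"
    and X :: "complex^'d \<Rightarrow> real \<Rightarrow> 'w \<Rightarrow> complex^'d"
  assumes H: "adj H = H"
    and space: "filtered_complete_prob_space M F"
    and W: "independent_wiener_processes M F m W"
    and X: "\<And>\<xi>. \<xi> \<noteq> 0 \<Longrightarrow> lsse_solution M F m W (G_op m L H) L \<xi> (X \<xi>)"
  shows "(\<forall>\<psi>. \<psi> \<noteq> 0 \<longrightarrow> S_space m (G_op m L H) L \<psi> = UNIV) \<longleftrightarrow>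
         (\<forall>t>0. \<forall>\<xi>. \<xi> \<noteq> 0 \<longrightarrow> total_set (essential_range M (X \<xi> t)))"
proof -
  have eq: "total_set (essential_range M (X \<xi> t)) \<longleftrightarrow> S_space m (G_op m L H) L \<xi> = UNIV"
    if "\<xi> \<noteq> 0" "t > 0" for \<xi> t
    by (rule total_iff_S_space[OF linear_sde_of_lsse[OF space W X[OF that(1)]] that(2)])
  \<comment> \<open>The condition on \<open>S_space\<close> does not involve the time; it is
    recovered from totality at the single time 1.\<close>
  show ?thesis
    using eq zero_less_one by blast
qed

end
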